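(* Let $n\ge 3$, $p,q>1$, and let $D_1,D_2,V_1,V_2$ satisfy the standing assumptions (A). Consider the Cauchy problem (S) with nonlinearities $N_1(v,v_t)=|v_t|^p$ and $N_2(u,u_t)=|u_t|^q$, with initial data as in (D). Assume $\Gamma_{GG}(n,p,q)\ge0$. Then every weak solution $(u,v)$ of (S) (in the sense defined in the context, with $u_t\in L^q_{loc}((0,T)\times\mathbb{R}^n)$, $v_t\in L^p_{loc}((0,T)\times\mathbb{R}^n)$) satisfying $\operatorname{supp}(u,v)\subset\{(t,x):|x|\le t+R\}$ blows up in finite time. Moreover, there exist $\varepsilon_0>0$ and $C>0$ independent of $\varepsilon$ such that for all $\varepsilon\in(0,\varepsilon_0)$, $$T_\varepsilon\le\begin{cases} C\,\varepsilon^{-\Gamma_{GG}(n,p,q)^{-1}}, & \Gamma_{GG}(n,p,q)>0,\\ \exp\big(C\varepsilon^{-(pq-1)}\big), & \Gamma_{GG}(n,p,q)=0,\ p\ne q,\\ \exp\big(C\varepsilon^{-(p-1)}\big), & \Gamma_{GG}(n,p,q)=0,\ p=q.\end{cases}$$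
   Context: System (S): for $(t,x)\in(0,T)\times\mathbb{R}^n$, $u_{tt}-\Delta u+D_1(x)u_t+V_1(x)u=N_1(v,v_t)$, $v_{tt}-\Delta v+D_2(x)v_t+V_2(x)v=N_2(u,u_t)$, with $u(0,x)=\varepsilon u_0(x)$, $u_t(0,x)=\varepsilon u_1(x)$, $v(0,x)=\varepsilon v_0(x)$, $v_t(0,x)=\varepsilon v_1(x)$, where $\varepsilon>0$ is a small parameter. (D): $u_0,u_1,v_0,v_1\in C_c^\infty(\mathbb{R}^n)$ are nonnegative, $(u_0,u_1)$ and $(v_0,v_1)$ are each nontrivial, and all are supported in $B_R=\{x:|x|\le R\}$ for some $R>0$. (A): for $i=1,2$, $D_i,V_i\in C(\mathbb{R}^n)\cap C^\delta(B_\delta)$ for some $\delta>0$, are radial, and $0\le D_i(x)\le \alpha_1(1+|x|)^{-\beta}$, $0\le V_i(x)\le\alpha_2(1+|x|)^{-\omega}$ with constants $\alpha_1,\alpha_2\ge0$, $\beta>1$, $\omega>2$. Weak solution on $[0,T)$: $u,v\in C([0,T),H^1(\mathbb{R}^n))\cap C^1([0,T),L^2(\mathbb{R}^n))$ with the stated local integrability, such that for every $\Psi\in C_0^\infty([0,T)\times\mathbb{R}^n)$, $\varepsilon\int u_1\Psi(0,x)dx+\varepsilon\int u_0D_1\Psi(0,x)dx+\int_0^T\!\!\int N_1(v,v_t)\Psi\,dxdt=-\int_0^T\!\!\int u_t\Psi_t\,dxdt+\int_0^T\!\!\int\nabla u\cdot\nabla\Psi\,dxdt-\int_0^T\!\!\int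 uD_1\Psi_t\,dxdt+\int_0^T\!\!\int V_1u\Psi\,dxdt$, and the analogous identity with $(u,u_0,u_1,D_1,V_1,N_1(v,v_t))$ replaced by $(v,v_0,v_1,D_2,V_2,N_2(u,u_t))$. The lifespan $T_\varepsilon$ is the supremum of all $T$ for which such a weak solution exists. $\Gamma_{GG}(n,p,q)=\max\Big\{\frac{p+1}{pq-1},\frac{q+1}{pq-1}\Big\}-\frac{n-1}{2}$. *)

theory Defs
  imports "HOL-Analysis.Analysis"
begin

fun iter_dd :: "('b::real_normed_vector \<Rightarrow> real) \<Rightarrow> 'b list \<Rightarrow> 'b \<Rightarrow> real" where
  "iter_dd f [] = f"
| "iter_dd f (v # vs) = (\<lambda>x. frechet_derivative (iter_dd f vs) (at x) v)"

definition smooth_fun :: "('b::real_normed_vector \<Rightarrow> real) \<Rightarrow> bool" where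
  "smooth_fun f \<longleftrightarrow> (\<forall>vs x. iter_dd f vs differentiable (at x))"

definition Cc_inf :: "('b::real_normed_vector \<Rightarrow> real) \<Rightarrow> bool" where
  "Cc_inf f \<longleftrightarrow> smooth_fun f \<and> (\<exists>K. compact K \<and> (\<forall>x. x \<notin> K \<longrightarrow> f x = 0))"

text \<open>Test functions in C_0^infinity([0,T) x R^n): smooth on R x R^n, vanishing outside
  a compact subset of (-infinity,T) x R^n.\<close>
definition test_fun :: "real \<Rightarrow> (real \<times> 'a::euclidean_space \<Rightarrow> real) \<Rightarrow> bool" where
  "test_fun T \<Psi> \<longleftrightarrow> smooth_fun \<Psi> \<and>
     (\<exists>K. compact K \<and> K \<subseteq> {z. fst z < T} \<and> (\<forall>z. z \<notin> K \<longrightarrow> \<Psi> z = 0))"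

definition radial :: "('a::real_normed_vector \<Rightarrow> real) \<Rightarrow> bool" where
  "radial f \<longleftrightarrow> (\<forall>x y. norm x = norm y \<longrightarrow> f x = f y)"

definition hoelder_ball :: "real \<Rightarrow> ('a::real_normed_vector \<Rightarrow> real) \<Rightarrow> bool" where
  "hoelder_ball \<delta> f \<longleftrightarrow> (\<exists>L. \<forall>x\<in>cball 0 \<delta>. \<forall>y\<in>cball 0 \<delta>.
      \<bar>f x - f y\<bar> \<le> L * norm (x - y) powr \<delta>)"

definition is_L2 :: "('a::euclidean_space \<Rightarrow> 'c::{real_normed_vector, second_countable_topology}) \<Rightarrow> bool" where
  "is_L2 f \<longleftrightarrow> f \<in> borel_measurable lborel \<and> integrable lborel (\<lambda>x. (norm (f x))\<^sup>2)"

definition L2norm :: "('a::euclidean_space \<Rightarrow> 'c::real_normed_vector) \<Rightarrow> real" where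
  "L2norm f = sqrt (\<integral>x. (norm (f x))\<^sup>2 \<partial>lborel)"

definition weak_grad :: "('a::euclidean_space \<Rightarrow> real) \<Rightarrow> ('a \<Rightarrow> 'a) \<Rightarrow> bool" where
  "weak_grad f g \<longleftrightarrow> (\<forall>\<phi>. Cc_inf \<phi> \<longrightarrow> (\<forall>e\<in>Basis.
      (\<integral>x. f x * frechet_derivative \<phi> (at x) e \<partial>lborel) = - (\<integral>x. (g x \<bullet> e) * \<phi> x \<partial>lborel)))"

definition is_H1 :: "('a::euclidean_space \<Rightarrow> real) \<Rightarrow> ('a \<Rightarrow> 'a) \<Rightarrow> bool" where
  "is_H1 f g \<longleftrightarrow> is_L2 f \<and> is_L2 g \<and> weak_grad f g"

definition C_H1 :: "real \<Rightarrow> (real \<Rightarrow> 'a::euclidean_space \<Rightarrow> real) \<Rightarrow> (real \<Rightarrow> 'a \<Rightarrow> 'a) \<Rightarrow> bool" where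
  "C_H1 T w gw \<longleftrightarrow> (\<forall>t\<in>{0..<T}. is_H1 (w t) (gw t)) \<and>
     (\<forall>t\<in>{0..<T}. ((\<lambda>s. L2norm (\<lambda>x. w s x - w t x) + L2norm (\<lambda>x. gw s x - gw t x))
        \<longlongrightarrow> 0) (at t within {0..<T}))"

definition C1_L2 :: "real \<Rightarrow> (real \<Rightarrow> 'a::euclidean_space \<Rightarrow> real) \<Rightarrow> (real \<Rightarrow> 'a \<Rightarrow> real) \<Rightarrow> bool" where
  "C1_L2 T w wt \<longleftrightarrow> (\<forall>t\<in>{0..<T}. is_L2 (w t) \<and> is_L2 (wt t)) \<and>
     (\<forall>t\<in>{0..<T}. ((\<lambda>s. L2norm (\<lambda>x. (w s x - w t x) / (s - t) - wt t x)) \<longlongrightarrow> 0)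
        (at t within {0..<T})) \<and>
     (\<forall>t\<in>{0..<T}. ((\<lambda>s. L2norm (\<lambda>x. wt s x - wt t x)) \<longlongrightarrow> 0) (at t within {0..<T}))"

definition Lp_loc :: "real \<Rightarrow> real \<Rightarrow> (real \<Rightarrow> 'a::euclidean_space \<Rightarrow> real) \<Rightarrow> bool" where
  "Lp_loc T r f \<longleftrightarrow> (\<lambda>z. f (fst z) (snd z)) \<in> borel_measurable lborel \<and>
     (\<forall>K. compact K \<and> K \<subseteq> {0<..<T} \<times> UNIV \<longrightarrow>
        set_integrable lborel K (\<lambda>z. \<bar>f (fst z) (snd z)\<bar> powr r))"

text \<open>Weak identity for  w_tt - Lap w + D w_t + V w = N, w(0)=eps w0, w_t(0)=eps w1,
  where N is the (already evaluated) nonlinear term; all integrals are required to exist.\<close>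
definition weak_eq :: "real \<Rightarrow> real \<Rightarrow> ('a::euclidean_space \<Rightarrow> real) \<Rightarrow> ('a \<Rightarrow> real)
    \<Rightarrow> ('a \<Rightarrow> real) \<Rightarrow> ('a \<Rightarrow> real) \<Rightarrow> (real \<Rightarrow> 'a \<Rightarrow> real)
    \<Rightarrow> (real \<Rightarrow> 'a \<Rightarrow> real) \<Rightarrow> (real \<Rightarrow> 'a \<Rightarrow> real) \<Rightarrow> (real \<Rightarrow> 'a \<Rightarrow> 'a) \<Rightarrow> bool" where
  "weak_eq T \<epsilon> D V w0 w1 N w wt gw \<longleftrightarrow> (\<forall>\<Psi>. test_fun T \<Psi> \<longrightarrow>
     set_integrable lborel ({0<..<T} \<times> UNIV) (\<lambda>(t,x). N t x * \<Psi> (t,x)) \<and>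
     set_integrable lborel ({0<..<T} \<times> UNIV) (\<lambda>(t,x). wt t x * frechet_derivative \<Psi> (at (t,x)) (1,0)) \<and>
     set_integrable lborel ({0<..<T} \<times> UNIV) (\<lambda>(t,x). frechet_derivative \<Psi> (at (t,x)) (0, gw t x)) \<and>
     set_integrable lborel ({0<..<T} \<times> UNIV) (\<lambda>(t,x). w t x * D x * frechet_derivative \<Psi> (at (t,x)) (1,0)) \<and>
     set_integrable lborel ({0<..<T} \<times> UNIV) (\<lambda>(t,x). V x * w t x * \<Psi> (t,x)) \<and>
     \<epsilon> * (\<integral>x. w1 x * \<Psi> (0,x) \<partial>lborel) + \<epsilon> * (\<integral>x. w0 x * D x * \<Psi> (0,x) \<partial>lborel)
       + (LINT z:{0<..<T} \<times> UNIV|lborel. (\<lambda>(t,x). N t x * \<Psi> (t,x)) z)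
     = - (LINT z:{0<..<T} \<times> UNIV|lborel. (\<lambda>(t,x). wt t x * frechet_derivative \<Psi> (at (t,x)) (1,0)) z)
       + (LINT z:{0<..<T} \<times> UNIV|lborel. (\<lambda>(t,x). frechet_derivative \<Psi> (at (t,x)) (0, gw t x)) z)
       - (LINT z:{0<..<T} \<times> UNIV|lborel. (\<lambda>(t,x). w t x * D x * frechet_derivative \<Psi> (at (t,x)) (1,0)) z)
       + (LINT z:{0<..<T} \<times> UNIV|lborel. (\<lambda>(t,x). V x * w t x * \<Psi> (t,x)) z))"

definition weak_solution :: "real \<Rightarrow> real \<Rightarrow> ('a::euclidean_space \<Rightarrow> real) \<Rightarrow> ('a \<Rightarrow> real)
    \<Rightarrow> ('a \<Rightarrow> real) \<Rightarrow> ('a \<Rightarrow> real) \<Rightarrow> ('a \<Rightarrow> real) \<Rightarrow> ('a \<Rightarrow> real) \<Rightarrow> ('a \<Rightarrow> real) \<Rightarrow> ('a \<Rightarrow> real)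
    \<Rightarrow> real \<Rightarrow> real
    \<Rightarrow> (real \<Rightarrow> 'a \<Rightarrow> real) \<Rightarrow> (real \<Rightarrow> 'a \<Rightarrow> real) \<Rightarrow> (real \<Rightarrow> 'a \<Rightarrow> 'a)
    \<Rightarrow> (real \<Rightarrow> 'a \<Rightarrow> real) \<Rightarrow> (real \<Rightarrow> 'a \<Rightarrow> real) \<Rightarrow> (real \<Rightarrow> 'a \<Rightarrow> 'a) \<Rightarrow> bool" where
  "weak_solution p q D1 D2 V1 V2 u0 u1 v0 v1 \<epsilon> T u ut gu v vt gv \<longleftrightarrow>
     0 < T \<and>
     C_H1 T u gu \<and> C1_L2 T u ut \<and> C_H1 T v gv \<and> C1_L2 T v vt \<and>
     Lp_loc T q ut \<and> Lp_loc T p vt \<and>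
     (AE x in lborel. u 0 x = \<epsilon> * u0 x) \<and> (AE x in lborel. v 0 x = \<epsilon> * v0 x) \<and>
     weak_eq T \<epsilon> D1 V1 u0 u1 (\<lambda>t x. \<bar>vt t x\<bar> powr p) u ut gu \<and>
     weak_eq T \<epsilon> D2 V2 v0 v1 (\<lambda>t x. \<bar>ut t x\<bar> powr q) v vt gv"

definition supp_in_cone :: "real \<Rightarrow> real \<Rightarrow> (real \<Rightarrow> 'a::euclidean_space \<Rightarrow> real) \<Rightarrow> (real \<Rightarrow> 'a \<Rightarrow> real) \<Rightarrow> bool" where
  "supp_in_cone R T u v \<longleftrightarrow> (\<forall>t\<in>{0..<T}. AE x in lborel. norm x > t + R \<longrightarrow> u t x = 0 \<and> v t x = 0)"

definition lifespan :: "real \<Rightarrow> real \<Rightarrow> ('a::euclidean_space \<Rightarrow> real) \<Rightarrow> ('a \<Rightarrow> real)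
    \<Rightarrow> ('a \<Rightarrow> real) \<Rightarrow> ('a \<Rightarrow> real) \<Rightarrow> ('a \<Rightarrow> real) \<Rightarrow> ('a \<Rightarrow> real) \<Rightarrow> ('a \<Rightarrow> real) \<Rightarrow> ('a \<Rightarrow> real)
    \<Rightarrow> real \<Rightarrow> real \<Rightarrow> ereal" where
  "lifespan p q D1 D2 V1 V2 u0 u1 v0 v1 R \<epsilon> =
     (SUP T \<in> {T. \<exists>(u::real \<Rightarrow> 'a \<Rightarrow> real) ut gu v vt gv.
        weak_solution p q D1 D2 V1 V2 u0 u1 v0 v1 \<epsilon> T u ut gu v vt gv \<and> supp_in_cone R T u v}.
      ereal T)"

definition GammaGG :: "nat \<Rightarrow> real \<Rightarrow> real \<Rightarrow> real" where
  "GammaGG n p q = max ((p + 1) / (p * q - 1)) ((q + 1) / (p * q - 1)) - (real n - 1) / 2"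

end

theory Submission
  imports Defs
begin

text \<open>
  Write \<open>n\<close> for the dimension and \<open>s = (n - 1) / 2\<close>.  For each equation let \<open>\<phi>\<close> be the radial
  solution of \<open>\<Delta>\<phi> = (1 + D + V) \<phi>\<close> with \<open>\<phi> 0 = 1\<close>.  Since \<open>D + V\<close> is integrable along rays, \<open>\<phi>\<close> is
  comparable to \<open>(1 + r) powr (- s) * exp r\<close>.  Testing the weak equation with \<open>\<theta>(t) \<phi>(x)\<close> and moving
  the undifferentiated \<open>u\<close> onto \<open>u_t\<close> by integrating by parts in time gives an identity whose kernel
  for \<open>\<theta> = \<eta> * exp (- t)\<close>, with \<open>\<eta>\<close> decreasing and convex, is bounded by \<open>- \<eta>' * exp (- t) * \<phi>\<close>.

  With \<open>\<eta> = ((\<sigma> - t) / (1 + \<sigma>)) ^ (k + 1)\<close>, the two equations become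
  \<open>c \<epsilon> + X \<le> C / (1 + \<sigma>) * \<integral>|u_t| W \<eta>\<^sub>1\<close> and \<open>c \<epsilon> + Y \<le> C / (1 + \<sigma>) * \<integral>|v_t| W \<eta>\<^sub>1\<close>, where
  \<open>X\<close> and \<open>Y\<close> are the integrals of \<open>|v_t| powr p\<close> and \<open>|u_t| powr q\<close> against \<open>W \<eta>\<close>, \<open>W\<close> is the
  exponential weight on the light cone and \<open>\<eta>\<^sub>1\<close> is the same profile with exponent \<open>k\<close>.  Hoelder's
  inequality closes the subcritical case.  In the critical case the Hoelder weight
  \<open>\<tau> = (1 + t) / (1 + \<sigma>)\<close> produces the increment of \<open>X\<close> between \<open>\<sigma>\<close> and the next dyadic time, so
  \<open>z = c \<epsilon> + X\<close> satisfies \<open>z' \<ge> z + d * z powr (p q)\<close> along dyadic times (for \<open>p = q\<close>,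
  \<open>z = c \<epsilon> + min X Y\<close> even satisfies it with exponent \<open>p\<close>) while staying bounded, which limits the
  number of dyadic times.
\<close>

section \<open>Smooth functions\<close>

lemma iter_dd_append_last:
  "iter_dd f (vs @ [v]) = iter_dd (\<lambda>x. frechet_derivative f (at x) v) vs"
  by (induction vs) auto

lemma smooth_fun_differentiable: "smooth_fun f \<Longrightarrow> f differentiable (at x)"
  unfolding smooth_fun_def by (metis iter_dd.simps(1))

lemma smooth_fun_frechet_derivative:
  assumes "smooth_fun f"
  shows "smooth_fun (\<lambda>x. frechet_derivative f (at x) v)"
  using assms unfolding smooth_fun_def by (metis iter_dd_append_last)

lemma smooth_fun_continuous: "smooth_fun f \<Longrightarrow> continuous_on S f"
  by (meson continuous_at_imp_continuous_on differentiable_imp_continuous_within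
      smooth_fun_differentiable)

lemma smooth_fun_coinduct [consumes 1, case_names has_derivative]:
  assumes "P f"
    and deriv: "\<And>f. P f \<Longrightarrow> \<exists>f'. \<forall>x. (f has_derivative f' x) (at x) \<and> (\<forall>v. P (\<lambda>x. f' x v))"
  shows "smooth_fun f"
proof -
  have "P (iter_dd f vs)" for vs
  proof (induction vs)
    case (Cons v vs)
    from deriv[OF Cons.IH] obtain f'
      where "\<And>x. (iter_dd f vs has_derivative f' x) (at x)" "\<And>v. P (\<lambda>x. f' x v)"
      by blast
    moreover have "frechet_derivative (iter_dd f vs) (at x) = f' x" for x
      using frechet_derivative_at calculation(1) by metis
    ultimately show ?case
      by simp
  qed (simp add: \<open>P f\<close>)
  then show ?thesis
    unfolding smooth_fun_def differentiable_def using deriv by blast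
qed

lemma smooth_funI:
  assumes "\<And>x. (f has_derivative f' x) (at x)" "\<And>v. smooth_fun (\<lambda>x. f' x v)"
  shows "smooth_fun f"
proof (rule smooth_fun_coinduct[where P = "\<lambda>g. g = f \<or> smooth_fun g"])
  fix g assume "g = f \<or> smooth_fun g"
  then show "\<exists>g'. \<forall>x. (g has_derivative g' x) (at x) \<and>
      (\<forall>v. (\<lambda>x. g' x v) = f \<or> smooth_fun (\<lambda>x. g' x v))"
    using assms frechet_derivative_works smooth_fun_differentiable smooth_fun_frechet_derivative
    by metis
qed simp

lemma smooth_fun_const: "smooth_fun (\<lambda>_. c)"
proof (rule smooth_fun_coinduct[where P = "\<lambda>f. \<exists>c. f = (\<lambda>_. c)"])
  fix f :: "'a \<Rightarrow> real" assume "\<exists>c. f = (\<lambda>_. c)"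
  then show "\<exists>f'. \<forall>x. (f has_derivative f' x) (at x) \<and> (\<forall>v. \<exists>c. (\<lambda>x. f' x v) = (\<lambda>_. c))"
    by (intro exI[of _ "\<lambda>_ _. 0"]) auto
qed blast

lemma smooth_fun_linear: "bounded_linear f \<Longrightarrow> smooth_fun f"
  by (rule smooth_funI[of f "\<lambda>_. f"])
    (auto intro: bounded_linear_imp_has_derivative smooth_fun_const)

lemma smooth_fun_compose_linear:
  assumes "smooth_fun f" "bounded_linear l"
  shows "smooth_fun (\<lambda>x. f (l x))"
proof (rule smooth_fun_coinduct[where P = "\<lambda>h. \<exists>g. smooth_fun g \<and> h = (\<lambda>x. g (l x))"])
  fix h assume "\<exists>g. smooth_fun g \<and> h = (\<lambda>x. g (l x))"
  then obtain g where g: "smooth_fun g" "h = (\<lambda>x. g (l x))" by blast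
  have "(h has_derivative (\<lambda>v. frechet_derivative g (at (l x)) (l v))) (at x)" for x
    unfolding g(2)
    by (rule has_derivative_compose[OF bounded_linear_imp_has_derivative[OF assms(2)]])
      (use smooth_fun_differentiable[OF g(1)] frechet_derivative_works in blast)
  moreover have "smooth_fun (\<lambda>y. frechet_derivative g (at y) (l v))" for v
    by (rule smooth_fun_frechet_derivative[OF g(1)])
  ultimately show "\<exists>h'. \<forall>x. (h has_derivative h' x) (at x) \<and>
      (\<forall>v. \<exists>g. smooth_fun g \<and> (\<lambda>x. h' x v) = (\<lambda>x. g (l x)))"
    by (intro exI[of _ "\<lambda>x v. frechet_derivative g (at (l x)) (l v)"]) auto
qed (use assms(1) in blast)

text \<open>The product rule leaves the class of products of smooth functions, so the coinduction for
  algebraic operations has to run over the closure of the smooth functions under all of them.\<close>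

inductive smooth_closure :: "('b::real_normed_vector \<Rightarrow> real) \<Rightarrow> bool" where
  base: "smooth_fun f \<Longrightarrow> smooth_closure f"
| add: "smooth_closure f \<Longrightarrow> smooth_closure g \<Longrightarrow> smooth_closure (\<lambda>x. f x + g x)"
| mult: "smooth_closure f \<Longrightarrow> smooth_closure g \<Longrightarrow> smooth_closure (\<lambda>x. f x * g x)"
| inverse: "smooth_closure f \<Longrightarrow> (\<And>x. f x \<noteq> 0) \<Longrightarrow> smooth_closure (\<lambda>x. inverse (f x))"
| compose: "smooth_fun h \<Longrightarrow> smooth_closure f \<Longrightarrow> smooth_closure (\<lambda>x. h (f x :: real))"

lemma smooth_fun_has_real_derivative:
  assumes "smooth_fun (f :: real \<Rightarrow> real)"
  shows "(f has_real_derivative deriv f t) (at t)"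
  using smooth_fun_differentiable[OF assms] by (simp add: DERIV_deriv_iff_real_differentiable)

lemma frechet_derivative_real:
  assumes "smooth_fun (f :: real \<Rightarrow> real)"
  shows "frechet_derivative f (at t) v = v * deriv f t"
  using smooth_fun_has_real_derivative[OF assms, of t]
  by (simp add: has_field_derivative_def frechet_derivative_at[symmetric])

lemma smooth_fun_deriv: "smooth_fun (f :: real \<Rightarrow> real) \<Longrightarrow> smooth_fun (deriv f)"
  using smooth_fun_frechet_derivative[of f 1] by (simp add: frechet_derivative_real)

lemma smooth_closure_has_derivative:
  assumes "smooth_closure f"
  shows "\<exists>f'. \<forall>x. (f has_derivative f' x) (at x) \<and> (\<forall>v. smooth_closure (\<lambda>x. f' x v))"
  using assms
proof (induction rule: smooth_closure.induct)
  case (base f)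
  then show ?case
    using frechet_derivative_works smooth_closure.base smooth_fun_differentiable
      smooth_fun_frechet_derivative by metis
next
  case (add f g)
  then obtain f' g' where "\<And>x. (f has_derivative f' x) (at x)" "\<And>v. smooth_closure (\<lambda>x. f' x v)"
    "\<And>x. (g has_derivative g' x) (at x)" "\<And>v. smooth_closure (\<lambda>x. g' x v)" by metis
  then show ?case
    by (intro exI[of _ "\<lambda>x v. f' x v + g' x v"])
      (auto intro: smooth_closure.add has_derivative_add)
next
  case (mult f g)
  then obtain f' g' where "\<And>x. (f has_derivative f' x) (at x)" "\<And>v. smooth_closure (\<lambda>x. f' x v)"
    "\<And>x. (g has_derivative g' x) (at x)" "\<And>v. smooth_closure (\<lambda>x. g' x v)" by metis
  with mult.hyps show ?case
    by (intro exI[of _ "\<lambda>x v. f x * g' x v + f' x v * g x"])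
      (auto intro!: smooth_closure.add smooth_closure.mult has_derivative_mult)
next
  case (inverse f)
  then obtain f' where f': "\<And>x. (f has_derivative f' x) (at x)" "\<And>v. smooth_closure (\<lambda>x. f' x v)"
    by metis
  have "smooth_closure (\<lambda>x. - 1 * (inverse (f x) * f' x v * inverse (f x)))" for v
    by (intro smooth_closure.mult smooth_closure.inverse smooth_closure.base[OF smooth_fun_const]
        inverse.hyps f')
  then show ?case
    using inverse.hyps f'(1)
    by (intro exI[of _ "\<lambda>x v. - (inverse (f x) * f' x v * inverse (f x))"])
      (auto intro!: has_derivative_inverse)
next
  case (compose h f)
  then obtain f' where f': "\<And>x. (f has_derivative f' x) (at x)" "\<And>v. smooth_closure (\<lambda>x. f' x v)"
    by metis
  have "((\<lambda>x. h (f x)) has_derivative (\<lambda>v. deriv h (f x) * f' x v)) (at x)" for x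
    by (rule has_derivative_compose[OF f'(1) has_field_derivative_imp_has_derivative[OF
            smooth_fun_has_real_derivative[OF compose.hyps(1)]]])
  moreover have "smooth_closure (\<lambda>x. deriv h (f x) * f' x v)" for v
    by (rule smooth_closure.mult[OF smooth_closure.compose[OF smooth_fun_deriv[OF compose.hyps(1)]
            compose.hyps(2)] f'(2)])
  ultimately show ?case
    by (intro exI[of _ "\<lambda>x v. deriv h (f x) * f' x v"]) auto
qed

lemma smooth_closure_imp_smooth_fun: "smooth_closure f \<Longrightarrow> smooth_fun f"
  by (erule smooth_fun_coinduct[where P = smooth_closure]) (rule smooth_closure_has_derivative)

lemma smooth_fun_add: "smooth_fun f \<Longrightarrow> smooth_fun g \<Longrightarrow> smooth_fun (\<lambda>x. f x + g x)"
  by (rule smooth_closure_imp_smooth_fun) (auto intro: smooth_closure.add smooth_closure.base)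

lemma smooth_fun_mult: "smooth_fun f \<Longrightarrow> smooth_fun g \<Longrightarrow> smooth_fun (\<lambda>x. f x * g x)"
  by (rule smooth_closure_imp_smooth_fun) (auto intro: smooth_closure.mult smooth_closure.base)

lemma smooth_fun_inverse:
  "smooth_fun f \<Longrightarrow> (\<And>x. f x \<noteq> 0) \<Longrightarrow> smooth_fun (\<lambda>x. inverse (f x))"
  by (rule smooth_closure_imp_smooth_fun) (auto intro: smooth_closure.inverse smooth_closure.base)

lemma smooth_fun_compose:
  fixes h :: "real \<Rightarrow> real"
  shows "smooth_fun h \<Longrightarrow> smooth_fun f \<Longrightarrow> smooth_fun (\<lambda>x. h (f x))"
  by (rule smooth_closure_imp_smooth_fun[OF smooth_closure.compose[OF _ smooth_closure.base]])

lemma smooth_fun_diff: "smooth_fun f \<Longrightarrow> smooth_fun g \<Longrightarrow> smooth_fun (\<lambda>x. f x - g x)"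
  using smooth_fun_add[OF _ smooth_fun_mult[OF smooth_fun_const[of "- 1"]], of f g] by simp

lemma smooth_fun_sum:
  "(\<And>i. i \<in> I \<Longrightarrow> smooth_fun (f i)) \<Longrightarrow> smooth_fun (\<lambda>x. \<Sum>i\<in>I. f i x)"
  by (induction I rule: infinite_finite_induct) (auto intro: smooth_fun_const smooth_fun_add)

lemma smooth_fun_power: "smooth_fun f \<Longrightarrow> smooth_fun (\<lambda>x. f x ^ n)"
  by (induction n) (auto intro: smooth_fun_const smooth_fun_mult)

lemma has_derivative_norm_power2:
  "((\<lambda>x::'a::real_inner. (norm x)\<^sup>2) has_derivative (\<lambda>v. 2 * (x \<bullet> v))) (at x)"
  unfolding power2_norm_eq_inner by (auto intro!: derivative_eq_intros simp: inner_commute)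

lemma smooth_fun_norm_power2: "smooth_fun (\<lambda>x::'a::real_inner. (norm x)\<^sup>2)"
  by (rule smooth_funI[OF has_derivative_norm_power2])
    (intro smooth_fun_linear bounded_linear_const_mult bounded_linear_inner_left)

definition flat :: "real poly \<Rightarrow> real \<Rightarrow> real" where
  "flat p t = (if t > 0 then poly p (inverse t) * exp (- inverse t) else 0)"

lemma tendsto_poly_mult_exp_minus: "((\<lambda>x::real. poly p x * exp (- x)) \<longlongrightarrow> 0) at_top"
proof -
  have "((\<lambda>x::real. \<Sum>i\<le>degree p. coeff p i * (x ^ i / exp x)) \<longlongrightarrow> (\<Sum>i\<le>degree p. coeff p i * 0))
      at_top"
    by (intro tendsto_intros tendsto_power_div_exp_0)
  then show ?thesis
    by (simp add: poly_altdef sum_distrib_right exp_minus divide_inverse mult.assoc)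
qed

lemma flat_tendsto_0: "(flat p \<longlongrightarrow> 0) (at 0)"
proof -
  have "((\<lambda>t. poly p (inverse t) * exp (- inverse t)) \<longlongrightarrow> 0) (at_right (0::real))"
    by (rule filterlim_compose[OF tendsto_poly_mult_exp_minus filterlim_inverse_at_top_right])
  then have "(flat p \<longlongrightarrow> 0) (at_right 0)"
    by (rule Lim_transform_eventually)
      (auto simp: flat_def eventually_at_right_field intro!: exI[of _ 1])
  moreover have "(flat p \<longlongrightarrow> 0) (at_left 0)"
    by (rule tendsto_eventually)
      (auto simp: flat_def eventually_at_left_field intro!: exI[of _ "-1"])
  ultimately show ?thesis
    by (simp add: filterlim_split_at)
qed

lemma DERIV_flat: "(flat p has_real_derivative flat ([:0, 0, 1:] * (p - pderiv p)) t) (at t)"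
proof -
  let ?p' = "[:0, 0, 1:] * (p - pderiv p)"
  consider (pos) "t > 0" | (neg) "t < 0" | (zero) "t = 0" by linarith
  then show ?thesis
  proof cases
    case pos
    then have "((\<lambda>t. poly p (inverse t) * exp (- inverse t)) has_real_derivative flat ?p' t) (at t)"
      by (auto intro!: derivative_eq_intros simp: flat_def power2_eq_square algebra_simps)
    then show ?thesis
      by (rule has_field_derivative_transform_within_open[where S = "{0<..}"])
        (use pos in \<open>auto simp: flat_def\<close>)
  next
    case neg
    then have "((\<lambda>_. 0) has_real_derivative flat ?p' t) (at t)"
      by (simp add: flat_def)
    then show ?thesis
      by (rule has_field_derivative_transform_within_open[where S = "{..<0}"])
        (use neg in \<open>auto simp: flat_def\<close>)
  next
    case zero
    have quotient: "(flat p (0 + h) - flat p 0) / h = flat ([:0, 1:] * p) h" for h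
      by (simp add: flat_def divide_inverse)
    have "flat ?p' 0 = 0" by (simp add: flat_def)
    then show ?thesis
      unfolding zero DERIV_def quotient using flat_tendsto_0[of "[:0, 1:] * p"] by simp
  qed
qed

lemma smooth_fun_flat: "smooth_fun (flat p)"
proof (rule smooth_fun_coinduct[where P = "\<lambda>f. \<exists>p. f = flat p"])
  fix f assume "\<exists>p. f = flat p"
  then obtain p where "f = flat p" by blast
  moreover have "(*) (flat q t) = (\<lambda>v. flat (smult v q) t)" for q t
    by (simp add: flat_def fun_eq_iff)
  ultimately show "\<exists>f'. \<forall>x. (f has_derivative f' x) (at x) \<and> (\<forall>v. \<exists>p. (\<lambda>x. f' x v) = flat p)"
    using DERIV_flat[of p] unfolding has_field_derivative_def
    by (intro exI[of _ "\<lambda>t v. flat (smult v ([:0, 0, 1:] * (p - pderiv p))) t"]) auto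
qed blast

lemma smooth_cutoff:
  fixes a b :: real
  assumes "0 \<le> a" "a < b"
  obtains \<kappa> :: "'a::real_inner \<Rightarrow> real"
  where "smooth_fun \<kappa>" "\<And>x. 0 \<le> \<kappa> x" "\<And>x. \<kappa> x \<le> 1"
    "\<And>x. norm x \<le> a \<Longrightarrow> \<kappa> x = 1" "\<And>x. b \<le> norm x \<Longrightarrow> \<kappa> x = 0"
proof -
  define outer where "outer = (\<lambda>x::'a. flat 1 (b\<^sup>2 - (norm x)\<^sup>2))"
  define inner where "inner = (\<lambda>x::'a. flat 1 ((norm x)\<^sup>2 - a\<^sup>2))"
  define \<kappa> where "\<kappa> = (\<lambda>x. outer x * inverse (outer x + inner x))"
  have flat_nonneg: "0 \<le> flat 1 t" for t by (simp add: flat_def)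
  have "a\<^sup>2 < b\<^sup>2"
    using assms by (simp add: power_strict_mono)
  then have denom_pos: "0 < outer x + inner x" for x
    using flat_nonneg[of "b\<^sup>2 - (norm x)\<^sup>2"] flat_nonneg[of "(norm x)\<^sup>2 - a\<^sup>2"]
    by (cases "(norm x)\<^sup>2 < b\<^sup>2")
      (auto simp: outer_def inner_def flat_def add_pos_nonneg add_nonneg_pos)
  have smooth_outer: "smooth_fun outer" and smooth_inner: "smooth_fun inner"
    unfolding outer_def inner_def
    by (rule smooth_fun_compose[OF smooth_fun_flat] smooth_fun_diff smooth_fun_const
        smooth_fun_norm_power2)+
  show ?thesis
  proof
    show "smooth_fun \<kappa>"
      unfolding \<kappa>_def
      by (intro smooth_fun_mult smooth_fun_inverse smooth_fun_add smooth_outer smooth_inner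
          denom_pos[THEN less_imp_neq, symmetric])
    fix x
    show "0 \<le> \<kappa> x" "\<kappa> x \<le> 1"
      using denom_pos[of x] by (simp_all add: \<kappa>_def outer_def inner_def flat_nonneg field_simps)
    show "\<kappa> x = 1" if "norm x \<le> a"
      using denom_pos[of x] power_mono[OF that, of 2] by (simp add: \<kappa>_def inner_def flat_def)
    have "\<not> (norm x)\<^sup>2 < b\<^sup>2" if "b \<le> norm x"
      using that assms by (intro leD power_mono) auto
    then show "\<kappa> x = 0" if "b \<le> norm x"
      using that by (simp add: \<kappa>_def outer_def flat_def)
  qed
qed

lemma frechet_derivative_eq_0_outside:
  fixes f :: "'a::real_normed_vector \<Rightarrow> real"
  assumes "\<And>x. L \<le> norm x \<Longrightarrow> f x = 0" "L < norm x"
  shows "frechet_derivative f (at x) v = 0"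
proof -
  have "frechet_derivative (\<lambda>_. 0) (at x) = frechet_derivative f (at x)"
    by (rule frechet_derivative_transform_within_open[of _ _ "{y. L < norm y}"])
      (use assms open_Collect_less[OF continuous_on_const continuous_on_norm_id] in auto)
  then show ?thesis
    using frechet_derivative_const[of "0 :: real" x] by metis
qed

definition laplace :: "('a::euclidean_space \<Rightarrow> real) \<Rightarrow> 'a \<Rightarrow> real" where
  "laplace \<zeta> x = (\<Sum>e\<in>Basis. frechet_derivative (\<lambda>y. frechet_derivative \<zeta> (at y) e) (at x) e)"

lemma smooth_fun_laplace: "smooth_fun \<zeta> \<Longrightarrow> smooth_fun (laplace \<zeta>)"
  unfolding laplace_def[abs_def] by (intro smooth_fun_sum smooth_fun_frechet_derivative)

lemma laplace_cong_open:
  assumes "open S" "x \<in> S" "\<And>y. y \<in> S \<Longrightarrow> f y = g y" "smooth_fun f"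
  shows "laplace f x = laplace g x"
  unfolding laplace_def
proof (intro sum.cong refl)
  fix e :: 'a
  have "frechet_derivative f (at y) e = frechet_derivative g (at y) e" if "y \<in> S" for y
    using frechet_derivative_transform_within_open[OF _ assms(1) that assms(3)] assms(4)
    by (simp add: smooth_fun_differentiable)
  then show "frechet_derivative (\<lambda>y. frechet_derivative f (at y) e) (at x) e =
      frechet_derivative (\<lambda>y. frechet_derivative g (at y) e) (at x) e"
    by (intro fun_cong[OF frechet_derivative_transform_within_open[OF _ assms(1,2)]]
        smooth_fun_differentiable smooth_fun_frechet_derivative assms(4))
qed

lemma laplace_eq_0_outside:
  assumes "\<And>x. L \<le> norm x \<Longrightarrow> \<zeta> x = 0" "L < norm x"
  shows "laplace \<zeta> x = 0"
proof -
  have "laplace (\<lambda>_. 0) x = laplace \<zeta> x"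
    by (rule laplace_cong_open[of "{y. L < norm y}"])
      (use assms smooth_fun_const open_Collect_less[OF continuous_on_const continuous_on_norm_id]
        in auto)
  then show ?thesis
    by (simp add: laplace_def frechet_derivative_const)
qed

lemma laplace_radial:
  fixes P P' P'' :: "real \<Rightarrow> real"
  assumes P: "\<And>s. (P has_real_derivative P' s) (at s)" "\<And>s. (P' has_real_derivative P'' s) (at s)"
  shows "laplace (\<lambda>x::'a::euclidean_space. P ((norm x)\<^sup>2)) x =
    4 * (norm x)\<^sup>2 * P'' ((norm x)\<^sup>2) + 2 * DIM('a) * P' ((norm x)\<^sup>2)"
proof -
  have compose_norm: "((\<lambda>x::'a. F ((norm x)\<^sup>2)) has_derivative
      (\<lambda>v. F' ((norm x)\<^sup>2) * (2 * (x \<bullet> v)))) (at x)"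
    if "\<And>s. (F has_real_derivative F' s) (at s)" for F F' :: "real \<Rightarrow> real" and x :: 'a
    by (rule has_derivative_compose[OF has_derivative_norm_power2
          has_field_derivative_imp_has_derivative[OF that]])
  have first: "frechet_derivative (\<lambda>x::'a. P ((norm x)\<^sup>2)) (at x) =
      (\<lambda>v. P' ((norm x)\<^sup>2) * (2 * (x \<bullet> v)))" for x
    using frechet_derivative_at[OF compose_norm[OF P(1)]] by simp
  have second: "frechet_derivative (\<lambda>y::'a. P' ((norm y)\<^sup>2) * (2 * (y \<bullet> e))) (at x) e =
      4 * P'' ((norm x)\<^sup>2) * (x \<bullet> e)\<^sup>2 + 2 * P' ((norm x)\<^sup>2)" if "e \<in> Basis" for e
  proof -
    have "((\<lambda>y::'a. 2 * (y \<bullet> e)) has_derivative (\<lambda>v. 2 * (v \<bullet> e))) (at x)"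
      by (auto intro!: derivative_eq_intros)
    from frechet_derivative_at[OF has_derivative_mult[OF compose_norm[OF P(2)] this], symmetric]
      that
    show ?thesis by (simp add: power2_eq_square algebra_simps)
  qed
  have "laplace (\<lambda>x::'a. P ((norm x)\<^sup>2)) x =
      (\<Sum>e\<in>Basis. 4 * P'' ((norm x)\<^sup>2) * (x \<bullet> e)\<^sup>2 + 2 * P' ((norm x)\<^sup>2))"
    unfolding laplace_def first by (intro sum.cong refl second)
  also have "\<dots> = 4 * P'' ((norm x)\<^sup>2) * (\<Sum>e\<in>Basis. (x \<bullet> e)\<^sup>2) + 2 * DIM('a) * P' ((norm x)\<^sup>2)"
    by (simp add: sum.distrib sum_distrib_left)
  also have "(\<Sum>e\<in>Basis. (x \<bullet> e)\<^sup>2) = (norm x)\<^sup>2"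
    unfolding power2_norm_eq_inner by (subst (2) euclidean_inner) (simp add: power2_eq_square)
  finally show ?thesis by simp
qed

lemma laplace_norm_power:
  "laplace (\<lambda>x::'a::euclidean_space. ((norm x)\<^sup>2) ^ Suc i) x =
    real ((2 * i + 2) * (2 * i + DIM('a))) * ((norm x)\<^sup>2) ^ i"
proof -
  have first: "((\<lambda>s. s ^ Suc i) has_real_derivative real (Suc i) * s ^ i) (at s)" for s :: real
    using DERIV_pow[of "Suc i" s] by simp
  have second: "((\<lambda>s. real (Suc i) * s ^ i) has_real_derivative
      real (Suc i) * (real i * s ^ (i - 1))) (at s)" for s :: real
    using DERIV_pow[of i s] by (intro DERIV_cmult) simp
  show ?thesis
    unfolding laplace_radial[OF first second] by (cases i) (simp_all add: algebra_simps)
qed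

lemma laplace_const: "laplace (\<lambda>_. c) x = 0"
  by (simp add: laplace_def frechet_derivative_const)

lemma laplace_add:
  assumes "smooth_fun f" "smooth_fun g"
  shows "laplace (\<lambda>x. f x + g x) x = laplace f x + laplace g x"
proof -
  have additive: "frechet_derivative (\<lambda>x. f x + g x) (at y) =
      (\<lambda>v. frechet_derivative f (at y) v + frechet_derivative g (at y) v)"
    if "smooth_fun f" "smooth_fun g" for f g :: "'a \<Rightarrow> real" and y
    using that[THEN smooth_fun_differentiable, of y, unfolded frechet_derivative_works]
    by (intro frechet_derivative_at[symmetric] has_derivative_add)
  show ?thesis
    unfolding laplace_def additive[OF assms] additive[OF assms[THEN smooth_fun_frechet_derivative]]
    by (simp only: sum.distrib)
qed

lemma laplace_cmult:
  assumes "smooth_fun f"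
  shows "laplace (\<lambda>x. c * f x) x = c * laplace f x"
proof -
  have pull_out: "frechet_derivative (\<lambda>x. c * g x) (at y) = (\<lambda>v. c * frechet_derivative g (at y) v)"
    if "smooth_fun g" for g :: "'a \<Rightarrow> real" and y
    using smooth_fun_differentiable[OF that, of y, unfolded frechet_derivative_works]
    by (intro frechet_derivative_at[symmetric] has_derivative_mult_right)
  show ?thesis
    unfolding laplace_def pull_out[OF assms] pull_out[OF smooth_fun_frechet_derivative[OF assms]]
    by (simp only: sum_distrib_left)
qed

lemma laplace_sum:
  assumes "finite I" "\<And>i. i \<in> I \<Longrightarrow> smooth_fun (f i)"
  shows "laplace (\<lambda>x. \<Sum>i\<in>I. f i x) x = (\<Sum>i\<in>I. laplace (f i) x)"
  using assms
  by (induction I) (simp_all add: laplace_const laplace_add smooth_fun_sum)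

section \<open>Radial solutions of the adjoint elliptic equation\<close>

definition scaled_moment :: "nat \<Rightarrow> (real \<Rightarrow> real) \<Rightarrow> real \<Rightarrow> real" where
  "scaled_moment m g r = integral {0..1} (\<lambda>\<tau>. \<tau> ^ m * g (r * \<tau>))"

lemma scaled_moment_integrable:
  assumes "continuous_on UNIV g"
  shows "(\<lambda>\<tau>. \<tau> ^ m * g (r * \<tau>)) integrable_on {0..1::real}"
  by (intro integrable_continuous_real continuous_intros continuous_on_compose2[OF assms]) auto

lemma continuous_on_scaled_moment:
  assumes "continuous_on UNIV g"
  shows "continuous_on UNIV (scaled_moment m g)"
proof -
  have "continuous_on UNIV (\<lambda>r. integral (cbox 0 1) (\<lambda>\<tau>. \<tau> ^ m * g (r * \<tau>)))"
    by (rule integral_continuous_on_param)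
      (auto simp: split_beta intro!: continuous_intros continuous_on_compose2[OF assms])
  then show ?thesis by (simp add: scaled_moment_def[abs_def])
qed

lemma scaled_moment_diff:
  assumes "continuous_on UNIV f" "continuous_on UNIV g"
  shows "scaled_moment m (\<lambda>x. f x - g x) r = scaled_moment m f r - scaled_moment m g r"
  unfolding scaled_moment_def right_diff_distrib
  by (intro integral_diff scaled_moment_integrable assms)

lemma scaled_moment_sum:
  assumes "finite I" "\<And>i. i \<in> I \<Longrightarrow> continuous_on UNIV (f i)"
  shows "scaled_moment m (\<lambda>x. \<Sum>i\<in>I. f i x) r = (\<Sum>i\<in>I. scaled_moment m (f i) r)"
  unfolding scaled_moment_def using assms
  by (subst integral_sum[symmetric]) (auto intro: scaled_moment_integrable simp: sum_distrib_left)

lemma scaled_moment_cmult: "scaled_moment m (\<lambda>x. c * f x) r = c * scaled_moment m f r"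
  unfolding scaled_moment_def
  by (subst integral_mult_right[symmetric]) (simp add: algebra_simps)

lemma scaled_moment_abs_le:
  assumes "continuous_on UNIV f" "continuous_on UNIV g"
    and "\<And>\<tau>. 0 \<le> \<tau> \<Longrightarrow> \<tau> \<le> 1 \<Longrightarrow> \<bar>f (r * \<tau>)\<bar> \<le> g (r * \<tau>)"
  shows "\<bar>scaled_moment m f r\<bar> \<le> scaled_moment m g r"
  unfolding scaled_moment_def real_norm_def[symmetric] using assms
  by (intro integral_norm_bound_integral scaled_moment_integrable)
    (auto simp: abs_mult intro!: mult_left_mono)

lemma scaled_moment_eq_integral:
  assumes "0 < r"
  shows "r ^ Suc m * scaled_moment m g r = integral {0..r} (\<lambda>\<rho>. \<rho> ^ m * g \<rho>)"
proof -
  have "(\<lambda>x. x / r) ` {0..r} = {0..1}"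
    using assms by (auto simp: image_iff field_simps intro!: bexI[of _ "_ * r"])
  then have "integral {0..1} (\<lambda>\<tau>. (r * \<tau>) ^ m * g (r * \<tau>)) =
      1 / r * integral {0..r} (\<lambda>\<rho>. \<rho> ^ m * g \<rho>)"
    using integral_stretch_real[of r 0 r "\<lambda>\<rho>. \<rho> ^ m * g \<rho>"] assms by simp
  moreover have "r ^ m * scaled_moment m g r = integral {0..1} (\<lambda>\<tau>. (r * \<tau>) ^ m * g (r * \<tau>))"
    unfolding scaled_moment_def
    by (subst integral_mult_right[symmetric]) (simp add: algebra_simps power_mult_distrib)
  ultimately show ?thesis using assms by (simp add: field_simps)
qed

lemma DERIV_power_mult_scaled_moment:
  assumes "continuous_on UNIV g" "0 < r"
  shows "((\<lambda>r. r ^ Suc m * scaled_moment m g r) has_real_derivative r ^ m * g r) (at r)"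
proof -
  have "((\<lambda>u. integral {0..u} (\<lambda>\<rho>. \<rho> ^ m * g \<rho>)) has_real_derivative r ^ m * g r)
      (at r within {0..r + 1})"
    by (rule integral_has_real_derivative)
      (use assms in \<open>auto intro!: continuous_intros continuous_on_subset[OF assms(1)]\<close>)
  then have "((\<lambda>u. integral {0..u} (\<lambda>\<rho>. \<rho> ^ m * g \<rho>)) has_real_derivative r ^ m * g r) (at r)"
    using at_within_interior[of r "{0..r + 1}"] assms(2) by (simp add: interior_atLeastAtMost_real)
  then show ?thesis
    by (rule has_field_derivative_transform_within_open[where S = "{0<..}"])
      (use assms scaled_moment_eq_integral in auto)
qed

lemma DERIV_scaled_moment:
  assumes "continuous_on UNIV g" "0 < r"
  shows "(scaled_moment m g has_real_derivative
    (g r - real (Suc m) * scaled_moment m g r) / r) (at r)"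
proof -
  let ?M = "scaled_moment m g"
  have "((\<lambda>r. (r ^ Suc m * ?M r) / r ^ Suc m) has_real_derivative
      (r ^ m * g r * r ^ Suc m - r ^ Suc m * ?M r * (real (Suc m) * r ^ m)) /
        (r ^ Suc m * r ^ Suc m))
      (at r)"
    using assms DERIV_pow[of "Suc m" r]
    by (intro DERIV_divide DERIV_power_mult_scaled_moment) auto
  also have "(r ^ m * g r * r ^ Suc m - r ^ Suc m * ?M r * (real (Suc m) * r ^ m)) /
      (r ^ Suc m * r ^ Suc m) = (g r - real (Suc m) * ?M r) / r"
    using assms by (simp add: field_simps)
  finally show ?thesis
    by (rule has_field_derivative_transform_within_open[where S = "{0<..}"]) (use assms in auto)
qed

lemma scaled_moment_power: "scaled_moment m (\<lambda>x. x ^ j) r = r ^ j / real (m + j + 1)"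
proof -
  have "((\<lambda>\<tau>. \<tau> ^ (m + j)) has_integral
      1 ^ Suc (m + j) / real (Suc (m + j)) - 0 ^ Suc (m + j) / real (Suc (m + j))) {0..1::real}"
  proof (rule fundamental_theorem_of_calculus)
    fix x :: real
    have "((\<lambda>x. x ^ Suc (m + j) / real (Suc (m + j))) has_real_derivative
        real (Suc (m + j)) * x ^ (m + j) / real (Suc (m + j))) (at x within {0..1})"
      by (rule DERIV_cdivide)
        (use DERIV_pow[of "Suc (m + j)" x] in \<open>simp del: of_nat_Suc power_Suc\<close>)
    then show "((\<lambda>x. x ^ Suc (m + j) / real (Suc (m + j))) has_vector_derivative x ^ (m + j))
        (at x within {0..1})"
      by (simp add: has_real_derivative_iff_has_vector_derivative del: of_nat_Suc)
  qed simp
  from has_integral_mult_right[OF this, of "r ^ j"] show ?thesis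
    unfolding scaled_moment_def
    by (intro integral_unique) (simp add: power_mult_distrib power_add mult_ac)
qed

text \<open>\<open>u = radial_poisson n g\<close> solves \<open>u'' + (n - 1) / r * u' = g\<close> with \<open>u 0 = u' 0 = 0\<close>.\<close>

definition radial_poisson :: "nat \<Rightarrow> (real \<Rightarrow> real) \<Rightarrow> real \<Rightarrow> real" where
  "radial_poisson n g r = r\<^sup>2 * scaled_moment 1 (scaled_moment (n - 1) g) r"

lemma continuous_on_radial_poisson:
  assumes "continuous_on UNIV g"
  shows "continuous_on UNIV (radial_poisson n g)"
  unfolding radial_poisson_def[abs_def]
  by (intro continuous_intros continuous_on_scaled_moment assms)

lemma radial_poisson_diff:
  assumes "continuous_on UNIV f" "continuous_on UNIV g"
  shows "radial_poisson n (\<lambda>x. f x - g x) r = radial_poisson n f r - radial_poisson n g r"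
proof -
  have "scaled_moment (n - 1) (\<lambda>x. f x - g x) =
      (\<lambda>x. scaled_moment (n - 1) f x - scaled_moment (n - 1) g x)"
    using assms by (intro ext scaled_moment_diff)
  then show ?thesis
    using assms
    by (simp add: radial_poisson_def scaled_moment_diff continuous_on_scaled_moment algebra_simps)
qed

lemma radial_poisson_sum:
  assumes "finite I" "\<And>i. i \<in> I \<Longrightarrow> continuous_on UNIV (f i)"
  shows "radial_poisson n (\<lambda>x. \<Sum>i\<in>I. f i x) r = (\<Sum>i\<in>I. radial_poisson n (f i) r)"
proof -
  have "scaled_moment (n - 1) (\<lambda>x. \<Sum>i\<in>I. f i x) = (\<lambda>x. \<Sum>i\<in>I. scaled_moment (n - 1) (f i) x)"
    using assms by (intro ext scaled_moment_sum)
  then show ?thesis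
    using assms
    by (simp add: radial_poisson_def scaled_moment_sum continuous_on_scaled_moment sum_distrib_left)
qed

lemma radial_poisson_cmult: "radial_poisson n (\<lambda>x. c * f x) r = c * radial_poisson n f r"
  by (simp add: radial_poisson_def scaled_moment_cmult[abs_def])

lemma radial_poisson_power:
  assumes "0 < n"
  shows "radial_poisson n (\<lambda>x. x ^ (2 * i)) r =
    r ^ (2 * i + 2) / real ((2 * i + 2) * (2 * i + n))"
proof -
  have "scaled_moment (n - 1) (\<lambda>x. x ^ (2 * i)) = (\<lambda>x. 1 / real (2 * i + n) * x ^ (2 * i))"
    using assms by (intro ext) (simp add: scaled_moment_power add.commute)
  then show ?thesis
    unfolding radial_poisson_def
    by (simp only: scaled_moment_cmult scaled_moment_power)
      (simp add: power2_eq_square field_simps)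
qed

lemma radial_poisson_abs_le:
  assumes "continuous_on UNIV f" "continuous_on UNIV g"
    and "\<And>\<tau>. 0 \<le> \<tau> \<Longrightarrow> \<tau> \<le> 1 \<Longrightarrow> \<bar>f (r * \<tau>)\<bar> \<le> g (r * \<tau>)"
  shows "\<bar>radial_poisson n f r\<bar> \<le> radial_poisson n g r"
proof -
  have "\<bar>scaled_moment 1 (scaled_moment (n - 1) f) r\<bar> \<le> scaled_moment 1 (scaled_moment (n - 1) g) r"
  proof (intro scaled_moment_abs_le continuous_on_scaled_moment assms(1,2))
    fix \<tau> \<upsilon> :: real assume "0 \<le> \<tau>" "\<tau> \<le> 1" "0 \<le> \<upsilon>" "\<upsilon> \<le> 1"
    then show "\<bar>f (r * \<tau> * \<upsilon>)\<bar> \<le> g (r * \<tau> * \<upsilon>)"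
      using assms(3)[of "\<tau> * \<upsilon>"] by (simp add: mult_le_one mult.assoc)
  qed
  then show ?thesis
    by (simp add: radial_poisson_def abs_mult mult_left_mono)
qed

lemma radial_poisson_abs_le_const:
  assumes "0 < n" "continuous_on UNIV f" "\<And>\<tau>. 0 \<le> \<tau> \<Longrightarrow> \<tau> \<le> 1 \<Longrightarrow> \<bar>f (r * \<tau>)\<bar> \<le> e"
  shows "\<bar>radial_poisson n f r\<bar> \<le> r\<^sup>2 * e"
proof -
  have "0 \<le> e" using assms(3)[of 0] by simp
  have "\<bar>radial_poisson n f r\<bar> \<le> radial_poisson n (\<lambda>x. e * x ^ (2 * 0)) r"
    using assms by (intro radial_poisson_abs_le continuous_intros) auto
  also have "\<dots> = r\<^sup>2 * e / real (2 * n)"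
    using radial_poisson_power[OF assms(1), of 0 r]
      by (simp only: radial_poisson_cmult) (simp add: power2_eq_square)
  also have "\<dots> \<le> r\<^sup>2 * e / 1"
    using assms(1) \<open>0 \<le> e\<close> by (intro divide_left_mono) auto
  finally show ?thesis by simp
qed

lemma uniform_limit_radial_poisson:
  assumes "0 < n" "\<And>j. continuous_on UNIV (f j)" "continuous_on UNIV g"
    and "bounded S" "\<And>r \<tau>. r \<in> S \<Longrightarrow> 0 \<le> \<tau> \<Longrightarrow> \<tau> \<le> 1 \<Longrightarrow> r * \<tau> \<in> S"
    and limit: "uniform_limit S f g F"
  shows "uniform_limit S (\<lambda>j. radial_poisson n (f j)) (radial_poisson n g) F"
proof (rule uniform_limitI)
  fix e :: real assume "0 < e"
  obtain B where "\<forall>r\<in>S. \<bar>r\<bar> \<le> B" using \<open>bounded S\<close> by (auto simp: bounded_iff)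
  then have square_le: "r\<^sup>2 \<le> B\<^sup>2" if "r \<in> S" for r
    using that power_mono[of "\<bar>r\<bar>" B 2] by simp
  define d where "d = e / (B\<^sup>2 + 1)"
  have "0 < d" using \<open>0 < e\<close> by (simp add: d_def add_nonneg_pos)
  show "\<forall>\<^sub>F j in F. \<forall>r\<in>S. dist (radial_poisson n (f j) r) (radial_poisson n g r) < e"
    using uniform_limitD[OF limit \<open>0 < d\<close>]
  proof eventually_elim
    case (elim j)
    show ?case
    proof
      fix r assume "r \<in> S"
      have "\<bar>radial_poisson n (\<lambda>x. f j x - g x) r\<bar> \<le> r\<^sup>2 * d"
      proof (rule radial_poisson_abs_le_const)
        fix \<tau> :: real assume "0 \<le> \<tau>" "\<tau> \<le> 1"
        then show "\<bar>f j (r * \<tau>) - g (r * \<tau>)\<bar> \<le> d"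
          using elim assms(5) \<open>r \<in> S\<close> by (force simp: dist_real_def)
      qed (intro assms continuous_intros)+
      also have "\<dots> \<le> B\<^sup>2 * d"
        using square_le[OF \<open>r \<in> S\<close>] \<open>0 < d\<close> by (intro mult_right_mono) auto
      also have "\<dots> < (B\<^sup>2 + 1) * d"
        using \<open>0 < d\<close> by (simp add: algebra_simps)
      also have "\<dots> = e"
        using add_nonneg_pos[OF zero_le_power2[of B] zero_less_one] by (simp add: d_def)
      finally show "dist (radial_poisson n (f j) r) (radial_poisson n g r) < e"
        by (simp add: dist_real_def radial_poisson_diff assms)
    qed
  qed
qed

subsection \<open>Existence by a Neumann series\<close>

definition radial_solution :: "nat \<Rightarrow> (real \<Rightarrow> real) \<Rightarrow> (real \<Rightarrow> real) \<Rightarrow> bool" where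
  "radial_solution n a \<phi> \<longleftrightarrow> continuous_on UNIV \<phi> \<and> (\<forall>r. 1 \<le> \<phi> r) \<and>
     (\<forall>r. \<phi> r = 1 + radial_poisson n (\<lambda>\<rho>. a \<rho> * \<phi> \<rho>) r)"

primrec neumann_term :: "nat \<Rightarrow> (real \<Rightarrow> real) \<Rightarrow> nat \<Rightarrow> real \<Rightarrow> real" where
  "neumann_term n a 0 = (\<lambda>_. 1)"
| "neumann_term n a (Suc j) = radial_poisson n (\<lambda>\<rho>. a \<rho> * neumann_term n a j \<rho>)"

lemma continuous_on_neumann_term:
  assumes "continuous_on UNIV a"
  shows "continuous_on UNIV (neumann_term n a j)"
  by (induction j)
    (auto intro!: continuous_on_radial_poisson continuous_on_mult assms continuous_on_const)

lemma neumann_term_nonneg: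
  assumes "continuous_on UNIV a" "\<And>r. 0 \<le> a r"
  shows "0 \<le> neumann_term n a j r"
proof (induction j arbitrary: r)
  case (Suc j)
  have "\<bar>radial_poisson n (\<lambda>\<rho>. a \<rho> * neumann_term n a j \<rho>) r\<bar> \<le> neumann_term n a (Suc j) r"
    unfolding neumann_term.simps using Suc assms
    by (intro radial_poisson_abs_le continuous_on_mult continuous_on_neumann_term)
      (auto simp: abs_mult)
  then show ?case by linarith
qed simp

lemma neumann_term_le:
  assumes a: "0 < n" "continuous_on UNIV a" "\<And>r. 0 \<le> a r" "\<And>r. \<bar>r\<bar> \<le> L \<Longrightarrow> a r \<le> K"
    and "\<bar>r\<bar> \<le> L"
  shows "neumann_term n a j r \<le> (K * r\<^sup>2) ^ j / fact j"
  using \<open>\<bar>r\<bar> \<le> L\<close>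
proof (induction j arbitrary: r)
  case (Suc j)
  define coeff where "coeff = K ^ Suc j / fact j"
  have "0 \<le> K" using a(3)[of r] a(4)[OF Suc.prems] by simp
  have "neumann_term n a (Suc j) r \<le> \<bar>radial_poisson n (\<lambda>\<rho>. a \<rho> * neumann_term n a j \<rho>) r\<bar>"
    by simp
  also have "\<dots> \<le> radial_poisson n (\<lambda>x. coeff * x ^ (2 * j)) r"
  proof (intro radial_poisson_abs_le continuous_intros continuous_on_neumann_term a(2))
    fix \<tau> :: real assume "0 \<le> \<tau>" "\<tau> \<le> 1"
    then have in_range: "\<bar>r * \<tau>\<bar> \<le> L"
      using Suc.prems mult_left_le[of \<tau> "\<bar>r\<bar>"] by (simp add: abs_mult)
    have "a (r * \<tau>) * neumann_term n a j (r * \<tau>) \<le> K * ((K * (r * \<tau>)\<^sup>2) ^ j / fact j)"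
      by (intro mult_mono a Suc.IH in_range \<open>0 \<le> K\<close> neumann_term_nonneg)
    also have "\<dots> = coeff * (r * \<tau>) ^ (2 * j)"
      by (simp add: coeff_def power_mult_distrib flip: power_mult)
    finally show "\<bar>a (r * \<tau>) * neumann_term n a j (r * \<tau>)\<bar> \<le> coeff * (r * \<tau>) ^ (2 * j)"
      using a neumann_term_nonneg[OF a(2,3)] by (simp add: abs_mult)
  qed
  also have "\<dots> = coeff * r ^ (2 * j + 2) / real ((2 * j + 2) * (2 * j + n))"
    unfolding radial_poisson_cmult radial_poisson_power[OF a(1)] by simp
  also have "\<dots> \<le> coeff * r ^ (2 * j + 2) / real (j + 1)"
  proof (rule divide_left_mono)
    have "j + 1 \<le> (2 * j + 2) * 1" by simp
    also have "\<dots> \<le> (2 * j + 2) * (2 * j + n)" using a(1) by (intro mult_le_mono) auto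
    finally show "real (j + 1) \<le> real ((2 * j + 2) * (2 * j + n))" by linarith
    show "0 \<le> coeff * r ^ (2 * j + 2)"
      unfolding coeff_def using \<open>0 \<le> K\<close> by (intro mult_nonneg_nonneg zero_le_even_power) auto
    show "0 < real ((2 * j + 2) * (2 * j + n)) * real (j + 1)"
      using a(1) by (intro mult_pos_pos) (auto simp del: of_nat_mult of_nat_add)
  qed
  also have "\<dots> = (K * r\<^sup>2) ^ Suc j / fact (Suc j)"
    by (simp add: coeff_def power_mult_distrib power_mult[symmetric] mult_ac add.commute
        flip: power_Suc)
  finally show ?case .
qed simp

definition neumann_series :: "nat \<Rightarrow> (real \<Rightarrow> real) \<Rightarrow> real \<Rightarrow> real" where
  "neumann_series n a r = (\<Sum>j. neumann_term n a j r)"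

lemma uniform_limit_neumann_series:
  assumes a: "0 < n" "continuous_on UNIV a" "\<And>r. 0 \<le> a r"
  shows "uniform_limit {-L..L} (\<lambda>N r. \<Sum>j<N. neumann_term n a j r) (neumann_series n a) sequentially"
proof -
  have "compact (a ` {-L..L})"
    by (intro compact_continuous_image continuous_on_subset[OF a(2)]) auto
  then obtain K where "\<forall>y\<in>a ` {-L..L}. norm y \<le> K"
    using compact_imp_bounded bounded_iff by blast
  then have coeff_le: "a r \<le> K" if "\<bar>r\<bar> \<le> L" for r
    using that by (auto simp: abs_le_iff)
  show ?thesis
    unfolding neumann_series_def[abs_def]
  proof (rule Weierstrass_m_test)
    show "summable (\<lambda>j. (K * L\<^sup>2) ^ j / fact j)"
      using summable_exp[of "K * L\<^sup>2"] by (simp add: divide_inverse mult_ac)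
    fix j r assume "r \<in> {-L..L}"
    then have in_range: "\<bar>r\<bar> \<le> L" by auto
    have "0 \<le> K" using a(3)[of r] coeff_le[OF in_range] by simp
    have "neumann_term n a j r \<le> (K * r\<^sup>2) ^ j / fact j"
      using a coeff_le in_range by (rule neumann_term_le)
    also have "\<dots> \<le> (K * L\<^sup>2) ^ j / fact j"
      using in_range \<open>0 \<le> K\<close> power_mono[of "\<bar>r\<bar>" L 2]
      by (intro divide_right_mono power_mono[of "K * r\<^sup>2"] mult_left_mono) auto
    finally show "norm (neumann_term n a j r) \<le> (K * L\<^sup>2) ^ j / fact j"
      using neumann_term_nonneg[OF a(2,3)] by simp
  qed
qed

lemma neumann_partial_sum_Suc:
  assumes "continuous_on UNIV a"
  shows "(\<Sum>j<Suc N. neumann_term n a j r) =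
    1 + radial_poisson n (\<lambda>\<rho>. a \<rho> * (\<Sum>j<N. neumann_term n a j \<rho>)) r"
proof -
  have "radial_poisson n (\<lambda>\<rho>. a \<rho> * (\<Sum>j<N. neumann_term n a j \<rho>)) r =
      (\<Sum>j<N. neumann_term n a (Suc j) r)"
    using assms
    by (simp add: sum_distrib_left radial_poisson_sum continuous_on_mult continuous_on_neumann_term)
  then show ?thesis
    by (subst sum.lessThan_Suc_shift) simp
qed

context
  fixes n :: nat and a :: "real \<Rightarrow> real"
  assumes a: "0 < n" "continuous_on UNIV a" "\<And>r. 0 \<le> a r"
begin

lemma continuous_on_neumann_partial_sum: "continuous_on X (\<lambda>r. \<Sum>j<N. neumann_term n a j r)"
  by (intro continuous_intros continuous_on_subset[OF continuous_on_neumann_term[OF a(2)]]) auto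

lemma continuous_on_neumann_series: "continuous_on X (neumann_series n a)"
proof -
  have "isCont (neumann_series n a) r" for r
  proof -
    have "continuous_on {-(\<bar>r\<bar> + 1)..\<bar>r\<bar> + 1} (neumann_series n a)"
      by (rule uniform_limit_theorem[OF _ uniform_limit_neumann_series[OF a]])
        (auto intro!: always_eventually continuous_on_neumann_partial_sum)
    moreover have "r \<in> interior {-(\<bar>r\<bar> + 1)..\<bar>r\<bar> + 1}"
      by (auto simp: interior_atLeastAtMost_real)
    ultimately show ?thesis
      using continuous_on_interior by blast
  qed
  then show ?thesis
    by (simp add: continuous_at_imp_continuous_on)
qed

lemma neumann_partial_sums_tendsto:
  "(\<lambda>N. \<Sum>j<N. neumann_term n a j r) \<longlonglongrightarrow> neumann_series n a r"
  by (rule tendsto_uniform_limitI[OF uniform_limit_neumann_series[OF a, of "\<bar>r\<bar>"]])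
    (auto simp: abs_real_def)

lemma neumann_series_ge_1: "1 \<le> neumann_series n a r"
proof (rule LIMSEQ_le_const[OF LIMSEQ_Suc[OF neumann_partial_sums_tendsto]])
  have "1 \<le> (\<Sum>j<Suc N. neumann_term n a j r)" for N
    using neumann_term_nonneg[OF a(2,3)]
    by (subst sum.lessThan_Suc_shift) (auto intro!: sum_nonneg simp del: neumann_term.simps(2))
  then show "\<exists>M. \<forall>N\<ge>M. 1 \<le> (\<Sum>j<Suc N. neumann_term n a j r)" by blast
qed

lemma neumann_series_fixed_point:
  "neumann_series n a r = 1 + radial_poisson n (\<lambda>\<rho>. a \<rho> * neumann_series n a \<rho>) r"
proof (rule LIMSEQ_unique[OF LIMSEQ_Suc[OF neumann_partial_sums_tendsto]])
  let ?S = "\<lambda>N r. \<Sum>j<N. neumann_term n a j r" and ?u = "neumann_series n a"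
  define I where "I = {-\<bar>r\<bar>..\<bar>r\<bar>}"
  have "uniform_limit I (\<lambda>N \<rho>. a \<rho> * ?S N \<rho>) (\<lambda>\<rho>. a \<rho> * ?u \<rho>) sequentially"
    unfolding I_def
    by (intro uniform_lim_mult uniform_limit_const uniform_limit_neumann_series a
        compact_imp_bounded compact_continuous_image continuous_on_neumann_series
        continuous_on_subset[OF a(2)]) auto
  then have "uniform_limit I (\<lambda>N. radial_poisson n (\<lambda>\<rho>. a \<rho> * ?S N \<rho>))
      (radial_poisson n (\<lambda>\<rho>. a \<rho> * ?u \<rho>)) sequentially"
  proof (rule uniform_limit_radial_poisson[OF a(1), rotated -1])
    fix \<rho> \<tau> :: real assume "\<rho> \<in> I" "0 \<le> \<tau>" "\<tau> \<le> 1"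
    then have "\<bar>\<rho> * \<tau>\<bar> \<le> \<bar>r\<bar>"
      using mult_left_le[of \<tau> "\<bar>\<rho>\<bar>"] by (auto simp: I_def abs_mult)
    then show "\<rho> * \<tau> \<in> I"
      by (auto simp: I_def)
  qed (auto simp: I_def intro: continuous_on_mult a(2) continuous_on_neumann_partial_sum
      continuous_on_neumann_series)
  then have "(\<lambda>N. radial_poisson n (\<lambda>\<rho>. a \<rho> * ?S N \<rho>) r) \<longlonglongrightarrow> radial_poisson n (\<lambda>\<rho>. a \<rho> * ?u \<rho>) r"
    by (rule tendsto_uniform_limitI) (auto simp: I_def abs_real_def)
  then show "(\<lambda>N. ?S (Suc N) r) \<longlonglongrightarrow> 1 + radial_poisson n (\<lambda>\<rho>. a \<rho> * ?u \<rho>) r"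
    unfolding neumann_partial_sum_Suc[OF a(2)] by (intro tendsto_intros)
qed

lemma radial_solution_neumann_series: "radial_solution n a (neumann_series n a)"
  unfolding radial_solution_def
  using continuous_on_neumann_series neumann_series_ge_1 neumann_series_fixed_point by blast

end

subsection \<open>Exponential growth under an integrable perturbation\<close>

lemma perturbed_exponential_upper:
  fixes g h b :: "real \<Rightarrow> real"
  assumes deriv: "\<And>x. 1 \<le> x \<Longrightarrow> (g has_real_derivative h x) (at x)"
      "\<And>x. 1 \<le> x \<Longrightarrow> (h has_real_derivative b x * g x) (at x)"
    and nonneg: "\<And>x. 1 \<le> x \<Longrightarrow> 0 \<le> g x" "\<And>x. 1 \<le> x \<Longrightarrow> 0 \<le> h x"
    and b_le: "\<And>x. 1 \<le> x \<Longrightarrow> b x \<le> 1 + K * x powr (- \<gamma>)"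
    and K: "0 \<le> K" and \<gamma>: "1 < \<gamma>" and r: "1 \<le> r"
  shows "g r \<le> (g 1 + h 1) * exp (K / (\<gamma> - 1)) * exp (r - 1)"
proof -
  define k where "k = K / (\<gamma> - 1)"
  define z where "z = (\<lambda>x. g x + h x)"
  define E where "E = (\<lambda>x. exp (k * x powr (1 - \<gamma>) - x))"
  have "0 \<le> k" using K \<gamma> by (simp add: k_def)
  have "0 \<le> z 1" using nonneg[of 1] by (simp add: z_def)
  have "z r * E r \<le> z 1 * E 1"
  proof (rule DERIV_nonpos_imp_nonincreasing[OF r])
    fix x assume x: "1 \<le> x" "x \<le> r"
    have "((\<lambda>x. k * x powr (1 - \<gamma>) - x) has_real_derivative
        k * ((1 - \<gamma>) * x powr (1 - \<gamma> - 1)) - 1) (at x)"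
      using x by (intro DERIV_diff DERIV_cmult has_real_derivative_powr DERIV_ident) auto
    moreover have "k * ((1 - \<gamma>) * x powr (1 - \<gamma> - 1)) - 1 = - K * x powr (- \<gamma>) - 1"
      using \<gamma> by (simp add: k_def field_simps)
    ultimately have "(E has_real_derivative E x * (- K * x powr (- \<gamma>) - 1)) (at x)"
      unfolding E_def by (auto intro: DERIV_fun_exp)
    then have deriv_zE: "((\<lambda>x. z x * E x) has_real_derivative
        (h x + b x * g x) * E x + E x * (- K * x powr (- \<gamma>) - 1) * z x) (at x)"
      unfolding z_def using x deriv by (intro DERIV_mult DERIV_add) auto
    have "b x * g x \<le> (1 + K * x powr (- \<gamma>)) * g x"
      using x b_le nonneg by (intro mult_right_mono) auto
    also have "\<dots> \<le> g x + K * x powr (- \<gamma>) * z x"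
      using x K nonneg by (simp add: z_def algebra_simps)
    finally have "E x * (h x + b x * g x - (1 + K * x powr (- \<gamma>)) * z x) \<le> 0"
      by (intro mult_nonneg_nonpos) (auto simp: E_def z_def algebra_simps)
    then show "\<exists>y. ((\<lambda>x. z x * E x) has_real_derivative y) (at x) \<and> y \<le> 0"
      using deriv_zE by (intro exI conjI) (auto simp: algebra_simps)
  qed
  then have "z r \<le> z 1 * (E 1 / E r)"
    by (simp add: E_def field_simps)
  also have "E 1 / E r = exp (k - k * r powr (1 - \<gamma>)) * exp (r - 1)"
    by (simp add: E_def flip: exp_diff exp_add)
  also have "z 1 * \<dots> \<le> z 1 * (exp k * exp (r - 1))"
    using \<open>0 \<le> z 1\<close> \<open>0 \<le> k\<close> by (intro mult_left_mono mult_right_mono) auto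
  finally show ?thesis
    using nonneg(2)[OF r] by (simp add: z_def k_def mult.assoc)
qed

lemma perturbed_exponential_sum_lower:
  fixes g h b :: "real \<Rightarrow> real"
  assumes deriv: "\<And>x. 1 \<le> x \<Longrightarrow> (g has_real_derivative h x) (at x)"
      "\<And>x. 1 \<le> x \<Longrightarrow> (h has_real_derivative b x * g x) (at x)"
    and g_nonneg: "\<And>x. 1 \<le> x \<Longrightarrow> 0 \<le> g x" and b_ge: "\<And>x. 1 \<le> x \<Longrightarrow> 1 \<le> b x" and r: "1 \<le> r"
  shows "(g 1 + h 1) * exp (r - 1) \<le> g r + h r"
proof -
  have "(g 1 + h 1) * exp (- 1) \<le> (g r + h r) * exp (- r)"
  proof (rule DERIV_nonneg_imp_nondecreasing[OF r])
    fix y assume y: "1 \<le> y" "y \<le> r"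
    have "((\<lambda>y. exp (- y)) has_real_derivative exp (- y) * - 1) (at y)"
      by (intro DERIV_fun_exp derivative_eq_intros) auto
    from DERIV_mult[OF DERIV_add[OF deriv[OF y(1)]] this]
    have "((\<lambda>y. (g y + h y) * exp (- y)) has_real_derivative (b y - 1) * g y * exp (- y)) (at y)"
      by (simp add: algebra_simps)
    moreover have "0 \<le> (b y - 1) * g y * exp (- y)"
      using b_ge[OF y(1)] g_nonneg[OF y(1)] by simp
    ultimately show "\<exists>D. ((\<lambda>y. (g y + h y) * exp (- y)) has_real_derivative D) (at y) \<and> 0 \<le> D"
      by blast
  qed
  then show ?thesis
    by (simp add: exp_diff exp_minus field_simps)
qed

lemma perturbed_exponential_lower:
  fixes g h b :: "real \<Rightarrow> real"
  assumes deriv: "\<And>x. 1 \<le> x \<Longrightarrow> (g has_real_derivative h x) (at x)"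
      "\<And>x. 1 \<le> x \<Longrightarrow> (h has_real_derivative b x * g x) (at x)"
    and g_nonneg: "\<And>x. 1 \<le> x \<Longrightarrow> 0 \<le> g x" and b_ge: "\<And>x. 1 \<le> x \<Longrightarrow> 1 \<le> b x" and r: "1 \<le> r"
  shows "min (g 1) ((g 1 + h 1) / 2) * exp (r - 1) \<le> g r"
proof -
  define m where "m = min (g 1) ((g 1 + h 1) / 2)"
  have sum_ge: "2 * m * exp (x - 1) \<le> g x + h x" if "1 \<le> x" for x
  proof -
    have "2 * m * exp (x - 1) \<le> (g 1 + h 1) * exp (x - 1)"
      by (intro mult_right_mono) (simp_all add: m_def min_def field_simps)
    also have "\<dots> \<le> g x + h x"
      by (rule perturbed_exponential_sum_lower[OF deriv g_nonneg b_ge that])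
    finally show ?thesis .
  qed
  have "g 1 * exp 1 - m * exp (2 * 1 - 1) \<le> g r * exp r - m * exp (2 * r - 1)"
  proof (rule DERIV_nonneg_imp_nondecreasing[OF r])
    fix x assume x: "1 \<le> x" "x \<le> r"
    have exp_split: "exp (2 * x - 1) = exp (x - 1) * exp x"
      by (simp add: mult_exp_exp)
    have "((\<lambda>x. m * exp (2 * x - 1)) has_real_derivative m * (exp (2 * x - 1) * 2)) (at x)"
      by (intro DERIV_cmult DERIV_fun_exp) (auto intro!: derivative_eq_intros)
    from DERIV_diff[OF DERIV_mult[OF deriv(1)[OF x(1)] DERIV_exp] this]
    have "((\<lambda>x. g x * exp x - m * exp (2 * x - 1)) has_real_derivative
        (g x + h x) * exp x - 2 * m * exp (x - 1) * exp x) (at x)"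
      by (rule DERIV_cong) (simp only: exp_split, simp add: algebra_simps)
    moreover have "0 \<le> (g x + h x) * exp x - 2 * m * exp (x - 1) * exp x"
      using sum_ge[OF x(1)] by (simp add: mult_right_mono)
    ultimately show "\<exists>D. ((\<lambda>x. g x * exp x - m * exp (2 * x - 1)) has_real_derivative D) (at x) \<and>
        0 \<le> D"
      by blast
  qed
  moreover have "m * exp (2 * 1 - 1) \<le> g 1 * exp 1"
    by (simp add: m_def mult_right_mono)
  ultimately have "m * exp (2 * r - 1) \<le> g r * exp r"
    by linarith
  then have "m * exp (r - 1) * exp r \<le> g r * exp r"
    by (simp add: mult_exp_exp mult.assoc)
  then show ?thesis by (simp add: m_def)
qed

subsection \<open>Asymptotics of the radial solution\<close>

definition radial_weight :: "real \<Rightarrow> real \<Rightarrow> real" where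
  "radial_weight s r = (1 + r) powr (- s) * exp r"

lemma radial_weight_pos: "0 \<le> r \<Longrightarrow> 0 < radial_weight s r"
  by (simp add: radial_weight_def)

lemma radial_weight_ge:
  assumes "0 \<le> s" "1 \<le> r"
  shows "r powr (- s) * exp r \<le> 2 powr s * radial_weight s r"
proof -
  have "r powr (- s) \<le> ((1 + r) / 2) powr (- s)" using assms by (intro powr_mono2') auto
  also have "\<dots> = 2 powr s * (1 + r) powr (- s)"
    using assms by (simp add: powr_divide powr_minus field_simps)
  finally show ?thesis by (simp add: radial_weight_def)
qed

lemma radial_weight_le:
  assumes "0 \<le> s" "1 \<le> r"
  shows "radial_weight s r \<le> r powr (- s) * exp r"
  using assms unfolding radial_weight_def by (intro mult_right_mono powr_mono2') auto

locale radial_equation =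
  fixes n :: nat and s :: real and a \<phi> :: "real \<Rightarrow> real"
  assumes dim_pos: "0 < n" and dim_eq: "real n = 2 * s + 1"
    and coeff_cont: "continuous_on UNIV a" and coeff_nonneg: "\<And>r. 0 \<le> a r"
    and solution: "radial_solution n a \<phi>"
begin

lemma phi_cont: "continuous_on X \<phi>" and phi_ge_1: "1 \<le> \<phi> r"
  and phi_eq: "\<phi> r = 1 + radial_poisson n (\<lambda>\<rho>. a \<rho> * \<phi> \<rho>) r"
  using solution unfolding radial_solution_def by (blast intro: continuous_on_subset)+

lemma phi_pos: "0 < \<phi> r" and phi_nonneg: "0 \<le> \<phi> r"
  using phi_ge_1[of r] by linarith+

definition flux :: "real \<Rightarrow> real" where
  "flux = scaled_moment (n - 1) (\<lambda>\<rho>. a \<rho> * \<phi> \<rho>)"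

lemma flux_nonneg: "0 \<le> flux r"
proof -
  have "\<bar>flux r\<bar> \<le> flux r"
    unfolding flux_def using coeff_nonneg phi_nonneg
    by (intro scaled_moment_abs_le continuous_on_mult coeff_cont phi_cont) (auto simp: abs_mult)
  then show ?thesis by linarith
qed

lemma DERIV_phi:
  assumes "0 < r"
  shows "(\<phi> has_real_derivative r * flux r) (at r)"
proof -
  have "\<phi> = (\<lambda>r. 1 + r ^ Suc 1 * scaled_moment 1 flux r)"
    by (rule ext, subst phi_eq) (simp add: radial_poisson_def flux_def power2_eq_square)
  moreover have "continuous_on UNIV flux"
    unfolding flux_def by (intro continuous_on_scaled_moment continuous_on_mult coeff_cont phi_cont)
  ultimately show ?thesis
    using DERIV_add[OF DERIV_const[of 1] DERIV_power_mult_scaled_moment[of flux r 1]] assms by simp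
qed

lemma DERIV_flux:
  assumes "0 < r"
  shows "(flux has_real_derivative (a r * \<phi> r - real n * flux r) / r) (at r)"
  using DERIV_scaled_moment[of "\<lambda>\<rho>. a \<rho> * \<phi> \<rho>" r "n - 1"] assms dim_pos coeff_cont phi_cont
  by (simp add: flux_def continuous_on_mult)

text \<open>Liouville's substitution: \<open>g = r\<^sup>s \<phi>\<close> removes the first-order term of the radial Laplacian.\<close>

definition liouville :: "real \<Rightarrow> real" where
  "liouville r = r powr s * \<phi> r"

definition liouville_deriv :: "real \<Rightarrow> real" where
  "liouville_deriv r = s * r powr (s - 1) * \<phi> r + r powr (s + 1) * flux r"

lemma DERIV_liouville:
  assumes "0 < r"
  shows "(liouville has_real_derivative liouville_deriv r) (at r)"
proof -
  have "(liouville has_real_derivative s * r powr (s - 1) * \<phi> r + r * flux r * r powr s) (at r)"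
    unfolding liouville_def
    using DERIV_mult[OF has_real_derivative_powr[OF assms, of s] DERIV_phi[OF assms]] by simp
  moreover have "r * flux r * r powr s = r powr (s + 1) * flux r"
    using assms by (simp add: powr_add)
  ultimately show ?thesis by (simp only: liouville_deriv_def)
qed

lemma DERIV_liouville_deriv:
  assumes "0 < r"
  shows "(liouville_deriv has_real_derivative (a r + s * (s - 1) * r powr (- 2)) * liouville r)
      (at r)"
proof -
  have powr_shift: "r powr (s - 1 - 1) = r powr (- 2) * r powr s" "r powr (s - 1) = r powr s / r"
    "r powr (s + 1) = r powr s * r"
    using assms by (simp_all add: powr_diff powr_add powr_minus field_simps power2_eq_square)
  have "(liouville_deriv has_real_derivative
      s * ((s - 1) * r powr (s - 1 - 1)) * \<phi> r + r * flux r * (s * r powr (s - 1))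
      + ((s + 1) * r powr (s + 1 - 1) * flux r
        + (a r * \<phi> r - real n * flux r) / r * r powr (s + 1))) (at r)"
    unfolding liouville_deriv_def
    by (intro DERIV_add DERIV_mult DERIV_cmult has_real_derivative_powr DERIV_phi DERIV_flux assms)
  moreover have "s * ((s - 1) * r powr (s - 1 - 1)) * \<phi> r + r * flux r * (s * r powr (s - 1))
      + ((s + 1) * r powr (s + 1 - 1) * flux r
        + (a r * \<phi> r - real n * flux r) / r * r powr (s + 1))
      = (a r + s * (s - 1) * r powr (- 2)) * liouville r"
    unfolding liouville_def powr_shift dim_eq using assms by (simp add: field_simps)
  ultimately show ?thesis by simp
qed

lemma liouville_bounds:
  assumes n: "3 \<le> n" and a: "\<And>r. 1 \<le> a r" "\<And>r. 1 \<le> r \<Longrightarrow> a r \<le> 1 + K * r powr (- \<gamma>)"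
    and K: "0 \<le> K" and \<gamma>: "1 < \<gamma>" "\<gamma> \<le> 2"
  obtains c C where "0 < c" "0 < C"
    "\<And>r. 1 \<le> r \<Longrightarrow> c * exp r \<le> liouville r" "\<And>r. 1 \<le> r \<Longrightarrow> liouville r \<le> C * exp r"
proof -
  have s: "1 \<le> s" using n dim_eq by linarith
  define b where "b = (\<lambda>r. a r + s * (s - 1) * r powr (- 2))"
  define K' where "K' = K + s * (s - 1)"
  have K': "0 \<le> K'" using K s by (simp add: K'_def)
  have deriv: "(liouville has_real_derivative liouville_deriv r) (at r)"
    "(liouville_deriv has_real_derivative b r * liouville r) (at r)" if "1 \<le> r" for r
    unfolding b_def using that by (auto intro: DERIV_liouville DERIV_liouville_deriv)
  have pos: "0 < liouville r" if "1 \<le> r" for r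
    using that phi_pos by (simp add: liouville_def)
  have deriv_nonneg: "0 \<le> liouville_deriv r" for r
    unfolding liouville_deriv_def using s flux_nonneg phi_nonneg
    by (intro add_nonneg_nonneg mult_nonneg_nonneg) auto
  have b_ge: "1 \<le> b r" for r
    using a(1)[of r] s by (simp add: b_def add_increasing2)
  have b_le: "b r \<le> 1 + K' * r powr (- \<gamma>)" if "1 \<le> r" for r
  proof -
    have "s * (s - 1) * r powr (- 2) \<le> s * (s - 1) * r powr (- \<gamma>)"
      using that \<gamma> s by (intro mult_left_mono powr_mono) auto
    then show ?thesis
      using a(2)[OF that] by (simp add: b_def K'_def algebra_simps)
  qed
  define m where "m = min (liouville 1) ((liouville 1 + liouville_deriv 1) / 2)"
  define M where "M = (liouville 1 + liouville_deriv 1) * exp (K' / (\<gamma> - 1))"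
  show ?thesis
  proof
    show "0 < m * exp (- 1)" "0 < M * exp (- 1)"
      using pos[of 1] deriv_nonneg[of 1] by (auto simp: m_def M_def)
    fix r :: real assume r: "1 \<le> r"
    have "m * exp (r - 1) \<le> liouville r"
      unfolding m_def
      by (rule perturbed_exponential_lower[OF deriv less_imp_le[OF pos] b_ge r])
    then show "m * exp (- 1) * exp r \<le> liouville r"
      by (simp add: exp_diff exp_minus field_simps)
    have "liouville r \<le> M * exp (r - 1)"
      unfolding M_def
      by (rule perturbed_exponential_upper[OF deriv less_imp_le[OF pos] deriv_nonneg b_le K'
            \<gamma>(1) r])
    then show "liouville r \<le> M * exp (- 1) * exp r"
      by (simp add: exp_diff exp_minus field_simps)
  qed
qed

lemma phi_comparable_on_unit_interval:
  obtains c C where "0 < c" "0 < C"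
    "\<And>r. 0 \<le> r \<Longrightarrow> r \<le> 1 \<Longrightarrow> c * radial_weight s r \<le> \<phi> r \<and> \<phi> r \<le> C * radial_weight s r"
proof -
  define ratio where "ratio = (\<lambda>r. \<phi> r / radial_weight s r)"
  have pos: "0 < ratio r" if "0 \<le> r" for r
    using radial_weight_pos[OF that, of s] phi_pos by (simp add: ratio_def)
  have ratio_cont: "continuous_on {0..1} ratio"
    unfolding ratio_def radial_weight_def
    by (intro continuous_intros phi_cont) auto
  then obtain lo hi where "lo \<in> {0..1}" "hi \<in> {0..1}"
    and extrema: "\<forall>r\<in>{0..1}. ratio lo \<le> ratio r" "\<forall>r\<in>{0..1}. ratio r \<le> ratio hi"
    using continuous_attains_inf[OF compact_Icc _ ratio_cont]
      continuous_attains_sup[OF compact_Icc _ ratio_cont] by force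
  show ?thesis
  proof
    show "0 < ratio lo" "0 < ratio hi" using pos \<open>lo \<in> _\<close> \<open>hi \<in> _\<close> by auto
    fix r :: real assume r: "0 \<le> r" "r \<le> 1"
    have "\<phi> r = ratio r * radial_weight s r"
      using radial_weight_pos[OF r(1), of s] by (simp add: ratio_def)
    then show "ratio lo * radial_weight s r \<le> \<phi> r \<and> \<phi> r \<le> ratio hi * radial_weight s r"
      using extrema r radial_weight_pos[OF r(1), of s] by (simp add: mult_right_mono)
  qed
qed

lemma phi_comparable_beyond_unit_interval:
  assumes n: "3 \<le> n" and a: "\<And>r. 1 \<le> a r" "\<And>r. 1 \<le> r \<Longrightarrow> a r \<le> 1 + K * r powr (- \<gamma>)"
    and K: "0 \<le> K" and \<gamma>: "1 < \<gamma>" "\<gamma> \<le> 2"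
  obtains c C where "0 < c" "0 < C"
    "\<And>r. 1 \<le> r \<Longrightarrow> c * radial_weight s r \<le> \<phi> r \<and> \<phi> r \<le> C * radial_weight s r"
proof -
  have s: "0 \<le> s" using n dim_eq by linarith
  obtain c C where bounds: "0 < c" "0 < C" "\<And>r. 1 \<le> r \<Longrightarrow> c * exp r \<le> liouville r"
      "\<And>r. 1 \<le> r \<Longrightarrow> liouville r \<le> C * exp r"
    by (rule liouville_bounds[OF n a K \<gamma>]) (assumption, rule that)
  have "c * radial_weight s r \<le> \<phi> r \<and> \<phi> r \<le> 2 powr s * C * radial_weight s r" if r: "1 \<le> r" for r
  proof
    have \<phi>_eq: "\<phi> r = r powr (- s) * liouville r"
      using r by (simp add: liouville_def powr_minus)
    have "c * radial_weight s r \<le> c * (r powr (- s) * exp r)"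
      using bounds(1) radial_weight_le[OF s r] by (intro mult_left_mono) auto
    also have "\<dots> = r powr (- s) * (c * exp r)" by simp
    also have "\<dots> \<le> \<phi> r"
      unfolding \<phi>_eq by (intro mult_left_mono bounds r) auto
    finally show "c * radial_weight s r \<le> \<phi> r" .
    have "\<phi> r \<le> r powr (- s) * (C * exp r)"
      unfolding \<phi>_eq by (intro mult_left_mono bounds r) auto
    also have "\<dots> = C * (r powr (- s) * exp r)" by simp
    also have "\<dots> \<le> C * (2 powr s * radial_weight s r)"
      using bounds(2) radial_weight_ge[OF s r] by (intro mult_left_mono) auto
    finally show "\<phi> r \<le> 2 powr s * C * radial_weight s r" by (simp add: mult_ac)
  qed
  with bounds(1,2) show ?thesis
    by (intro that[of c "2 powr s * C"]) auto
qed

proposition phi_comparable_to_weight: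
  assumes n: "3 \<le> n" and a: "\<And>r. 1 \<le> a r" "\<And>r. 1 \<le> r \<Longrightarrow> a r \<le> 1 + K * r powr (- \<gamma>)"
    and K: "0 \<le> K" and \<gamma>: "1 < \<gamma>" "\<gamma> \<le> 2"
  obtains c C where "0 < c" "0 < C"
    "\<And>r. 0 \<le> r \<Longrightarrow> c * radial_weight s r \<le> \<phi> r" "\<And>r. 0 \<le> r \<Longrightarrow> \<phi> r \<le> C * radial_weight s r"
proof -
  obtain c0 C0 where near: "0 < c0" "0 < C0" "\<And>r. 0 \<le> r \<Longrightarrow> r \<le> 1 \<Longrightarrow>
      c0 * radial_weight s r \<le> \<phi> r \<and> \<phi> r \<le> C0 * radial_weight s r"
    by (rule phi_comparable_on_unit_interval) (rule that)
  obtain c1 C1 where far: "0 < c1" "0 < C1" "\<And>r. 1 \<le> r \<Longrightarrow>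
      c1 * radial_weight s r \<le> \<phi> r \<and> \<phi> r \<le> C1 * radial_weight s r"
    by (rule phi_comparable_beyond_unit_interval[OF n a K \<gamma>]) (assumption, rule that)
  show ?thesis
  proof
    show "0 < min c0 c1" using near(1) far(1) by simp
    show "0 < max C0 C1" using near(2) by (simp add: less_max_iff_disj)
    fix r :: real assume r: "0 \<le> r"
    have weight: "0 \<le> radial_weight s r" using radial_weight_pos[OF r, of s] by simp
    have "min c0 c1 * radial_weight s r \<le> c0 * radial_weight s r"
      "min c0 c1 * radial_weight s r \<le> c1 * radial_weight s r"
      "C0 * radial_weight s r \<le> max C0 C1 * radial_weight s r"
      "C1 * radial_weight s r \<le> max C0 C1 * radial_weight s r"
      by (auto intro!: mult_right_mono weight)
    with near(3)[OF r] far(3)[of r]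
    show "min c0 c1 * radial_weight s r \<le> \<phi> r" "\<phi> r \<le> max C0 C1 * radial_weight s r"
      by linarith+
  qed
qed

end

subsection \<open>Smooth approximation of the radial solution and its Laplacian\<close>

lemma radial_poisson_polynomial:
  assumes "real_polynomial_function g"
  obtains Q :: "'a::euclidean_space \<Rightarrow> real" where "smooth_fun Q"
    "\<And>x. Q x = 1 + radial_poisson DIM('a) (\<lambda>r. g (r\<^sup>2)) (norm x)"
    "\<And>x. laplace Q x = g ((norm x)\<^sup>2)"
proof -
  obtain c N where g: "g = (\<lambda>s. \<Sum>i\<le>N. c i * s ^ i)"
    using assms unfolding real_polynomial_function_iff_sum by blast
  define scale where "scale = (\<lambda>i. real ((2 * i + 2) * (2 * i + DIM('a))))"
  have scale_eq: "real ((2 * i + 2) * (2 * i + DIM('a))) = scale i" for i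
    by (simp only: scale_def)
  have scale_nonzero: "scale i \<noteq> 0" for i
    unfolding scale_def of_nat_eq_0_iff using DIM_positive[where 'a = 'a] by simp
  define Q where "Q = (\<lambda>x::'a. 1 + (\<Sum>i\<le>N. c i / scale i * ((norm x)\<^sup>2) ^ Suc i))"
  have smooth_terms: "smooth_fun (\<lambda>x::'a. ((norm x)\<^sup>2) ^ Suc i)" for i
    by (rule smooth_fun_power[OF smooth_fun_norm_power2])
  have smooth_sum: "smooth_fun (\<lambda>x::'a. \<Sum>i\<le>N. c i / scale i * ((norm x)\<^sup>2) ^ Suc i)"
    by (intro smooth_fun_sum smooth_fun_mult smooth_fun_const smooth_terms)
  show ?thesis
  proof
    show "smooth_fun Q"
      unfolding Q_def by (intro smooth_fun_add smooth_fun_const smooth_sum)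
    fix x :: 'a
    have "radial_poisson DIM('a) (\<lambda>r. g (r\<^sup>2)) (norm x) =
        (\<Sum>i\<le>N. radial_poisson DIM('a) (\<lambda>r. c i * r ^ (2 * i)) (norm x))"
      unfolding g power_mult[symmetric]
      by (intro radial_poisson_sum continuous_intros) auto
    also have "\<dots> = (\<Sum>i\<le>N. c i / scale i * ((norm x)\<^sup>2) ^ Suc i)"
      unfolding radial_poisson_cmult radial_poisson_power[OF DIM_positive] scale_eq
      by (simp add: power2_eq_square[of "norm x"] power_mult mult.assoc)
    finally show "Q x = 1 + radial_poisson DIM('a) (\<lambda>r. g (r\<^sup>2)) (norm x)"
      by (simp add: Q_def)
    have "laplace Q x = (\<Sum>i\<le>N. laplace (\<lambda>x::'a. c i / scale i * ((norm x)\<^sup>2) ^ Suc i) x)"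
      unfolding Q_def laplace_add[OF smooth_fun_const smooth_sum] laplace_const add_0
      by (intro laplace_sum finite_atMost smooth_fun_mult smooth_fun_const smooth_terms)
    also have "\<dots> = (\<Sum>i\<le>N. c i * ((norm x)\<^sup>2) ^ i)"
      unfolding laplace_cmult[OF smooth_terms] laplace_norm_power scale_eq
      by (intro sum.cong refl) (simp add: scale_nonzero)
    finally show "laplace Q x = g ((norm x)\<^sup>2)"
      by (simp add: g)
  qed
qed

lemma even_polynomial_approximation:
  fixes f :: "real \<Rightarrow> real"
  assumes "continuous_on UNIV f"
  obtains g :: "nat \<Rightarrow> real \<Rightarrow> real" where "\<And>j. polynomial_function (g j)"
    "uniform_limit {0..L} (\<lambda>j r. g j (r\<^sup>2)) f sequentially"
proof -
  have "continuous_on {0..L\<^sup>2} (\<lambda>s. f (sqrt s))"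
    by (rule continuous_on_compose2[OF assms]) (auto intro: continuous_on_real_sqrt)
  then obtain g where g: "uniform_limit {0..L\<^sup>2} g (\<lambda>s. f (sqrt s)) sequentially"
      "\<And>j. polynomial_function (g j)"
    using Stone_Weierstrass_uniform_limit[OF compact_Icc] by blast
  have "uniform_limit {0..L} (\<lambda>j r. g j (r\<^sup>2)) (\<lambda>r. f (sqrt (r\<^sup>2))) sequentially"
    by (rule uniform_limit_compose'[OF g(1)]) (auto intro: power_mono)
  then have "uniform_limit {0..L} (\<lambda>j r. g j (r\<^sup>2)) f sequentially"
    by (rule uniform_limit_cong'[THEN iffD1, rotated -1]) auto
  with g(2) show ?thesis by (rule that)
qed

text \<open>The coefficients are merely continuous, so \<open>\<phi>\<close> itself is not an admissible test function.\<close>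

proposition (in radial_equation) smooth_approximation:
  assumes "n = DIM('a::euclidean_space)"
  obtains Q :: "nat \<Rightarrow> 'a::euclidean_space \<Rightarrow> real" where "\<And>j. smooth_fun (Q j)"
    "uniform_limit (cball 0 L) Q (\<lambda>x. \<phi> (norm x)) sequentially"
    "uniform_limit (cball 0 L) (\<lambda>j. laplace (Q j)) (\<lambda>x. a (norm x) * \<phi> (norm x)) sequentially"
proof -
  let ?f = "\<lambda>r. a r * \<phi> r"
  have f_cont: "continuous_on UNIV ?f"
    by (intro continuous_on_mult coeff_cont phi_cont)
  obtain g where g: "\<And>j. polynomial_function (g j)"
      and on_radii: "uniform_limit {0..L} (\<lambda>j r. g j (r\<^sup>2)) ?f sequentially"
    by (rule even_polynomial_approximation[OF f_cont]) (rule that)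
  have "\<forall>j. \<exists>Q. smooth_fun Q \<and> (\<forall>x::'a. laplace Q x = g j ((norm x)\<^sup>2) \<and>
      Q x = 1 + radial_poisson DIM('a) (\<lambda>r. g j (r\<^sup>2)) (norm x))"
    using radial_poisson_polynomial g unfolding real_polynomial_function_eq by metis
  then obtain Q :: "nat \<Rightarrow> 'a \<Rightarrow> real" where Q: "\<And>j. smooth_fun (Q j)"
      "\<And>j x. Q j x = 1 + radial_poisson DIM('a) (\<lambda>r. g j (r\<^sup>2)) (norm x)"
      "\<And>j x. laplace (Q j) x = g j ((norm x)\<^sup>2)"
    by metis
  have "uniform_limit {0..L} (\<lambda>j. radial_poisson n (\<lambda>r. g j (r\<^sup>2))) (radial_poisson n ?f)
      sequentially"
  proof (rule uniform_limit_radial_poisson[OF dim_pos _ f_cont _ _ on_radii])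
    show "continuous_on UNIV (\<lambda>r. g j (r\<^sup>2))" for j
      by (rule continuous_on_compose2[OF continuous_on_polymonial_function[OF g]])
        (auto intro: continuous_intros)
    fix r \<tau> :: real assume "r \<in> {0..L}" "0 \<le> \<tau>" "\<tau> \<le> 1"
    then show "r * \<tau> \<in> {0..L}" using mult_left_le[of \<tau> r] by auto
  qed auto
  then have "uniform_limit {0..L} (\<lambda>j r. 1 + radial_poisson n (\<lambda>r. g j (r\<^sup>2)) r) \<phi> sequentially"
    by (subst phi_eq[THEN ext]) (intro uniform_limit_add uniform_limit_const)
  then have "uniform_limit (cball 0 L) (\<lambda>j x. 1 + radial_poisson n (\<lambda>r. g j (r\<^sup>2)) (norm x))
      (\<lambda>x::'a. \<phi> (norm x)) sequentially"
    by (rule uniform_limit_compose') auto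
  then have "uniform_limit (cball 0 L) Q (\<lambda>x. \<phi> (norm x)) sequentially"
    unfolding assms Q(2)[symmetric] .
  moreover have "uniform_limit (cball 0 L) (\<lambda>j x. g j ((norm x)\<^sup>2)) (\<lambda>x::'a. ?f (norm x))
      sequentially"
    by (rule uniform_limit_compose'[OF on_radii]) auto
  then have "uniform_limit (cball 0 L) (\<lambda>j. laplace (Q j)) (\<lambda>x. ?f (norm x)) sequentially"
    unfolding Q(3)[symmetric] .
  ultimately show ?thesis
    using that Q(1) by blast
qed

section \<open>Elementary inequalities\<close>

lemma power_diff_bounds:
  fixes x y :: real
  assumes "0 \<le> x" "x \<le> y"
  shows power_diff_ge: "real k * x ^ (k - 1) * (y - x) \<le> y ^ k - x ^ k"
    and power_diff_le: "y ^ k - x ^ k \<le> real k * y ^ (k - 1) * (y - x)"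
proof -
  have "y ^ k - x ^ k = (y - x) * (\<Sum>i<k. x ^ (k - Suc i) * y ^ i)"
    by (rule power_diff_sumr2)
  moreover have "real (card {..<k}) * x ^ (k - 1) \<le> (\<Sum>i<k. x ^ (k - Suc i) * y ^ i)"
  proof (rule sum_bounded_below)
    fix i assume "i \<in> {..<k}"
    then have "x ^ (k - 1) = x ^ (k - Suc i) * x ^ i" by (simp flip: power_add)
    also have "\<dots> \<le> x ^ (k - Suc i) * y ^ i" using assms by (intro mult_left_mono power_mono) auto
    finally show "x ^ (k - 1) \<le> x ^ (k - Suc i) * y ^ i" .
  qed
  moreover have "(\<Sum>i<k. x ^ (k - Suc i) * y ^ i) \<le> real (card {..<k}) * y ^ (k - 1)"
  proof (rule sum_bounded_above)
    fix i assume "i \<in> {..<k}"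
    then have "y ^ (k - 1) = y ^ (k - Suc i) * y ^ i" by (simp flip: power_add)
    moreover have "x ^ (k - Suc i) * y ^ i \<le> y ^ (k - Suc i) * y ^ i"
      using assms by (intro mult_right_mono power_mono) auto
    ultimately show "x ^ (k - Suc i) * y ^ i \<le> y ^ (k - 1)" by simp
  qed
  ultimately show "real k * x ^ (k - 1) * (y - x) \<le> y ^ k - x ^ k"
    "y ^ k - x ^ k \<le> real k * y ^ (k - 1) * (y - x)"
    using assms by (simp_all add: mult.commute mult_left_mono)
qed

lemma weighted_am_gm:
  fixes x y t :: real
  assumes "0 \<le> x" "0 \<le> y" "0 < t" "t < 1"
  shows "x powr t * y powr (1 - t) \<le> t * x + (1 - t) * y"
proof (cases "x = 0 \<or> y = 0")
  case False
  then show ?thesis using Youngs_inequality_0[of t "1 - t" x y] assms by simp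
qed (use assms in auto)

lemma integrable_powr_mult_powr:
  fixes f g :: "'b \<Rightarrow> real"
  assumes f: "integrable M f" "\<And>z. 0 \<le> f z" and g: "integrable M g" "\<And>z. 0 \<le> g z"
    and t: "0 < t" "t < 1"
  shows "integrable M (\<lambda>z. f z powr t * g z powr (1 - t))"
proof (rule Bochner_Integration.integrable_bound)
  show "integrable M (\<lambda>z. t * f z + (1 - t) * g z)" using f g by auto
  show "AE z in M. norm (f z powr t * g z powr (1 - t)) \<le> norm (t * f z + (1 - t) * g z)"
    using weighted_am_gm[OF f(2) g(2) t] by (intro AE_I2) (simp add: order_trans[OF _ abs_ge_self])
  have [measurable]: "f \<in> borel_measurable M" "g \<in> borel_measurable M" using f g by auto
  show "(\<lambda>z. f z powr t * g z powr (1 - t)) \<in> borel_measurable M" by measurable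
qed

lemma Hoelder_powr:
  fixes f g :: "'b \<Rightarrow> real"
  assumes f: "integrable M f" "\<And>z. 0 \<le> f z" and g: "integrable M g" "\<And>z. 0 \<le> g z"
    and t: "0 < t" "t < 1"
  shows "(\<integral>z. f z powr t * g z powr (1 - t) \<partial>M) \<le> (\<integral>z. f z \<partial>M) powr t * (\<integral>z. g z \<partial>M) powr (1 - t)"
proof (cases "(\<integral>z. f z \<partial>M) = 0 \<or> (\<integral>z. g z \<partial>M) = 0")
  case True
  then have "(AE z in M. f z = 0) \<or> (AE z in M. g z = 0)"
    using integral_nonneg_eq_0_iff_AE[OF f(1)] integral_nonneg_eq_0_iff_AE[OF g(1)] f g by auto
  then have "AE z in M. f z powr t * g z powr (1 - t) = 0"
    by (elim disjE) (auto elim: eventually_mono)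
  then have "(\<integral>z. f z powr t * g z powr (1 - t) \<partial>M) = 0"
    by (rule integral_eq_zero_AE)
  then show ?thesis by simp
next
  case False
  define F G where "F = (\<integral>z. f z \<partial>M)" and "G = (\<integral>z. g z \<partial>M)"
  have pos: "0 < F" "0 < G"
    using False Bochner_Integration.integral_nonneg[of M f]
      Bochner_Integration.integral_nonneg[of M g]
      f g unfolding F_def G_def by (simp_all add: order_less_le)
  have "(\<integral>z. f z powr t * g z powr (1 - t) \<partial>M) \<le>
    (\<integral>z. (F powr t * G powr (1 - t)) * (t * (f z / F) + (1 - t) * (g z / G)) \<partial>M)"
  proof (rule integral_mono[OF integrable_powr_mult_powr[OF f g t]])
    fix z
    have "f z powr t * g z powr (1 - t) =
        (F powr t * G powr (1 - t)) * ((f z / F) powr t * (g z / G) powr (1 - t))"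
      using pos f(2)[of z] g(2)[of z] by (simp add: powr_divide)
    also have "\<dots> \<le> (F powr t * G powr (1 - t)) * (t * (f z / F) + (1 - t) * (g z / G))"
      using pos f(2)[of z] g(2)[of z] t by (intro mult_left_mono weighted_am_gm) auto
    finally show "f z powr t * g z powr (1 - t) \<le> \<dots>" .
  qed (use f g in auto)
  also have "\<dots> = (F powr t * G powr (1 - t)) * (t * (F / F) + (1 - t) * (G / G))"
    using f g by (simp add: F_def G_def)
  finally show ?thesis using pos by (simp add: F_def G_def)
qed

lemma sublinear_self_bound:
  fixes u X A \<theta> :: real
  assumes "0 < u" "0 \<le> X" "0 < \<theta>" "\<theta> < 1" "0 \<le> A" "u + X \<le> A * X powr \<theta>"
  shows "u + X \<le> A powr (1 / (1 - \<theta>))"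
proof -
  define v where "v = u + X"
  have v: "0 < v" "X \<le> v" using assms by (auto simp: v_def)
  have "X powr \<theta> \<le> v powr \<theta>" using v assms by (intro powr_mono2) auto
  then have "v \<le> A * v powr \<theta>"
    using assms mult_left_mono[of "X powr \<theta>" "v powr \<theta>" A] by (simp add: v_def)
  then have "v powr (1 - \<theta>) \<le> A"
    using v by (simp add: powr_diff field_simps)
  then have "(v powr (1 - \<theta>)) powr (1 / (1 - \<theta>)) \<le> A powr (1 / (1 - \<theta>))"
    using assms by (intro powr_mono2) auto
  then show ?thesis using v assms by (simp add: powr_powr v_def)
qed

subsection \<open>Superlinear recursions\<close>

lemma one_plus_powr_le_affine:
  fixes r x Y :: real
  assumes "1 < r" "0 \<le> x" "x \<le> Y"
  shows "(1 + x) powr (1 - r) \<le> 1 - (r - 1) * (1 + Y) powr (- r) * x"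
proof -
  define m where "m = (r - 1) * (1 + Y) powr (- r)"
  have "(1 + x) powr (1 - r) + m * x \<le> (1 + 0) powr (1 - r) + m * 0"
  proof (rule DERIV_nonpos_imp_nonincreasing[OF assms(2)])
    fix y assume y: "0 \<le> y" "y \<le> x"
    then have "((\<lambda>y. (1 + y) powr (1 - r)) has_real_derivative (1 - r) * (1 + y) powr (1 - r - 1))
        (at y)"
      by (auto intro!: derivative_eq_intros)
    then have "((\<lambda>y. (1 + y) powr (1 - r) + m * y) has_real_derivative
        (1 - r) * (1 + y) powr (1 - r - 1) + m * 1) (at y)"
      by (intro DERIV_add DERIV_cmult DERIV_ident)
    moreover have "m \<le> (r - 1) * (1 + y) powr (- r)"
      unfolding m_def using y assms by (intro mult_left_mono powr_mono2') auto
    then have "(1 - r) * (1 + y) powr (1 - r - 1) + m * 1 \<le> 0"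
      by (simp add: algebra_simps)
    ultimately show "\<exists>D. ((\<lambda>y. (1 + y) powr (1 - r) + m * y) has_real_derivative D) (at y) \<and> D \<le> 0"
      by blast
  qed
  then show ?thesis by (simp add: m_def)
qed

definition recursion_drop :: "real \<Rightarrow> real \<Rightarrow> real \<Rightarrow> real" where
  "recursion_drop c K r = (r - 1) * (1 + c * K powr (r - 1)) powr (- r) * c"

lemma recursion_drop_pos:
  assumes "0 < c" "1 < r"
  shows "0 < recursion_drop c K r"
proof -
  have "0 < 1 + c * K powr (r - 1)" using assms by (simp add: add_pos_nonneg)
  then show ?thesis using assms by (simp add: recursion_drop_def)
qed

lemma superlinear_step:
  fixes c K r z z' :: real
  assumes "0 < c" "1 < r" "0 < z" "z \<le> K" "z + c * z powr r \<le> z'"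
  shows "z' powr (1 - r) \<le> z powr (1 - r) - recursion_drop c K r"
proof -
  define x where "x = c * z powr (r - 1)"
  define m where "m = (r - 1) * (1 + c * K powr (r - 1)) powr (- r)"
  have x: "0 \<le> x" "x \<le> c * K powr (r - 1)"
    unfolding x_def using assms by (auto intro!: mult_left_mono powr_mono2)
  have "z powr r = z powr (r - 1) * z" using assms by (simp add: powr_diff)
  then have "z * (1 + x) \<le> z'"
    using assms(5) by (simp add: x_def algebra_simps)
  then have "z' powr (1 - r) \<le> (z * (1 + x)) powr (1 - r)"
    using assms x by (intro powr_mono2') auto
  also have "\<dots> = z powr (1 - r) * (1 + x) powr (1 - r)"
    using assms x by (simp add: powr_mult)
  also have "\<dots> \<le> z powr (1 - r) * (1 - m * x)"
    unfolding m_def by (intro mult_left_mono one_plus_powr_le_affine assms x) auto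
  also have "\<dots> = z powr (1 - r) - m * c * (z powr (1 - r) * z powr (r - 1))"
    by (simp add: x_def algebra_simps)
  also have "\<dots> = z powr (1 - r) - recursion_drop c K r"
    using assms by (simp add: recursion_drop_def m_def flip: powr_add)
  finally show ?thesis .
qed

text \<open>A discrete substitute for the blow-up of \<open>z' \<ge> c z\<^sup>r\<close>: as long as \<open>z\<close> stays bounded,
  \<open>z\<close> to the power \<open>1 - r\<close> drops by a fixed amount in each step.\<close>

lemma superlinear_recursion_bound:
  fixes z :: "nat \<Rightarrow> real"
  assumes "0 < c" "1 < r" "0 < z 0"
    and step: "\<And>j. j < J \<Longrightarrow> z j + c * z j powr r \<le> z (Suc j)" and bounded: "\<And>j. j \<le> J \<Longrightarrow> z j \<le> K"
  shows "real J \<le> z 0 powr (1 - r) / recursion_drop c K r"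
proof -
  have "0 < z j \<and> z j powr (1 - r) \<le> z 0 powr (1 - r) - real j * recursion_drop c K r"
    if "j \<le> J" for j
    using that
  proof (induction j)
    case (Suc j)
    then have z: "0 < z j" "z j + c * z j powr r \<le> z (Suc j)"
      and "z j powr (1 - r) \<le> z 0 powr (1 - r) - real j * recursion_drop c K r"
      using step by auto
    moreover have "0 \<le> c * z j powr r" using \<open>0 < c\<close> by simp
    moreover have "z (Suc j) powr (1 - r) \<le> z j powr (1 - r) - recursion_drop c K r"
      using Suc.prems by (intro superlinear_step assms bounded z) auto
    ultimately show ?case by (simp add: algebra_simps)
  qed (use assms in auto)
  from this[of J] have "real J * recursion_drop c K r \<le> z 0 powr (1 - r)"
    using powr_ge_zero[of "z J" "1 - r"] by linarith
  then show ?thesis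
    using recursion_drop_pos[OF assms(1,2), of K] by (simp add: pos_le_divide_eq)
qed

section \<open>Coupled weighted inequalities that force blow-up\<close>

definition ramp :: "real \<Rightarrow> real \<Rightarrow> real" where
  "ramp \<sigma> t = max 0 ((\<sigma> - t) / (1 + \<sigma>))"

lemma ramp_nonneg: "0 \<le> ramp \<sigma> t"
  by (simp add: ramp_def)

lemma ramp_le_1: "0 \<le> t \<Longrightarrow> 1 \<le> \<sigma> \<Longrightarrow> ramp \<sigma> t \<le> 1"
  by (simp add: ramp_def)

lemma ramp_eq_0: "1 \<le> \<sigma> \<Longrightarrow> \<sigma> \<le> t \<Longrightarrow> ramp \<sigma> t = 0"
  unfolding ramp_def by (intro max_absorb1) (simp add: divide_le_0_iff)

lemma ramp_power_eq_0: "1 \<le> \<sigma> \<Longrightarrow> \<sigma> \<le> t \<Longrightarrow> 1 \<le> k \<Longrightarrow> ramp \<sigma> t ^ k = 0"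
  by (simp add: ramp_eq_0 power_0_left)

lemma continuous_on_ramp: "continuous_on X (ramp \<sigma>)"
  unfolding ramp_def[abs_def] divide_inverse by (intro continuous_intros)

lemma ramp_measurable [measurable]: "ramp \<sigma> \<in> borel_measurable borel"
  by (intro borel_measurable_continuous_onI continuous_on_ramp)

lemma ramp_power_doubling:
  assumes "1 \<le> \<sigma>" "0 \<le> t" "t < \<sigma>" "1 + \<sigma>' = 2 * (1 + \<sigma>)" "1 \<le> k"
  shows "ramp \<sigma> t ^ Suc k + (1 + t) / (1 + \<sigma>) * ramp \<sigma> t ^ k \<le> ramp \<sigma>' t ^ Suc k"
proof -
  define \<tau> where "\<tau> = (1 + t) / (1 + \<sigma>)"
  have "0 \<le> \<tau>" using assms by (simp add: \<tau>_def)
  have "\<sigma>' = 2 * (1 + \<sigma>) - 1" using assms(4) by linarith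
  then have ramp_eq: "ramp \<sigma> t = 1 - \<tau>" "ramp \<sigma>' t = 1 - \<tau> / 2"
    using assms by (simp_all add: ramp_def \<tau>_def field_simps max_def)
  have "\<tau> * ramp \<sigma> t ^ k \<le> (real (Suc k) / 2) * (\<tau> * ramp \<sigma> t ^ k)"
    using assms \<open>0 \<le> \<tau>\<close> ramp_nonneg[of \<sigma> t]
      mult_right_mono[of 1 "real (Suc k) / 2" "\<tau> * ramp \<sigma> t ^ k"] by simp
  also have "\<dots> = real (Suc k) * ramp \<sigma> t ^ (Suc k - 1) * (ramp \<sigma>' t - ramp \<sigma> t)"
    by (simp add: ramp_eq)
  also have "\<dots> \<le> ramp \<sigma>' t ^ Suc k - ramp \<sigma> t ^ Suc k"
    using ramp_nonneg[of \<sigma> t] \<open>0 \<le> \<tau>\<close> by (intro power_diff_ge) (auto simp: ramp_eq)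
  finally show ?thesis by (simp add: \<tau>_def)
qed

locale cone_weight =
  fixes M :: "'b measure" and time W :: "'b \<Rightarrow> real" and s C0 T :: real
  assumes time_meas [measurable]: "time \<in> borel_measurable M"
    and W_meas [measurable]: "W \<in> borel_measurable M"
    and W_nonneg: "\<And>z. 0 \<le> W z" and time_nonneg: "\<And>z. W z \<noteq> 0 \<Longrightarrow> 0 \<le> time z"
    and s_pos: "0 < s" and C0_ge_1: "1 \<le> C0"
    and weight_integrable: "\<And>e \<sigma>. 0 \<le> e \<Longrightarrow> e \<le> s \<Longrightarrow> 1 \<le> \<sigma> \<Longrightarrow> \<sigma> < T \<Longrightarrow>
        integrable M (\<lambda>z. if time z < \<sigma> then W z * (1 + time z) powr (- e) else 0)"
    and weight_integral_le: "\<And>e \<sigma>. 0 \<le> e \<Longrightarrow> e \<le> s \<Longrightarrow> 1 \<le> \<sigma> \<Longrightarrow> \<sigma> < T \<Longrightarrow>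
        (\<integral>z. (if time z < \<sigma> then W z * (1 + time z) powr (- e) else 0) \<partial>M)
          \<le> C0 * (1 + \<sigma>) powr (s + 1 - e)"
begin

definition admissible :: "real \<Rightarrow> ('b \<Rightarrow> real) \<Rightarrow> bool" where
  "admissible p f \<longleftrightarrow> f \<in> borel_measurable M \<and> (\<forall>z. 0 \<le> f z) \<and>
     (\<forall>\<sigma>. 1 \<le> \<sigma> \<longrightarrow> \<sigma> < T \<longrightarrow> integrable M (\<lambda>z. if time z < \<sigma> then f z powr p * W z else 0))"

definition ramp_mass :: "nat \<Rightarrow> nat \<Rightarrow> real \<Rightarrow> ('b \<Rightarrow> real) \<Rightarrow> real" where
  "ramp_mass i k \<sigma> f =
    (\<integral>z. f z * W z * ((1 + time z) / (1 + \<sigma>)) ^ i * ramp \<sigma> (time z) ^ k \<partial>M)"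

definition power_mass :: "nat \<Rightarrow> real \<Rightarrow> ('b \<Rightarrow> real) \<Rightarrow> real \<Rightarrow> real" where
  "power_mass k p f \<sigma> = ramp_mass 0 (Suc k) \<sigma> (\<lambda>z. f z powr p)"

definition shell_mass :: "nat \<Rightarrow> real \<Rightarrow> ('b \<Rightarrow> real) \<Rightarrow> real \<Rightarrow> real" where
  "shell_mass k p f \<sigma> = ramp_mass 1 k \<sigma> (\<lambda>z. f z powr p)"

lemma admissible_nonneg: "admissible p f \<Longrightarrow> 0 \<le> f z"
  by (simp add: admissible_def)

lemma ramp_mass_integrable:
  assumes f: "admissible p f" and \<sigma>: "1 \<le> \<sigma>" "\<sigma> < T" and k: "1 \<le> k"
  shows "integrable M (\<lambda>z. f z powr p * W z * ((1 + time z) / (1 + \<sigma>)) ^ i * ramp \<sigma> (time z) ^ k)"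
proof (rule Bochner_Integration.integrable_bound)
  have [measurable]: "f \<in> borel_measurable M" using f by (simp add: admissible_def)
  show "integrable M (\<lambda>z. if time z < \<sigma> then f z powr p * W z else 0)"
    using f \<sigma> by (simp add: admissible_def)
  show "(\<lambda>z. f z powr p * W z * ((1 + time z) / (1 + \<sigma>)) ^ i * ramp \<sigma> (time z) ^ k)
      \<in> borel_measurable M"
    by measurable
  show "AE z in M. norm (f z powr p * W z * ((1 + time z) / (1 + \<sigma>)) ^ i * ramp \<sigma> (time z) ^ k)
      \<le> norm (if time z < \<sigma> then f z powr p * W z else 0)"
  proof (rule AE_I2)
    fix z
    show "norm (f z powr p * W z * ((1 + time z) / (1 + \<sigma>)) ^ i * ramp \<sigma> (time z) ^ k)
      \<le> norm (if time z < \<sigma> then f z powr p * W z else 0)"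
    proof (cases "W z \<noteq> 0 \<and> time z < \<sigma>")
      case True
      then have "0 \<le> time z" using time_nonneg by auto
      then have "((1 + time z) / (1 + \<sigma>)) ^ i * ramp \<sigma> (time z) ^ k \<le> 1 * 1"
        using True \<sigma> ramp_nonneg ramp_le_1 by (intro mult_mono power_le_one) auto
      moreover have "0 \<le> ((1 + time z) / (1 + \<sigma>)) ^ i * ramp \<sigma> (time z) ^ k"
        using \<open>0 \<le> time z\<close> \<sigma> ramp_nonneg by simp
      ultimately show ?thesis
        using True W_nonneg[of z] mult_left_le[of _ "f z powr p * W z"]
        by (simp add: abs_mult mult.assoc)
    next
      case False
      then show ?thesis using ramp_power_eq_0[OF \<sigma>(1)] k by auto
    qed
  qed
qed

lemma ramp_mass_nonneg:
  assumes "\<And>z. 0 \<le> f z" "1 \<le> \<sigma>"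
  shows "0 \<le> ramp_mass i k \<sigma> f"
  unfolding ramp_mass_def
proof (rule Bochner_Integration.integral_nonneg)
  fix z
  show "0 \<le> f z * W z * ((1 + time z) / (1 + \<sigma>)) ^ i * ramp \<sigma> (time z) ^ k"
    using assms W_nonneg[of z] ramp_nonneg[of \<sigma> "time z"] time_nonneg[of z]
    by (cases "W z = 0") auto
qed

lemma power_mass_nonneg: "1 \<le> \<sigma> \<Longrightarrow> 0 \<le> power_mass k p f \<sigma>"
  and shell_mass_nonneg: "1 \<le> \<sigma> \<Longrightarrow> 0 \<le> shell_mass k p f \<sigma>"
  by (simp_all add: power_mass_def shell_mass_def ramp_mass_nonneg)

lemma power_mass_doubling:
  assumes f: "admissible p f" and \<sigma>: "1 \<le> \<sigma>" "\<sigma>' < T" "1 + \<sigma>' = 2 * (1 + \<sigma>)" and k: "1 \<le> k"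
  shows "power_mass k p f \<sigma> + shell_mass k p f \<sigma> \<le> power_mass k p f \<sigma>'"
proof -
  have \<sigma>': "\<sigma> < T" "1 \<le> \<sigma>'" using \<sigma> by auto
  note integrable = ramp_mass_integrable[OF f]
  have "power_mass k p f \<sigma> + shell_mass k p f \<sigma> =
      (\<integral>z. f z powr p * W z * ((1 + time z) / (1 + \<sigma>)) ^ 0 * ramp \<sigma> (time z) ^ Suc k
        + f z powr p * W z * ((1 + time z) / (1 + \<sigma>)) ^ 1 * ramp \<sigma> (time z) ^ k \<partial>M)"
    unfolding power_mass_def shell_mass_def ramp_mass_def
    by (intro Bochner_Integration.integral_add[symmetric] integrable \<sigma> \<sigma>' k) auto
  also have "\<dots> \<le> power_mass k p f \<sigma>'"
    unfolding power_mass_def ramp_mass_def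
  proof (intro integral_mono Bochner_Integration.integrable_add integrable \<sigma> \<sigma>' k)
    fix z
    have "ramp \<sigma> (time z) ^ Suc k + (1 + time z) / (1 + \<sigma>) * ramp \<sigma> (time z) ^ k
        \<le> ramp \<sigma>' (time z) ^ Suc k" if "W z \<noteq> 0"
    proof (cases "time z < \<sigma>")
      case True
      then show ?thesis using time_nonneg[OF that] \<sigma> k by (intro ramp_power_doubling)
    next
      case False
      then have "ramp \<sigma> (time z) ^ Suc k = 0" "ramp \<sigma> (time z) ^ k = 0"
        using k \<sigma> by (intro ramp_power_eq_0; simp)+
      then show ?thesis by (simp only:) (simp add: ramp_nonneg)
    qed
    from mult_left_mono[OF this, of "f z powr p * W z"] W_nonneg[of z]
    show "f z powr p * W z * ((1 + time z) / (1 + \<sigma>)) ^ 0 * ramp \<sigma> (time z) ^ Suc k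
        + f z powr p * W z * ((1 + time z) / (1 + \<sigma>)) ^ 1 * ramp \<sigma> (time z) ^ k
        \<le> f z powr p * W z * ((1 + time z) / (1 + \<sigma>')) ^ 0 * ramp \<sigma>' (time z) ^ Suc k"
      by (cases "W z = 0") (simp_all add: algebra_simps)
  qed auto
  finally show ?thesis .
qed

text \<open>The weight \<open>\<tau> = (1 + t) / (1 + \<sigma>)\<close> enters the two Hoelder factors with cancelling powers.\<close>

lemma hoelder_integrand_split:
  fixes f w \<tau> h p :: real
  assumes "0 \<le> f" "0 < w" "0 < \<tau>" "0 \<le> h" "1 < p"
  shows "(f powr p * w * \<tau> ^ i * h) powr (1 / p)
      * (w * \<tau> powr (- (real i / (p - 1)))) powr (1 - 1 / p)
    = f * w * h powr (1 / p)"
proof -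
  have "real i / (p - 1) * (1 - 1 / p) = real i / p"
    using assms by (simp add: field_simps)
  then have \<tau>_cancels: "(\<tau> ^ i) powr (1 / p) * (\<tau> powr (- (real i / (p - 1)))) powr (1 - 1 / p) = 1"
    using assms by (simp add: powr_powr flip: powr_realpow powr_add)
  have "w powr (1 / p) * w powr (1 - 1 / p) = w"
    using assms by (simp flip: powr_add)
  moreover have "(f powr p * w * \<tau> ^ i * h) powr (1 / p) *
      (w * \<tau> powr (- (real i / (p - 1)))) powr (1 - 1 / p) =
      f * (w powr (1 / p) * w powr (1 - 1 / p)) * h powr (1 / p) *
      ((\<tau> ^ i) powr (1 / p) * (\<tau> powr (- (real i / (p - 1)))) powr (1 - 1 / p))"
    using assms by (simp add: powr_mult powr_powr)
  ultimately show ?thesis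
    unfolding \<tau>_cancels by simp
qed

lemma ramp_power_le_powr:
  assumes "1 < p" "real m \<le> p * real k" "1 \<le> \<sigma>" "0 \<le> t" "t < \<sigma>"
  shows "ramp \<sigma> t ^ k \<le> (ramp \<sigma> t ^ m) powr (1 / p)"
proof -
  have ramp_pos: "0 < ramp \<sigma> t" using assms by (simp add: ramp_def max_def)
  have "ramp \<sigma> t ^ k = ramp \<sigma> t powr real k" using ramp_pos by (simp add: powr_realpow)
  also have "\<dots> \<le> ramp \<sigma> t powr (real m / p)"
    using assms ramp_pos ramp_le_1[of t \<sigma>] by (intro powr_mono') (auto simp: field_simps)
  also have "\<dots> = (ramp \<sigma> t ^ m) powr (1 / p)"
    using ramp_pos by (simp add: powr_realpow[symmetric] powr_powr)
  finally show ?thesis .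
qed

lemma ramp_mass_integrand_le:
  fixes i k m :: nat and p \<sigma> y :: real
  assumes y: "0 \<le> y" and p: "1 < p" and m: "real m \<le> p * real k" and k: "1 \<le> k" and \<sigma>: "1 \<le> \<sigma>"
  defines "e \<equiv> real i / (p - 1)"
  shows "y * W z * ramp \<sigma> (time z) ^ k \<le>
    (y powr p * W z * ((1 + time z) / (1 + \<sigma>)) ^ i * ramp \<sigma> (time z) ^ m) powr (1 / p) *
    ((1 + \<sigma>) powr e * (if time z < \<sigma> then W z * (1 + time z) powr (- e) else 0)) powr (1 - 1 / p)"
proof (cases "W z \<noteq> 0 \<and> time z < \<sigma>")
  case True
  then have W: "0 < W z" and time: "0 \<le> time z"
    using W_nonneg[of z] time_nonneg[of z] by auto
  let ?\<tau> = "(1 + time z) / (1 + \<sigma>)"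
  have "y * W z * ramp \<sigma> (time z) ^ k \<le> y * W z * (ramp \<sigma> (time z) ^ m) powr (1 / p)"
    using True time y W by (intro mult_left_mono ramp_power_le_powr p m \<sigma>) auto
  also have "\<dots> = (y powr p * W z * ?\<tau> ^ i * ramp \<sigma> (time z) ^ m) powr (1 / p) *
      (W z * ?\<tau> powr (- e)) powr (1 - 1 / p)"
    unfolding e_def using y W time \<sigma> p ramp_nonneg
    by (intro hoelder_integrand_split[symmetric]) auto
  also have "W z * ?\<tau> powr (- e) =
      (1 + \<sigma>) powr e * (if time z < \<sigma> then W z * (1 + time z) powr (- e) else 0)"
    using True time \<sigma> by (simp add: powr_divide powr_minus field_simps)
  finally show ?thesis .
next
  case False
  then show ?thesis using k \<sigma> by (auto simp: ramp_power_eq_0)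
qed

lemma hoelder_ramp_mass:
  assumes f: "admissible p f" and p: "1 < p" and i: "real i / (p - 1) \<le> s"
    and m: "1 \<le> m" "real m \<le> p * real k" and k: "1 \<le> k" and \<sigma>: "1 \<le> \<sigma>" "\<sigma> < T"
  shows "ramp_mass 0 k \<sigma> f \<le>
    ramp_mass i m \<sigma> (\<lambda>z. f z powr p) powr (1 / p) * (C0 * (1 + \<sigma>) powr (s + 1)) powr (1 - 1 / p)"
proof -
  define e where "e = real i / (p - 1)"
  have e: "0 \<le> e" "e \<le> s" using p i by (auto simp: e_def)
  define F where "F = (\<lambda>z. f z powr p * W z * ((1 + time z) / (1 + \<sigma>)) ^ i * ramp \<sigma> (time z) ^ m)"
  define G where
    "G = (\<lambda>z. (1 + \<sigma>) powr e * (if time z < \<sigma> then W z * (1 + time z) powr (- e) else 0))"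
  have F: "integrable M F" "0 \<le> F z" for z
    unfolding F_def using ramp_mass_integrable[OF f \<sigma> m(1)] W_nonneg[of z] time_nonneg[of z] \<sigma>
      ramp_nonneg by (auto, cases "W z = 0", auto)
  have G: "integrable M G" "0 \<le> G z" for z
    unfolding G_def using weight_integrable[OF e \<sigma>] W_nonneg by auto
  have t: "0 < 1 / p" "1 / p < 1" using p by auto
  have "ramp_mass 0 k \<sigma> f \<le> (\<integral>z. F z powr (1 / p) * G z powr (1 - 1 / p) \<partial>M)"
    unfolding ramp_mass_def power_0 mult_1_right
  proof (rule integral_mono'[OF integrable_powr_mult_powr[OF F G t]])
    show "f z * W z * ramp \<sigma> (time z) ^ k \<le> F z powr (1 / p) * G z powr (1 - 1 / p)" for z
      unfolding F_def G_def e_def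
      by (rule ramp_mass_integrand_le[OF admissible_nonneg[OF f] p m(2) k \<sigma>(1)])
  qed simp
  also have "\<dots> \<le> (\<integral>z. F z \<partial>M) powr (1 / p) * (\<integral>z. G z \<partial>M) powr (1 - 1 / p)"
    by (rule Hoelder_powr[OF F G t])
  also have "\<dots> \<le> (\<integral>z. F z \<partial>M) powr (1 / p) * (C0 * (1 + \<sigma>) powr (s + 1)) powr (1 - 1 / p)"
  proof (intro mult_left_mono powr_mono2 Bochner_Integration.integral_nonneg G)
    have "(\<integral>z. G z \<partial>M) \<le> (1 + \<sigma>) powr e * (C0 * (1 + \<sigma>) powr (s + 1 - e))"
      unfolding G_def integral_mult_right_zero
      using weight_integral_le[OF e \<sigma>] by (intro mult_left_mono) auto
    also have "\<dots> = C0 * (1 + \<sigma>) powr (s + 1)" using \<sigma> by (simp add: powr_diff)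
    finally show "(\<integral>z. G z \<partial>M) \<le> C0 * (1 + \<sigma>) powr (s + 1)" .
  qed (use p in auto)
  finally show ?thesis by (simp add: ramp_mass_def F_def)
qed

end

definition Gamma_one_sided :: "real \<Rightarrow> real \<Rightarrow> real \<Rightarrow> real" where
  "Gamma_one_sided s p q = (p + 1) / (p * q - 1) - s"

definition chain_const :: "real \<Rightarrow> real \<Rightarrow> real" where
  "chain_const A q = A * A powr (1 / q)"

lemma chain_const_pos: "0 < A \<Longrightarrow> 0 < chain_const A q"
  by (simp add: chain_const_def)

definition mass_const :: "real \<Rightarrow> real \<Rightarrow> real \<Rightarrow> real" where
  "mass_const A p q = chain_const A q powr (1 / (1 - 1 / (p * q)))"

lemma powr_chain:
  fixes A N v Y Z a b p q :: real
  assumes "0 < p" "0 < q" "0 \<le> A" "0 < N" "0 \<le> Y" "0 \<le> Z"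
    and Y: "Y \<le> A * Z powr (1 / p) * N powr b" and v: "v \<le> A * Y powr (1 / q) * N powr a"
  shows "v \<le> chain_const A q * Z powr (1 / (p * q)) * N powr (b / q + a)"
proof -
  have "Y powr (1 / q) \<le> (A * Z powr (1 / p) * N powr b) powr (1 / q)"
    using assms by (intro powr_mono2) auto
  also have "\<dots> = A powr (1 / q) * Z powr (1 / (p * q)) * N powr (b / q)"
    using assms by (simp add: powr_mult powr_powr)
  finally have "A * Y powr (1 / q) * N powr a \<le>
      A * (A powr (1 / q) * Z powr (1 / (p * q)) * N powr (b / q)) * N powr a"
    using assms by (intro mult_right_mono mult_left_mono) auto
  also have "\<dots> = chain_const A q * Z powr (1 / (p * q)) * N powr (b / q + a)"
    using assms by (simp add: chain_const_def powr_add mult_ac)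
  finally show ?thesis using v by linarith
qed

lemma chain_exponent:
  fixes p q s :: real
  assumes "1 < p" "1 < q"
  shows "((s + 1) * (1 - 1 / p) - 1) / q + ((s + 1) * (1 - 1 / q) - 1) =
    - Gamma_one_sided s p q * (1 - 1 / (p * q))"
proof -
  have "p * q > 1" using assms by (simp add: less_1_mult)
  then show ?thesis using assms by (simp add: Gamma_one_sided_def field_simps)
qed

lemma powr_le_of_le_mult_powr:
  fixes B P r v :: real
  assumes "0 < B" "0 \<le> P" "0 < r" "0 \<le> v" "v \<le> B * P powr (1 / r)"
  shows "B powr (- r) * v powr r \<le> P"
proof -
  have "v powr r \<le> (B * P powr (1 / r)) powr r" using assms by (intro powr_mono2) auto
  also have "\<dots> = B powr r * P" using assms by (simp add: powr_mult powr_powr)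
  finally show ?thesis using assms by (simp add: powr_minus field_simps)
qed

locale coupled_pair = cone_weight M time W s C0 T
  for M :: "'b measure" and time W :: "'b \<Rightarrow> real" and s C0 T :: real +
  fixes k :: nat and p q u C :: real and f g :: "'b \<Rightarrow> real"
  assumes p: "1 < p" and q: "1 < q"
    and k: "1 \<le> k" "real (Suc k) \<le> p * real k" "real (Suc k) \<le> q * real k"
    and u_pos: "0 < u" and C_pos: "0 < C"
    and f: "admissible p f" and g: "admissible q g"
    and f_mass_le: "\<And>\<sigma>. 1 \<le> \<sigma> \<Longrightarrow> \<sigma> < T \<Longrightarrow>
        u + power_mass k p f \<sigma> \<le> C / (1 + \<sigma>) * ramp_mass 0 k \<sigma> g"
    and g_mass_le: "\<And>\<sigma>. 1 \<le> \<sigma> \<Longrightarrow> \<sigma> < T \<Longrightarrow>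
        u + power_mass k q g \<sigma> \<le> C / (1 + \<sigma>) * ramp_mass 0 k \<sigma> f"
begin

lemma swap: "coupled_pair M time W s C0 T k q p u C g f"
  by unfold_locales (fact p q k u_pos C_pos f g f_mass_le g_mass_le)+

lemma const_pos: "0 < C * C0"
  using C_pos C0_ge_1 by simp

lemma f_mass_le_hoelder:
  assumes i: "real i / (q - 1) \<le> s" and m: "1 \<le> m" "real m \<le> q * real k"
    and \<sigma>: "1 \<le> \<sigma>" "\<sigma> < T"
  shows "u + power_mass k p f \<sigma> \<le> C * C0 * ramp_mass i m \<sigma> (\<lambda>z. g z powr q) powr (1 / q)
    * (1 + \<sigma>) powr ((s + 1) * (1 - 1 / q) - 1)"
proof -
  define Y where "Y = ramp_mass i m \<sigma> (\<lambda>z. g z powr q)"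
  have "u + power_mass k p f \<sigma> \<le> C / (1 + \<sigma>) * ramp_mass 0 k \<sigma> g"
    by (rule f_mass_le[OF \<sigma>])
  also have "\<dots> \<le> C / (1 + \<sigma>) * (Y powr (1 / q) * (C0 * (1 + \<sigma>) powr (s + 1)) powr (1 - 1 / q))"
    unfolding Y_def using C_pos \<sigma>
    by (intro mult_left_mono hoelder_ramp_mass[OF g q i m k(1) \<sigma>]) auto
  also have "\<dots> = (C * C0 powr (1 - 1 / q)) * Y powr (1 / q)
      * (1 + \<sigma>) powr ((s + 1) * (1 - 1 / q) - 1)"
  proof -
    have "(C0 * (1 + \<sigma>) powr (s + 1)) powr (1 - 1 / q) =
        C0 powr (1 - 1 / q) * (1 + \<sigma>) powr ((s + 1) * (1 - 1 / q))"
      using C0_ge_1 by (subst powr_mult) (auto simp: powr_powr)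
    moreover have "(1 + \<sigma>) powr ((s + 1) * (1 - 1 / q) - 1) =
        (1 + \<sigma>) powr ((s + 1) * (1 - 1 / q)) / (1 + \<sigma>)"
      using \<sigma> by (subst powr_diff) auto
    ultimately show ?thesis by simp
  qed
  also have "\<dots> \<le> C * C0 * Y powr (1 / q) * (1 + \<sigma>) powr ((s + 1) * (1 - 1 / q) - 1)"
  proof (intro mult_right_mono mult_left_mono)
    show "C0 powr (1 - 1 / q) \<le> C0"
      using powr_mono[of "1 - 1 / q" 1 C0] C0_ge_1 q by simp
  qed (use C_pos in auto)
  finally show ?thesis by (simp add: Y_def)
qed

lemma f_mass_le_g_mass:
  assumes "1 \<le> \<sigma>" "\<sigma> < T"
  shows "u + power_mass k p f \<sigma> \<le>
      C * C0 * power_mass k q g \<sigma> powr (1 / q) * (1 + \<sigma>) powr ((s + 1) * (1 - 1 / q) - 1)"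
  using f_mass_le_hoelder[of 0 "Suc k" \<sigma>] assms s_pos k(3) by (simp add: power_mass_def)

lemma f_mass_le_g_shell:
  assumes "1 / (q - 1) \<le> s" "1 \<le> \<sigma>" "\<sigma> < T"
  shows "u + power_mass k p f \<sigma> \<le>
      C * C0 * shell_mass k q g \<sigma> powr (1 / q) * (1 + \<sigma>) powr ((s + 1) * (1 - 1 / q) - 1)"
  unfolding shell_mass_def using assms q k(1) by (intro f_mass_le_hoelder) auto

lemma power_mass_bound:
  assumes \<sigma>: "1 \<le> \<sigma>" "\<sigma> < T"
  shows "u + power_mass k p f \<sigma> \<le> mass_const (C * C0) p q * (1 + \<sigma>) powr (- Gamma_one_sided s p q)"
proof -
  define \<theta> where "\<theta> = 1 / (p * q)"
  have \<theta>: "0 < \<theta>" "\<theta> < 1"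
    using p q less_1_mult[OF p q] by (auto simp: \<theta>_def)
  define B where "B = chain_const (C * C0) q"
  define E where "E = (1 + \<sigma>) powr (- Gamma_one_sided s p q * (1 - \<theta>))"
  have B: "0 < B" unfolding B_def by (rule chain_const_pos[OF const_pos])
  have "power_mass k q g \<sigma> \<le>
      C * C0 * power_mass k p f \<sigma> powr (1 / p) * (1 + \<sigma>) powr ((s + 1) * (1 - 1 / p) - 1)"
    using coupled_pair.f_mass_le_g_mass[OF swap \<sigma>] u_pos by linarith
  from powr_chain[OF _ _ _ _ _ _ this f_mass_le_g_mass[OF \<sigma>]]
  have "u + power_mass k p f \<sigma> \<le> B * power_mass k p f \<sigma> powr \<theta> * E"
    unfolding chain_exponent[OF p q] using p q \<sigma> const_pos power_mass_nonneg[OF \<sigma>(1)]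
    by (simp add: B_def E_def \<theta>_def)
  then have "u + power_mass k p f \<sigma> \<le> (B * E) powr (1 / (1 - \<theta>))"
    using B u_pos \<theta> power_mass_nonneg[OF \<sigma>(1)]
    by (intro sublinear_self_bound) (auto simp: E_def mult_ac)
  also have "\<dots> = mass_const (C * C0) p q * E powr (1 / (1 - \<theta>))"
    using B by (simp add: mass_const_def powr_mult E_def B_def \<theta>_def)
  also have "E powr (1 / (1 - \<theta>)) = (1 + \<sigma>) powr (- Gamma_one_sided s p q)"
    using \<theta> by (simp add: E_def powr_powr)
  finally show ?thesis .
qed

lemma critical_step:
  assumes critical: "Gamma_one_sided s p q = 0" and s: "1 / (p - 1) \<le> s"
    and \<sigma>: "1 \<le> \<sigma>" "\<sigma>' < T" "1 + \<sigma>' = 2 * (1 + \<sigma>)"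
  shows "(u + power_mass k p f \<sigma>) + chain_const (C * C0) q powr (- (p * q)) *
      (u + power_mass k p f \<sigma>) powr (p * q) \<le> u + power_mass k p f \<sigma>'"
proof -
  have \<sigma>T: "\<sigma> < T" using \<sigma> by auto
  have "power_mass k q g \<sigma> \<le>
      C * C0 * shell_mass k p f \<sigma> powr (1 / p) * (1 + \<sigma>) powr ((s + 1) * (1 - 1 / p) - 1)"
    using coupled_pair.f_mass_le_g_shell[OF swap s \<sigma>(1) \<sigma>T] u_pos by linarith
  from powr_chain[OF _ _ _ _ _ _ this f_mass_le_g_mass[OF \<sigma>(1) \<sigma>T]]
  have "u + power_mass k p f \<sigma> \<le> chain_const (C * C0) q * shell_mass k p f \<sigma> powr (1 / (p * q))"
    unfolding chain_exponent[OF p q] critical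
    using p q \<sigma>(1) const_pos power_mass_nonneg[OF \<sigma>(1)] shell_mass_nonneg[OF \<sigma>(1)] by simp
  then have "chain_const (C * C0) q powr (- (p * q)) * (u + power_mass k p f \<sigma>) powr (p * q)
      \<le> shell_mass k p f \<sigma>"
    using p q u_pos power_mass_nonneg[OF \<sigma>(1)] shell_mass_nonneg[OF \<sigma>(1)]
    by (intro powr_le_of_le_mult_powr chain_const_pos const_pos) auto
  then show ?thesis
    using power_mass_doubling[OF f \<sigma> k(1)] by linarith
qed

lemma critical_step_diagonal:
  assumes s: "1 / (q - 1) = s" and \<sigma>: "1 \<le> \<sigma>" "\<sigma>' < T" "1 + \<sigma>' = 2 * (1 + \<sigma>)"
  shows "power_mass k q g \<sigma> + (C * C0) powr (- q) * (u + power_mass k p f \<sigma>) powr q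
    \<le> power_mass k q g \<sigma>'"
proof -
  have \<sigma>T: "\<sigma> < T" using \<sigma> by auto
  have "(s + 1) * (1 - 1 / q) - 1 = 0"
    using q by (simp add: s[symmetric] field_simps)
  then have "u + power_mass k p f \<sigma> \<le> C * C0 * shell_mass k q g \<sigma> powr (1 / q)"
    using f_mass_le_g_shell[OF _ \<sigma>(1) \<sigma>T] s \<sigma>(1) by simp
  then have "(C * C0) powr (- q) * (u + power_mass k p f \<sigma>) powr q \<le> shell_mass k q g \<sigma>"
    using q u_pos power_mass_nonneg[OF \<sigma>(1)] shell_mass_nonneg[OF \<sigma>(1)]
    by (intro powr_le_of_le_mult_powr const_pos) auto
  then show ?thesis
    using power_mass_doubling[OF g \<sigma> k(1)] by linarith
qed

subsection \<open>Lifespan of coupled pairs\<close>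

proposition lifespan_subcritical:
  assumes "0 < Gamma_one_sided s p q"
  shows "T \<le> 1 + (mass_const (C * C0) p q / u) powr (1 / Gamma_one_sided s p q)"
proof (rule ccontr)
  let ?\<Gamma> = "Gamma_one_sided s p q" and ?b = "mass_const (C * C0) p q"
  define \<sigma> where "\<sigma> = 1 + (?b / u) powr (1 / ?\<Gamma>)"
  assume "\<not> T \<le> \<sigma>"
  then have \<sigma>: "1 \<le> \<sigma>" "\<sigma> < T" by (auto simp: \<sigma>_def)
  then have "u \<le> ?b * (1 + \<sigma>) powr (- ?\<Gamma>)"
    using power_mass_bound[OF \<sigma>] power_mass_nonneg[OF \<sigma>(1), of k p f] by linarith
  then have "(1 + \<sigma>) powr ?\<Gamma> \<le> ?b / u"
    using u_pos \<sigma> by (simp add: powr_minus field_simps)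
  then have "((1 + \<sigma>) powr ?\<Gamma>) powr (1 / ?\<Gamma>) \<le> (?b / u) powr (1 / ?\<Gamma>)"
    using assms by (intro powr_mono2) auto
  then show False
    using assms \<sigma> by (simp add: powr_powr \<sigma>_def)
qed

end

lemma le_exp_of_dyadic_bound:
  fixes T :: real
  assumes "0 \<le> B" "\<And>J. 2 ^ Suc J - 1 < T \<Longrightarrow> real J \<le> B"
  shows "T \<le> exp (B + 2)"
proof -
  define J where "J = nat \<lfloor>B\<rfloor> + 1"
  have J: "B < real J" "real J \<le> B + 1" using assms by (auto simp: J_def) linarith+
  have "T \<le> 2 ^ Suc J - 1" using assms(2)[of J] J by fastforce
  also have "\<dots> \<le> 2 ^ Suc J" by simp
  also have "\<dots> \<le> exp 1 ^ Suc J" using exp_ge_add_one_self[of 1] by (intro power_mono) auto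
  also have "\<dots> = exp (real (Suc J))"
    using exp_of_nat_mult[of "Suc J" "1::real"] by (simp del: power_Suc of_nat_Suc)
  also have "\<dots> \<le> exp (B + 2)" using J by simp
  finally show ?thesis .
qed

lemma dyadic_times:
  fixes T :: real
  assumes "2 ^ Suc J - 1 < T"
  shows "1 \<le> (2::real) ^ Suc j - 1" "j \<le> J \<Longrightarrow> (2::real) ^ Suc j - 1 < T"
    "1 + ((2::real) ^ Suc (Suc j) - 1) = 2 * (1 + (2 ^ Suc j - 1))"
proof -
  show "1 \<le> (2::real) ^ Suc j - 1" using one_le_power[of "2::real" j] by simp
  show "(2::real) ^ Suc j - 1 < T" if "j \<le> J"
    using assms power_increasing[of "Suc j" "Suc J" "2::real"] that by linarith
qed simp

lemma lifespan_of_dyadic_recursion: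
  fixes z :: "real \<Rightarrow> real"
  assumes "0 < d" "1 < r" "0 < u" and z_ge: "\<And>\<sigma>. 1 \<le> \<sigma> \<Longrightarrow> u \<le> z \<sigma>"
    and step: "\<And>\<sigma> \<sigma>'. 1 \<le> \<sigma> \<Longrightarrow> \<sigma>' < T \<Longrightarrow> 1 + \<sigma>' = 2 * (1 + \<sigma>) \<Longrightarrow> z \<sigma> + d * z \<sigma> powr r \<le> z \<sigma>'"
    and bounded: "\<And>\<sigma>. 1 \<le> \<sigma> \<Longrightarrow> \<sigma> < T \<Longrightarrow> z \<sigma> \<le> b"
  shows "T \<le> exp (u powr (1 - r) / recursion_drop d b r + 2)"
proof (rule le_exp_of_dyadic_bound)
  have drop_pos: "0 < recursion_drop d b r"
    using assms(1,2) by (rule recursion_drop_pos)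
  then show "0 \<le> u powr (1 - r) / recursion_drop d b r" by simp
  fix J :: nat assume J: "2 ^ Suc J - 1 < T"
  define \<sigma> where "\<sigma> = (\<lambda>j. 2 ^ Suc j - 1 :: real)"
  have \<sigma>: "1 \<le> \<sigma> j" "j \<le> J \<Longrightarrow> \<sigma> j < T" "1 + \<sigma> (Suc j) = 2 * (1 + \<sigma> j)" for j
    unfolding \<sigma>_def by (fact dyadic_times[OF J])+
  have "real J \<le> z (\<sigma> 0) powr (1 - r) / recursion_drop d b r"
  proof (rule superlinear_recursion_bound[OF assms(1,2)])
    show "0 < z (\<sigma> 0)" using z_ge[OF \<sigma>(1)] \<open>0 < u\<close> by (rule less_le_trans[rotated])
    show "z (\<sigma> j) + d * z (\<sigma> j) powr r \<le> z (\<sigma> (Suc j))" if "j < J" for j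
      using that by (intro step \<sigma>) auto
    show "z (\<sigma> j) \<le> b" if "j \<le> J" for j
      using that by (intro bounded \<sigma>)
  qed
  also have "\<dots> \<le> u powr (1 - r) / recursion_drop d b r"
    using assms(2,3) z_ge[OF \<sigma>(1)] drop_pos by (intro divide_right_mono powr_mono2') auto
  finally show "real J \<le> u powr (1 - r) / recursion_drop d b r" .
qed

context coupled_pair
begin

proposition lifespan_critical:
  assumes critical: "Gamma_one_sided s p q = 0" and s: "1 / (p - 1) \<le> s"
  defines "d \<equiv> chain_const (C * C0) q powr (- (p * q))" and "b \<equiv> mass_const (C * C0) p q"
  shows "T \<le> exp (u powr (1 - p * q) / recursion_drop d b (p * q) + 2)"
proof (rule lifespan_of_dyadic_recursion[where z = "\<lambda>\<sigma>. u + power_mass k p f \<sigma>"])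
  show "0 < d"
    unfolding d_def using chain_const_pos[OF const_pos, of q] by simp
  show "1 < p * q" using p q by (rule less_1_mult)
  fix \<sigma> :: real assume "1 \<le> \<sigma>"
  then show "u \<le> u + power_mass k p f \<sigma>" using power_mass_nonneg by simp
  show "u + power_mass k p f \<sigma> \<le> b" if "\<sigma> < T"
    using power_mass_bound[OF \<open>1 \<le> \<sigma>\<close> that] \<open>1 \<le> \<sigma>\<close> by (simp add: b_def critical)
qed (use critical_step[OF critical s] u_pos in \<open>simp_all add: d_def\<close>)

proposition lifespan_critical_diagonal:
  assumes critical: "Gamma_one_sided s p q = 0" and diagonal: "p = q" and s: "1 / (p - 1) = s"
  defines "d \<equiv> (C * C0) powr (- p)" and "b \<equiv> mass_const (C * C0) p q"
  shows "T \<le> exp (u powr (1 - p) / recursion_drop d b p + 2)"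
proof -
  define z where "z = (\<lambda>\<sigma>. u + min (power_mass k p f \<sigma>) (power_mass k q g \<sigma>))"
  have z_ge: "u \<le> z \<sigma>" if "1 \<le> \<sigma>" for \<sigma>
    using that power_mass_nonneg by (simp add: z_def)
  have d_pos: "0 < d" using C_pos C0_ge_1 by (simp add: d_def)
  show ?thesis
  proof (rule lifespan_of_dyadic_recursion[OF d_pos p u_pos z_ge])
    fix \<sigma> \<sigma>' assume \<sigma>: "1 \<le> \<sigma>" "\<sigma>' < T" "1 + \<sigma>' = 2 * (1 + \<sigma>)"
    have "d * z \<sigma> powr p \<le> d * (u + power_mass k p f \<sigma>) powr p"
      "d * z \<sigma> powr p \<le> d * (u + power_mass k q g \<sigma>) powr p"
      using d_pos p u_pos z_ge[OF \<sigma>(1)] by (auto intro!: mult_left_mono powr_mono2 simp: z_def)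
    then show "z \<sigma> + d * z \<sigma> powr p \<le> z \<sigma>'"
      using critical_step_diagonal[OF s[unfolded diagonal] \<sigma>]
        coupled_pair.critical_step_diagonal[OF swap s \<sigma>]
      unfolding d_def diagonal z_def by linarith
  next
    fix \<sigma> assume \<sigma>: "1 \<le> \<sigma>" "\<sigma> < T"
    have "z \<sigma> \<le> u + power_mass k p f \<sigma>" by (simp add: z_def)
    also have "\<dots> \<le> b" using power_mass_bound[OF \<sigma>] \<sigma> by (simp add: b_def critical)
    finally show "z \<sigma> \<le> b" .
  qed
qed

end

definition lifespan_bound :: "real \<Rightarrow> real \<Rightarrow> real \<Rightarrow> real \<Rightarrow> real \<Rightarrow> real" where
  "lifespan_bound \<Gamma> p q K \<epsilon> =
    (if 0 < \<Gamma> then K * (1 + \<epsilon> powr (- (1 / \<Gamma>)))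
     else if p \<noteq> q then exp (K * (1 + \<epsilon> powr (- (p * q - 1))))
     else exp (K * (1 + \<epsilon> powr (- (p - 1)))))"

lemma lifespan_bound_commute: "lifespan_bound \<Gamma> p q K \<epsilon> = lifespan_bound \<Gamma> q p K \<epsilon>"
  by (simp add: lifespan_bound_def mult.commute)

lemma lifespan_bound_le:
  assumes "0 \<le> \<Gamma>" "1 < p" "1 < q" "0 < K" "0 < \<epsilon>" "\<epsilon> < 1"
  shows "lifespan_bound \<Gamma> p q K \<epsilon> \<le>
    (if 0 < \<Gamma> then 2 * K * \<epsilon> powr (- (1 / \<Gamma>))
     else if p \<noteq> q then exp (2 * K * \<epsilon> powr (- (p * q - 1)))
     else exp (2 * K * \<epsilon> powr (- (p - 1))))"
proof -
  have "K * (1 + \<epsilon> powr (- e)) \<le> 2 * K * \<epsilon> powr (- e)" if "0 \<le> e" for e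
    using assms powr_mono'[of "- e" 0 \<epsilon>] that by simp
  then show ?thesis
    using assms less_1_mult[OF assms(2,3)] by (simp add: lifespan_bound_def del: minus_diff_eq)
qed

lemma scaled_powr_affine_le:
  fixes a b c e \<epsilon> :: real
  assumes "0 < c" "0 < \<epsilon>"
  shows "a + b * (c * \<epsilon>) powr (- e) \<le> max a (b * c powr (- e)) * (1 + \<epsilon> powr (- e))"
proof -
  have "a + b * (c * \<epsilon>) powr (- e) = a * 1 + (b * c powr (- e)) * \<epsilon> powr (- e)"
    using assms by (simp add: powr_mult)
  also have "\<dots> \<le> max a (b * c powr (- e)) * 1 + max a (b * c powr (- e)) * \<epsilon> powr (- e)"
    by (intro add_mono mult_right_mono) auto
  finally show ?thesis by (simp add: algebra_simps)
qed

lemma inverse_pred_le_of_critical: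
  assumes "Gamma_one_sided s p q = 0" "1 < q" "q \<le> p"
  shows "1 / (p - 1) \<le> s" "p = q \<Longrightarrow> 1 / (p - 1) = s"
proof -
  have p: "1 < p" using assms by simp
  have "1 / (p - 1) = (p + 1) / ((p - 1) * (p + 1))" using p by simp
  also have "\<dots> = (p + 1) / (p * p - 1)" by (simp add: algebra_simps)
  finally have diagonal: "1 / (p - 1) = (p + 1) / (p * p - 1)" .
  have s: "s = (p + 1) / (p * q - 1)" using assms(1) by (simp add: Gamma_one_sided_def)
  then show "p = q \<Longrightarrow> 1 / (p - 1) = s" using diagonal by simp
  show "1 / (p - 1) \<le> s"
    unfolding diagonal s using assms p less_1_mult[OF p p] less_1_mult[OF p assms(2)]
    by (intro divide_left_mono mult_pos_pos) auto
qed

lemma exp_scaled_powr_le: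
  fixes c d e \<epsilon> :: real
  assumes "0 < c" "0 < \<epsilon>"
  shows "exp ((c * \<epsilon>) powr (- e) / d + 2) \<le> exp (max 2 (c powr (- e) / d) * (1 + \<epsilon> powr (- e)))"
  using scaled_powr_affine_le[OF assms, of 2 "1 / d" e] by (simp add: add.commute)

lemma coupled_pair_lifespan_subcritical:
  fixes p q s c C C0 :: real
  assumes \<Gamma>: "0 < Gamma_one_sided s p q" and pos: "0 < c" "0 < C" "0 < C0"
  obtains K where "0 < K"
    "\<And>(M :: 'b measure) time W T k f g \<epsilon>. coupled_pair M time W s C0 T k p q (c * \<epsilon>) C f g \<Longrightarrow>
      0 < \<epsilon> \<Longrightarrow> T \<le> lifespan_bound (Gamma_one_sided s p q) p q K \<epsilon>"
proof -
  define b where "b = mass_const (C * C0) p q"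
  have b: "0 < b"
    using pos chain_const_pos[of "C * C0" q] by (simp add: b_def mass_const_def)
  define \<gamma> where "\<gamma> = 1 / Gamma_one_sided s p q"
  show ?thesis
  proof (rule that[of "max 1 (b powr \<gamma> * c powr (- \<gamma>))"])
    fix M :: "'b measure" and time W T k f g \<epsilon>
    assume "coupled_pair M time W s C0 T k p q (c * \<epsilon>) C f g" "0 < \<epsilon>"
    then have "T \<le> 1 + (b / (c * \<epsilon>)) powr \<gamma>"
      unfolding b_def \<gamma>_def using \<Gamma> by (intro coupled_pair.lifespan_subcritical)
    also have "\<dots> = 1 + b powr \<gamma> * (c * \<epsilon>) powr (- \<gamma>)"
      using b pos \<open>0 < \<epsilon>\<close> by (subst powr_divide) (auto simp: powr_minus divide_inverse)
    also have "\<dots> \<le> max 1 (b powr \<gamma> * c powr (- \<gamma>)) * (1 + \<epsilon> powr (- \<gamma>))"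
      by (rule scaled_powr_affine_le[OF pos(1) \<open>0 < \<epsilon>\<close>])
    finally show "T \<le> lifespan_bound (Gamma_one_sided s p q) p q
        (max 1 (b powr \<gamma> * c powr (- \<gamma>))) \<epsilon>"
      using \<Gamma> by (simp add: lifespan_bound_def \<gamma>_def)
  qed auto
qed

lemma coupled_pair_lifespan_critical:
  fixes p q s c C C0 :: real
  assumes pq: "1 < q" "q \<le> p" "p \<noteq> q" and \<Gamma>: "Gamma_one_sided s p q = 0" and "0 < c"
  obtains K where "0 < K"
    "\<And>(M :: 'b measure) time W T k f g \<epsilon>. coupled_pair M time W s C0 T k p q (c * \<epsilon>) C f g \<Longrightarrow>
      0 < \<epsilon> \<Longrightarrow> T \<le> lifespan_bound (Gamma_one_sided s p q) p q K \<epsilon>"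
proof -
  define d where "d = recursion_drop (chain_const (C * C0) q powr (- (p * q)))
    (mass_const (C * C0) p q) (p * q)"
  show ?thesis
  proof (rule that[of "max 2 (c powr (- (p * q - 1)) / d)"])
    fix M :: "'b measure" and time W T k f g \<epsilon>
    assume "coupled_pair M time W s C0 T k p q (c * \<epsilon>) C f g" "0 < \<epsilon>"
    then have "T \<le> exp ((c * \<epsilon>) powr (- (p * q - 1)) / d + 2)"
      unfolding d_def minus_diff_eq using \<Gamma> inverse_pred_le_of_critical(1)[OF \<Gamma> pq(1,2)]
      by (intro coupled_pair.lifespan_critical)
    also note exp_scaled_powr_le[OF \<open>0 < c\<close> \<open>0 < \<epsilon>\<close>, of "p * q - 1" d]
    finally show "T \<le> lifespan_bound (Gamma_one_sided s p q) p q
        (max 2 (c powr (- (p * q - 1)) / d)) \<epsilon>"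
      using \<Gamma> pq by (simp add: lifespan_bound_def)
  qed auto
qed

lemma coupled_pair_lifespan_critical_diagonal:
  fixes p q s c C C0 :: real
  assumes pq: "1 < q" "p = q" and \<Gamma>: "Gamma_one_sided s p q = 0" and "0 < c"
  obtains K where "0 < K"
    "\<And>(M :: 'b measure) time W T k f g \<epsilon>. coupled_pair M time W s C0 T k p q (c * \<epsilon>) C f g \<Longrightarrow>
      0 < \<epsilon> \<Longrightarrow> T \<le> lifespan_bound (Gamma_one_sided s p q) p q K \<epsilon>"
proof -
  have s: "1 / (p - 1) = s"
    using inverse_pred_le_of_critical(2)[OF \<Gamma> pq(1)] pq(2) by simp
  define d where "d = recursion_drop ((C * C0) powr (- p)) (mass_const (C * C0) p q) p"
  show ?thesis
  proof (rule that[of "max 2 (c powr (- (p - 1)) / d)"])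
    fix M :: "'b measure" and time W T k f g \<epsilon>
    assume "coupled_pair M time W s C0 T k p q (c * \<epsilon>) C f g" "0 < \<epsilon>"
    then have "T \<le> exp ((c * \<epsilon>) powr (- (p - 1)) / d + 2)"
      unfolding d_def minus_diff_eq using \<Gamma> s pq(2)
      by (intro coupled_pair.lifespan_critical_diagonal)
    also note exp_scaled_powr_le[OF \<open>0 < c\<close> \<open>0 < \<epsilon>\<close>, of "p - 1" d]
    finally show "T \<le> lifespan_bound (Gamma_one_sided s p q) p q
        (max 2 (c powr (- (p - 1)) / d)) \<epsilon>"
      using \<Gamma> pq(2) by (simp add: lifespan_bound_def)
  qed auto
qed

lemma coupled_pair_lifespan_ordered:
  fixes p q s c C C0 :: real
  assumes pq: "1 < q" "q \<le> p" and \<Gamma>: "0 \<le> Gamma_one_sided s p q"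
    and pos: "0 < c" "0 < C" "0 < C0"
  obtains K where "0 < K"
    "\<And>(M :: 'b measure) time W T k f g \<epsilon>. coupled_pair M time W s C0 T k p q (c * \<epsilon>) C f g \<Longrightarrow>
      0 < \<epsilon> \<Longrightarrow> T \<le> lifespan_bound (Gamma_one_sided s p q) p q K \<epsilon>"
proof -
  consider (subcritical) "0 < Gamma_one_sided s p q"
    | (critical) "Gamma_one_sided s p q = 0" "p \<noteq> q"
    | (diagonal) "Gamma_one_sided s p q = 0" "p = q"
    using \<Gamma> by linarith
  then show ?thesis
  proof cases
    case subcritical
    show ?thesis
      by (rule coupled_pair_lifespan_subcritical[OF subcritical pos, where 'b = 'b]) (rule that)
  next
    case critical
    show ?thesis
      by (rule coupled_pair_lifespan_critical[OF pq critical(2,1) pos(1), where 'b = 'b])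
        (rule that)
  next
    case diagonal
    show ?thesis
      by (rule coupled_pair_lifespan_critical_diagonal[OF pq(1) diagonal(2,1) pos(1),
            where 'b = 'b]) (rule that)
  qed
qed

lemma GammaGG_commute: "GammaGG n p q = GammaGG n q p"
  by (simp add: GammaGG_def max.commute mult.commute)

lemma GammaGG_eq_one_sided:
  assumes "1 < q" "q \<le> p"
  shows "GammaGG n p q = Gamma_one_sided ((real n - 1) / 2) p q"
proof -
  have "(q + 1) / (p * q - 1) \<le> (p + 1) / (p * q - 1)"
    using assms less_1_mult[of p q] by (intro divide_right_mono) auto
  then show ?thesis by (simp add: GammaGG_def Gamma_one_sided_def)
qed

proposition coupled_pair_lifespan:
  fixes p q c C C0 :: real and n :: nat
  assumes pq: "1 < p" "1 < q" and \<Gamma>: "0 \<le> GammaGG n p q" and pos: "0 < c" "0 < C" "0 < C0"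
  obtains K where "0 < K"
    "\<And>(M :: 'b measure) time W T k f g \<epsilon>.
      coupled_pair M time W ((real n - 1) / 2) C0 T k p q (c * \<epsilon>) C f g \<Longrightarrow>
      0 < \<epsilon> \<Longrightarrow> T \<le> lifespan_bound (GammaGG n p q) p q K \<epsilon>"
proof (cases "q \<le> p")
  case True
  note \<Gamma>_eq = GammaGG_eq_one_sided[OF pq(2) True, of n]
  show ?thesis
    by (rule coupled_pair_lifespan_ordered[OF pq(2) True \<Gamma>[unfolded \<Gamma>_eq] pos, where 'b = 'b])
      (rule that, unfold \<Gamma>_eq)
next
  case False
  then have "p \<le> q" by simp
  note \<Gamma>_eq = GammaGG_eq_one_sided[OF pq(1) this, of n]
  obtain K where K: "0 < K" "\<And>(M :: 'b measure) time W T k f g \<epsilon>.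
      coupled_pair M time W ((real n - 1) / 2) C0 T k q p (c * \<epsilon>) C g f \<Longrightarrow>
      0 < \<epsilon> \<Longrightarrow> T \<le> lifespan_bound (GammaGG n q p) q p K \<epsilon>"
    by (rule coupled_pair_lifespan_ordered[OF pq(1) \<open>p \<le> q\<close> _ pos, where 'b = 'b])
      (use \<Gamma> in \<open>simp add: \<Gamma>_eq GammaGG_commute[of n p]\<close>, rule that, unfold \<Gamma>_eq)
  show ?thesis
    using that[OF K(1)] K(2)[OF coupled_pair.swap]
    by (simp add: GammaGG_commute[of n p] lifespan_bound_commute[of _ p])
qed

section \<open>Integration tools\<close>

lemma integrable_bounded_support:
  fixes f :: "'a::euclidean_space \<Rightarrow> real"
  assumes "f \<in> borel_measurable borel" "\<And>x. \<bar>f x\<bar> \<le> K" "S \<in> sets borel" "bounded S"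
    and "\<And>x. x \<notin> S \<Longrightarrow> f x = 0"
  shows "integrable lborel f"
  by (rule integrableI_bounded_set[of S _ _ K])
    (use assms emeasure_bounded_finite in auto)

lemma continuous_bounded_on_compact:
  fixes f :: "'a::metric_space \<Rightarrow> real"
  assumes "compact K" "continuous_on K f"
  obtains B where "0 \<le> B" "\<And>x. x \<in> K \<Longrightarrow> \<bar>f x\<bar> \<le> B"
proof -
  obtain B where "\<forall>y\<in>f ` K. norm y \<le> B"
    using compact_imp_bounded[OF compact_continuous_image[OF assms(2,1)]] bounded_iff by blast
  then show ?thesis using that[of "max B 0"] by (auto simp: max.coboundedI1)
qed

lemma set_integrable_mult_continuous:
  fixes F G :: "'a::euclidean_space \<Rightarrow> real"
  assumes F: "set_integrable lborel A F" and A: "A \<in> sets borel" "A \<subseteq> K"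
    and K: "compact K" "continuous_on K G"
  shows "set_integrable lborel A (\<lambda>z. F z * G z)"
proof -
  obtain B where B: "0 \<le> B" "\<And>x. x \<in> K \<Longrightarrow> \<bar>G x\<bar> \<le> B"
    using continuous_bounded_on_compact[OF K] by blast
  have "integrable lborel (\<lambda>z. (indicator A z *\<^sub>R F z) * (indicator A z *\<^sub>R G z))"
  proof (rule Bochner_Integration.integrable_bound)
    show "integrable lborel (\<lambda>z. (indicator A z *\<^sub>R F z) * B)"
      using F unfolding set_integrable_def by (rule integrable_mult_left)
    show "AE z in lborel. norm ((indicator A z *\<^sub>R F z) * (indicator A z *\<^sub>R G z))
        \<le> norm ((indicator A z *\<^sub>R F z) * B)"
      using B A(2) by (intro AE_I2) (auto simp: indicator_def abs_mult intro!: mult_left_mono)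
    have "(\<lambda>z. indicator A z *\<^sub>R G z) \<in> borel_measurable borel"
      using A K(2) by (intro borel_measurable_continuous_on_indicator continuous_on_subset[OF K(2)])
    then show "(\<lambda>z. (indicator A z *\<^sub>R F z) * (indicator A z *\<^sub>R G z)) \<in> borel_measurable lborel"
      using F unfolding set_integrable_def by (intro borel_measurable_times) auto
  qed
  also have "(\<lambda>z. (indicator A z *\<^sub>R F z) * (indicator A z *\<^sub>R G z)) =
      (\<lambda>z. indicator A z *\<^sub>R (F z * G z))"
    by (auto simp: indicator_def)
  finally show ?thesis by (simp add: set_integrable_def)
qed

lemma set_integral_restrict_AE:
  fixes f :: "'a \<Rightarrow> real"
  assumes f: "set_integrable M A f" and B: "B \<in> sets M" "B \<subseteq> A"
    and "AE z in M. z \<in> A - B \<longrightarrow> f z = 0"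
  shows "(LINT z:A|M. f z) = (LINT z:B|M. f z)"
  unfolding set_lebesgue_integral_def
proof (rule integral_cong_AE)
  show "(\<lambda>z. indicator A z *\<^sub>R f z) \<in> borel_measurable M"
    "(\<lambda>z. indicator B z *\<^sub>R f z) \<in> borel_measurable M"
    using f set_integrable_subset[OF f B] by (auto simp: set_integrable_def)
  show "AE z in M. indicator A z *\<^sub>R f z = indicator B z *\<^sub>R f z"
    using assms(4) by eventually_elim (use B(2) in \<open>auto simp: indicator_def\<close>)
qed

lemma continuous_on_tensor:
  fixes f :: "'b::topological_space \<Rightarrow> real" and g :: "'c::topological_space \<Rightarrow> real"
  assumes "continuous_on A f" "continuous_on B g"
  shows "continuous_on (A \<times> B) (\<lambda>z. f (fst z) * g (snd z))"
  by (intro continuous_on_mult continuous_on_compose2[OF assms(1)]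
      continuous_on_compose2[OF assms(2)]
      continuous_on_fst continuous_on_snd continuous_on_id) auto

lemma set_integral_mult_uniform_limit:
  fixes F :: "'a::euclidean_space \<Rightarrow> real"
  assumes F: "set_integrable lborel A F" and A: "A \<in> sets borel" "A \<subseteq> K" and K: "compact K"
    and cont: "\<And>j. continuous_on K (G j)" "continuous_on K H"
    and limit: "uniform_limit A G H sequentially"
  shows "(\<lambda>j. LINT z:A|lborel. F z * G j z) \<longlonglongrightarrow> (LINT z:A|lborel. F z * H z)"
proof (rule LIMSEQ_I)
  fix e :: real assume "0 < e"
  have int: "set_integrable lborel A (\<lambda>z. F z * G j z)" "set_integrable lborel A (\<lambda>z. F z * H z)"
    "set_integrable lborel A (\<lambda>z. \<bar>F z\<bar>)" for j
    by (intro set_integrable_mult_continuous[OF F A K] set_integrable_abs F cont)+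
  define I where "I = (LINT z:A|lborel. \<bar>F z\<bar>)"
  have I: "0 \<le> I"
    unfolding I_def set_lebesgue_integral_def by (intro Bochner_Integration.integral_nonneg) simp
  define d where "d = e / (I + 1)"
  have d: "0 < d" using \<open>0 < e\<close> I by (simp add: d_def)
  obtain J where J: "\<And>j z. J \<le> j \<Longrightarrow> z \<in> A \<Longrightarrow> \<bar>G j z - H z\<bar> < d"
    using uniform_limitD[OF limit d] unfolding eventually_sequentially dist_real_def by blast
  have "norm ((LINT z:A|lborel. F z * G j z) - (LINT z:A|lborel. F z * H z)) < e" if "J \<le> j" for j
  proof -
    have "\<bar>LINT z:A|lborel. F z * G j z - F z * H z\<bar> \<le> (LINT z:A|lborel. \<bar>F z * G j z - F z * H z\<bar>)"
      unfolding set_lebesgue_integral_def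
      by (rule order_trans[OF integral_abs_bound]) (simp add: abs_mult)
    also have "\<dots> \<le> (LINT z:A|lborel. \<bar>F z\<bar> * d)"
      using int F J[OF that] A(1)
      by (intro set_integral_mono set_integrable_abs set_integral_diff set_integrable_mult_left)
        (auto simp: abs_mult less_imp_le simp flip: right_diff_distrib intro!: mult_left_mono)
    also have "\<dots> = I * d" by (simp add: I_def)
    also have "\<dots> < (I + 1) * d" using d by simp
    also have "\<dots> = e" using I by (simp add: d_def)
    finally show ?thesis using int by (simp add: set_integral_diff)
  qed
  then show "\<exists>J. \<forall>j\<ge>J. norm ((LINT z:A|lborel. F z * G j z) - (LINT z:A|lborel. F z * H z)) < e"
    by blast
qed

lemma uniform_limit_tensor:
  fixes f :: "nat \<Rightarrow> 'b::metric_space \<Rightarrow> real" and g :: "nat \<Rightarrow> 'c::metric_space \<Rightarrow> real"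
  assumes "compact A" "continuous_on A f'" "uniform_limit A f f' sequentially"
    and "compact B" "continuous_on B g'" "uniform_limit B g g' sequentially"
  shows "uniform_limit (A \<times> B) (\<lambda>j z. f j (fst z) * g j (snd z)) (\<lambda>z. f' (fst z) * g' (snd z))
      sequentially"
proof (rule uniform_lim_mult)
  show "uniform_limit (A \<times> B) (\<lambda>j z. f j (fst z)) (\<lambda>z. f' (fst z)) sequentially"
    by (rule uniform_limit_compose'[OF assms(3)]) auto
  show "uniform_limit (A \<times> B) (\<lambda>j z. g j (snd z)) (\<lambda>z. g' (snd z)) sequentially"
    by (rule uniform_limit_compose'[OF assms(6)]) auto
  have "bounded (f' ` A)" "bounded (g' ` B)"
    using assms by (auto intro!: compact_imp_bounded compact_continuous_image)
  then show "bounded ((\<lambda>z. f' (fst z)) ` (A \<times> B))" "bounded ((\<lambda>z. g' (snd z)) ` (A \<times> B))"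
    by (auto intro: bounded_subset)
qed

lemma integral_by_parts_vanishing:
  fixes f g f' g' :: "real \<Rightarrow> real"
  assumes "a \<le> b"
    and f: "\<And>t. t \<in> {a..b} \<Longrightarrow> (f has_real_derivative f' t) (at t within {a..b})"
        "continuous_on {a..b} f'"
    and g: "\<And>t. t \<in> {a..b} \<Longrightarrow> (g has_real_derivative g' t) (at t within {a..b})"
        "continuous_on {a..b} g'"
    and "f b = 0"
  shows "integral {a..b} (\<lambda>t. f' t * g t) = - f a * g a - integral {a..b} (\<lambda>t. f t * g' t)"
proof -
  have cont: "continuous_on {a..b} f" "continuous_on {a..b} g"
    using f(1) g(1) DERIV_continuous_on by blast+
  have "((\<lambda>t. f' t * g t + f t * g' t) has_integral f b * g b - f a * g a) {a..b}"
  proof (rule fundamental_theorem_of_calculus[OF \<open>a \<le> b\<close>])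
    fix t assume "t \<in> {a..b}"
    from DERIV_mult[OF f(1)[OF this] g(1)[OF this]]
    show "((\<lambda>t. f t * g t) has_vector_derivative f' t * g t + f t * g' t) (at t within {a..b})"
      by (simp add: has_real_derivative_iff_has_vector_derivative mult.commute)
  qed
  moreover have "(\<lambda>t. f' t * g t) integrable_on {a..b}" "(\<lambda>t. f t * g' t) integrable_on {a..b}"
    by (intro integrable_continuous_real continuous_on_mult cont f g)+
  ultimately show ?thesis
    using \<open>f b = 0\<close> by (simp add: integral_unique integral_add[symmetric] eq_diff_eq)
qed

lemma strip_integral_eq_integral:
  fixes F :: "real \<times> 'a::euclidean_space \<Rightarrow> real" and f :: "real \<Rightarrow> real"
  assumes F: "set_integrable lborel ({0<..<T} \<times> UNIV) F"
    and slices: "\<And>t. 0 < t \<Longrightarrow> t < T \<Longrightarrow> (\<integral>x. F (t, x) \<partial>lborel) = f t"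
    and f: "continuous_on {0..b} f" "\<And>t. b < t \<Longrightarrow> f t = 0" and b: "0 \<le> b" "b < T"
  shows "(LINT z:{0<..<T} \<times> UNIV|lborel. F z) = integral {0..b} f"
proof -
  have "integrable (lborel \<Otimes>\<^sub>M lborel) (\<lambda>z. indicator ({0<..<T} \<times> UNIV) z *\<^sub>R F z)"
    using F unfolding set_integrable_def lborel_prod .
  from lborel_pair.integral_fst'[OF this] have "(LINT z:{0<..<T} \<times> UNIV|lborel. F z) =
      (\<integral>t. \<integral>x. indicator ({0<..<T} \<times> (UNIV :: 'a set)) (t, x) *\<^sub>R F (t, x) \<partial>lborel \<partial>lborel)"
    unfolding set_lebesgue_integral_def by (simp add: lborel_prod)
  also have "\<dots> = (\<integral>t. indicator {0<..} t *\<^sub>R indicator {0..b} t *\<^sub>R f t \<partial>lborel)"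
    using slices f(2) b
    by (intro Bochner_Integration.integral_cong refl) (auto simp: indicator_def not_le)
  also have "\<dots> = (\<integral>t. indicator {0..b} t *\<^sub>R f t \<partial>lborel)"
  proof (rule integral_cong_AE)
    show "(\<lambda>t. indicator {0..b} t *\<^sub>R f t) \<in> borel_measurable lborel"
      using borel_measurable_continuous_on_indicator[OF _ f(1)] by simp
    then show "(\<lambda>t. indicator {0<..} t *\<^sub>R indicator {0..b} t *\<^sub>R f t) \<in> borel_measurable lborel"
      by measurable
    show "AE t in lborel. indicator {0<..} t *\<^sub>R indicator {0..b} t *\<^sub>R f t =
        indicator {0..b} t *\<^sub>R f t"
      using AE_lborel_singleton[of "0 :: real"] by eventually_elim (auto simp: indicator_def)
  qed
  also have "\<dots> = integral {0..b} f"
    using set_borel_integral_eq_integral(2)[OF borel_integrable_atLeastAtMost'[OF f(1)]]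
    by (simp add: set_lebesgue_integral_def)
  finally show ?thesis .
qed

section \<open>Square-integrable functions\<close>

lemma is_L2_measurable: "is_L2 f \<Longrightarrow> f \<in> borel_measurable borel"
  by (simp add: is_L2_def)

lemma is_L2_dominated:
  fixes f :: "'a::euclidean_space \<Rightarrow> real"
    and g :: "'a \<Rightarrow> 'c::{real_normed_vector, second_countable_topology}"
  assumes "is_L2 g" "f \<in> borel_measurable borel" "\<And>x. \<bar>f x\<bar> \<le> norm (g x)"
  shows "is_L2 f"
proof -
  have "integrable lborel (\<lambda>x. (norm (f x))\<^sup>2)"
  proof (rule Bochner_Integration.integrable_bound)
    show "integrable lborel (\<lambda>x. (norm (g x))\<^sup>2)" using assms(1) by (simp add: is_L2_def)
    show "AE x in lborel. norm ((norm (f x))\<^sup>2) \<le> norm ((norm (g x))\<^sup>2)"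
      using power_mono[OF assms(3) abs_ge_zero, of _ 2] by (intro AE_I2) simp
  qed (use assms(2) in measurable)
  then show ?thesis using assms(2) by (simp add: is_L2_def)
qed

lemma is_L2_cmult:
  fixes f :: "'a::euclidean_space \<Rightarrow> real"
  assumes "is_L2 f" shows "is_L2 (\<lambda>x. c * f x)"
  using assms by (auto simp: is_L2_def power_mult_distrib)

lemma is_L2_diff:
  fixes f g :: "'a::euclidean_space \<Rightarrow> real"
  assumes "is_L2 f" "is_L2 g" shows "is_L2 (\<lambda>x. f x - g x)"
proof -
  have [measurable]: "f \<in> borel_measurable borel" "g \<in> borel_measurable borel"
    using assms by (auto dest: is_L2_measurable)
  have "integrable lborel (\<lambda>x. (norm (f x - g x))\<^sup>2)"
  proof (rule Bochner_Integration.integrable_bound)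
    show "integrable lborel (\<lambda>x. 2 * (norm (f x))\<^sup>2 + 2 * (norm (g x))\<^sup>2)"
      using assms by (auto simp: is_L2_def)
    have "(f x - g x)\<^sup>2 \<le> 2 * (f x)\<^sup>2 + 2 * (g x)\<^sup>2" for x
      using zero_le_power2[of "f x + g x"] by (simp add: power2_eq_square algebra_simps)
    then show "AE x in lborel. norm ((norm (f x - g x))\<^sup>2) \<le>
        norm (2 * (norm (f x))\<^sup>2 + 2 * (norm (g x))\<^sup>2)"
      by (intro AE_I2) simp
  qed measurable
  then show ?thesis by (simp add: is_L2_def)
qed

lemma is_L2_continuous_support:
  fixes h :: "'a::euclidean_space \<Rightarrow> real"
  assumes "continuous_on UNIV h" "\<And>x. L < norm x \<Longrightarrow> h x = 0"
  shows "is_L2 h"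
proof -
  have [measurable]: "h \<in> borel_measurable borel"
    using assms(1) by (rule borel_measurable_continuous_onI)
  obtain B where "0 \<le> B" "\<And>x. x \<in> cball 0 L \<Longrightarrow> \<bar>h x\<bar> \<le> B"
    using continuous_bounded_on_compact[of "cball 0 L" h] continuous_on_subset[OF assms(1)] by auto
  then have "\<bar>(h x)\<^sup>2\<bar> \<le> B\<^sup>2" for x
    using assms(2)[of x] power_mono[of "\<bar>h x\<bar>" B 2] by (cases "norm x \<le> L") auto
  then have "integrable lborel (\<lambda>x. (h x)\<^sup>2)"
    using assms(2) by (intro integrable_bounded_support[of _ "B\<^sup>2" "cball 0 L"]) auto
  then show ?thesis by (simp add: is_L2_def)
qed

lemma L2_pairing:
  fixes f g :: "'a::euclidean_space \<Rightarrow> real"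
  assumes "is_L2 f" "is_L2 g"
  shows L2_pairing_integrable: "integrable lborel (\<lambda>x. f x * g x)"
    and L2_pairing_bound: "\<bar>\<integral>x. f x * g x \<partial>lborel\<bar> \<le> L2norm f * L2norm g"
proof -
  have [measurable]: "f \<in> borel_measurable borel" "g \<in> borel_measurable borel"
    using assms by (auto dest: is_L2_measurable)
  have squares: "integrable lborel (\<lambda>x. (f x)\<^sup>2)" "integrable lborel (\<lambda>x. (g x)\<^sup>2)"
    using assms by (auto simp: is_L2_def)
  have sqrt_eq: "((f x)\<^sup>2) powr (1/2) * ((g x)\<^sup>2) powr (1 - 1/2) = \<bar>f x * g x\<bar>" for x
    by (simp add: powr_half_sqrt abs_mult)
  have "integrable lborel (\<lambda>x. \<bar>f x * g x\<bar>)"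
    using integrable_powr_mult_powr[OF squares(1) _ squares(2), of "1/2", unfolded sqrt_eq] by auto
  then show "integrable lborel (\<lambda>x. f x * g x)"
    by (rule Bochner_Integration.integrable_bound) auto
  have "\<bar>\<integral>x. f x * g x \<partial>lborel\<bar> \<le> (\<integral>x. \<bar>f x * g x\<bar> \<partial>lborel)"
    by (rule integral_abs_bound)
  also have "\<dots> \<le> L2norm f * L2norm g"
    using Hoelder_powr[OF squares(1) _ squares(2), of "1/2", unfolded sqrt_eq]
    by (simp add: L2norm_def powr_half_sqrt)
  finally show "\<bar>\<integral>x. f x * g x \<partial>lborel\<bar> \<le> L2norm f * L2norm g" .
qed

lemma L2_pairing_tendsto:
  fixes f h :: "'a::euclidean_space \<Rightarrow> real"
  assumes "\<And>s. s \<in> S \<Longrightarrow> is_L2 (F s)" "is_L2 f" "is_L2 h"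
    and limit: "((\<lambda>s. L2norm (\<lambda>x. F s x - f x)) \<longlongrightarrow> 0) (at t within S)"
  shows "((\<lambda>s. \<integral>x. F s x * h x \<partial>lborel) \<longlongrightarrow> (\<integral>x. f x * h x \<partial>lborel)) (at t within S)"
proof (rule LIM_zero_cancel, rule Lim_null_comparison)
  have "norm ((\<integral>x. F s x * h x \<partial>lborel) - (\<integral>x. f x * h x \<partial>lborel))
      \<le> L2norm (\<lambda>x. F s x - f x) * L2norm h" if "s \<in> S" for s
  proof -
    have "(\<integral>x. (F s x - f x) * h x \<partial>lborel) = (\<integral>x. F s x * h x \<partial>lborel) - (\<integral>x. f x * h x \<partial>lborel)"
      using assms that by (simp add: left_diff_distrib L2_pairing_integrable)
    then show ?thesis
      using L2_pairing_bound[OF is_L2_diff] assms that by (metis real_norm_def)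
  qed
  then show "\<forall>\<^sub>F s in at t within S. norm ((\<integral>x. F s x * h x \<partial>lborel) - (\<integral>x. f x * h x \<partial>lborel))
      \<le> L2norm (\<lambda>x. F s x - f x) * L2norm h"
    by (auto simp: eventually_at_filter)
  show "((\<lambda>s. L2norm (\<lambda>x. F s x - f x) * L2norm h) \<longlongrightarrow> 0) (at t within S)"
    by (rule tendsto_mult_left_zero[OF limit])
qed

lemma C1_L2_is_L2:
  assumes "C1_L2 T w wt" "t \<in> {0..<T}"
  shows "is_L2 (w t)" "is_L2 (wt t)"
  using assms by (auto simp: C1_L2_def)

lemma C1_L2_pairing_derivative:
  fixes w wt :: "real \<Rightarrow> 'a::euclidean_space \<Rightarrow> real"
  assumes w: "C1_L2 T w wt" and h: "is_L2 h" and t: "t \<in> {0..<T}"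
  shows "((\<lambda>t. \<integral>x. w t x * h x \<partial>lborel) has_real_derivative (\<integral>x. wt t x * h x \<partial>lborel))
    (at t within {0..<T})"
  unfolding has_field_derivative_iff
proof -
  define q where "q = (\<lambda>s x. (w s x - w t x) / (s - t))"
  have q_L2: "is_L2 (q s)" if "s \<in> {0..<T}" for s
    unfolding q_def divide_inverse mult.commute[of _ "inverse _"]
    using that t by (intro is_L2_cmult is_L2_diff C1_L2_is_L2[OF w])
  have limit: "((\<lambda>s. \<integral>x. q s x * h x \<partial>lborel) \<longlongrightarrow> (\<integral>x. wt t x * h x \<partial>lborel)) (at t within {0..<T})"
  proof (rule L2_pairing_tendsto[OF q_L2 C1_L2_is_L2(2)[OF w t] h])
    show "((\<lambda>s. L2norm (\<lambda>x. q s x - wt t x)) \<longlongrightarrow> 0) (at t within {0..<T})"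
      unfolding q_def using w t by (auto simp: C1_L2_def)
  qed
  have quotient: "(\<integral>x. q s x * h x \<partial>lborel) =
      ((\<integral>x. w s x * h x \<partial>lborel) - (\<integral>x. w t x * h x \<partial>lborel)) / (s - t)" if "s \<in> {0..<T}" for s
  proof -
    have "(\<integral>x. q s x * h x \<partial>lborel) = (\<integral>x. (w s x * h x - w t x * h x) / (s - t) \<partial>lborel)"
      by (simp add: q_def left_diff_distrib)
    then show ?thesis
      using L2_pairing_integrable[OF C1_L2_is_L2(1)[OF w that] h]
        L2_pairing_integrable[OF C1_L2_is_L2(1)[OF w t] h] by simp
  qed
  show "((\<lambda>s. ((\<integral>x. w s x * h x \<partial>lborel) - (\<integral>x. w t x * h x \<partial>lborel)) / (s - t))
      \<longlongrightarrow> (\<integral>x. wt t x * h x \<partial>lborel)) (at t within {0..<T})"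
    by (rule Lim_transform_eventually[OF limit]) (simp add: eventually_at_filter quotient)
qed

lemma C1_L2_pairing_continuous:
  fixes w wt :: "real \<Rightarrow> 'a::euclidean_space \<Rightarrow> real"
  assumes w: "C1_L2 T w wt" and h: "is_L2 h"
  shows "continuous_on {0..<T} (\<lambda>t. \<integral>x. wt t x * h x \<partial>lborel)"
  unfolding continuous_on_def
proof
  fix t assume t: "t \<in> {0..<T}"
  show "((\<lambda>t. \<integral>x. wt t x * h x \<partial>lborel) \<longlongrightarrow> (\<integral>x. wt t x * h x \<partial>lborel)) (at t within {0..<T})"
    by (rule L2_pairing_tendsto[OF C1_L2_is_L2(2)[OF w] C1_L2_is_L2(2)[OF w t] h])
      (use w t in \<open>auto simp: C1_L2_def\<close>)
qed

subsection \<open>Propagation of support to the time derivative\<close>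

lemma time_derivative_support:
  fixes w wt :: "real \<Rightarrow> 'a::euclidean_space \<Rightarrow> real"
  assumes w: "C1_L2 T w wt" and t: "0 < t" "t < T"
    and supp: "\<And>t. t \<in> {0..<T} \<Longrightarrow> AE x in lborel. t + R < norm x \<longrightarrow> w t x = 0"
  shows "AE x in lborel. t + R < norm x \<longrightarrow> wt t x = 0"
proof -
  have tT: "t \<in> {0..<T}" using t by auto
  define outside where "outside = {x::'a. t + R < norm x}"
  have [measurable]: "outside \<in> sets borel" unfolding outside_def by measurable
  have [measurable]: "wt t \<in> borel_measurable borel"
    by (rule is_L2_measurable[OF C1_L2_is_L2(2)[OF w tT]])
  define h where "h = (\<lambda>x. indicator outside x * wt t x)"
  have h: "is_L2 h"
    unfolding h_def
    by (rule is_L2_dominated[OF C1_L2_is_L2(2)[OF w tT]]) (auto simp: indicator_def)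
  have vanish: "(\<integral>x. w s x * h x \<partial>lborel) = 0" if "s \<in> {0..t}" for s
  proof (rule integral_eq_zero_AE)
    have "s \<in> {0..<T}" using that t by auto
    from supp[OF this] show "AE x in lborel. w s x * h x = 0"
      by eventually_elim (use that in \<open>auto simp: h_def outside_def indicator_def\<close>)
  qed
  have "((\<lambda>s. \<integral>x. w s x * h x \<partial>lborel) has_real_derivative (\<integral>x. wt t x * h x \<partial>lborel))
      (at t within {0..t})"
    by (rule DERIV_subset[OF C1_L2_pairing_derivative[OF w h tT]]) (use t in auto)
  then have "((\<lambda>_. 0) has_real_derivative (\<integral>x. wt t x * h x \<partial>lborel)) (at t within {0..t})"
    by (rule has_field_derivative_transform_within[where d = 1]) (use t vanish in auto)
  then have "(\<integral>x. wt t x * h x \<partial>lborel) = 0"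
    by (rule has_field_derivative_unique[OF _ DERIV_const])
      (use t in \<open>simp add: at_within_Icc_at_left\<close>)
  moreover have "wt t x * h x = (h x)\<^sup>2" for x
    by (simp add: h_def power2_eq_square indicator_def)
  ultimately have "AE x in lborel. (h x)\<^sup>2 = 0"
    using integral_nonneg_eq_0_iff_AE[of lborel "\<lambda>x. (h x)\<^sup>2"] h by (simp add: is_L2_def)
  then show ?thesis
    by eventually_elim (auto simp: h_def outside_def)
qed

lemma time_derivative_cone_AE:
  fixes w wt :: "real \<Rightarrow> 'a::euclidean_space \<Rightarrow> real"
  assumes w: "C1_L2 T w wt" and meas: "(\<lambda>z. wt (fst z) (snd z)) \<in> borel_measurable borel"
    and supp: "\<And>t. t \<in> {0..<T} \<Longrightarrow> AE x in lborel. t + R < norm x \<longrightarrow> w t x = 0"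
  shows "AE z in lborel. 0 < fst z \<and> fst z < T \<and> fst z + R < norm (snd z) \<longrightarrow> wt (fst z) (snd z) = 0"
    (is "AE z in lborel. ?P z")
proof -
  have [measurable]: "(\<lambda>z. wt (fst z) (snd z)) \<in> borel_measurable (borel \<Otimes>\<^sub>M borel)"
    using meas by (simp add: borel_prod)
  have "{z \<in> space (borel \<Otimes>\<^sub>M borel). ?P z} \<in> sets (borel \<Otimes>\<^sub>M borel)"
    by measurable
  then have "{z \<in> space (lborel \<Otimes>\<^sub>M lborel). ?P z} \<in> sets (lborel \<Otimes>\<^sub>M lborel)"
    by (simp add: space_pair_measure borel_prod lborel_prod)
  moreover have "AE t in lborel. AE x in lborel. ?P (t, x)"
  proof (rule AE_I2)
    fix t :: real
    show "AE x in lborel. ?P (t, x)"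
    proof (cases "0 < t \<and> t < T")
      case True
      then show ?thesis
        using time_derivative_support[OF w _ _ supp, of t] by (auto elim: eventually_mono)
    qed auto
  qed
  ultimately have "AE z in lborel \<Otimes>\<^sub>M lborel. ?P z"
    by (rule lborel_pair.AE_pair_measure)
  then show ?thesis unfolding lborel_prod .
qed

section \<open>Weak solutions tested with products\<close>

lemma frechet_derivative_product:
  fixes \<theta> :: "real \<Rightarrow> real" and \<zeta> :: "'a::euclidean_space \<Rightarrow> real"
  assumes "smooth_fun \<theta>" "smooth_fun \<zeta>"
  shows "frechet_derivative (\<lambda>z. \<theta> (fst z) * \<zeta> (snd z)) (at (t, x)) (a, y) =
    a * deriv \<theta> t * \<zeta> x + \<theta> t * frechet_derivative \<zeta> (at x) y"
proof -
  have "((\<lambda>z. \<theta> (fst z)) has_derivative (\<lambda>v. deriv \<theta> t * fst v)) (at (t, x))"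
    using smooth_fun_has_real_derivative[OF assms(1), of t]
    by (auto intro!: has_derivative_compose[where f = fst, OF has_derivative_fst]
        simp: has_field_derivative_def)
  moreover have "((\<lambda>z. \<zeta> (snd z)) has_derivative (\<lambda>v. frechet_derivative \<zeta> (at x) (snd v)))
      (at (t, x))"
    using smooth_fun_differentiable[OF assms(2), of x]
    by (auto intro!: has_derivative_compose[where f = snd, OF has_derivative_snd]
        simp: frechet_derivative_works)
  ultimately show ?thesis
    by (subst frechet_derivative_at[OF has_derivative_mult, symmetric]) (auto simp: algebra_simps)
qed

lemma test_fun_product:
  fixes \<theta> :: "real \<Rightarrow> real" and \<zeta> :: "'a::euclidean_space \<Rightarrow> real"
  assumes "smooth_fun \<theta>" "smooth_fun \<zeta>" "b < T"
    and "\<And>t. b \<le> \<bar>t\<bar> \<Longrightarrow> \<theta> t = 0" "\<And>x. L \<le> norm x \<Longrightarrow> \<zeta> x = 0"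
  shows "test_fun T (\<lambda>z. \<theta> (fst z) * \<zeta> (snd z))"
proof -
  have "smooth_fun (\<lambda>z::real \<times> 'a. \<theta> (fst z) * \<zeta> (snd z))"
    by (intro smooth_fun_mult smooth_fun_compose_linear[OF assms(1)]
        smooth_fun_compose_linear[OF assms(2)] bounded_linear_fst bounded_linear_snd)
  moreover have "\<theta> (fst z) * \<zeta> (snd z) = 0" if "z \<notin> {-b..b} \<times> cball (0::'a) L" for z
    using that assms(4)[of "fst z"] assms(5)[of "snd z"]
    by (cases z) (auto simp: abs_real_def split: if_splits)
  ultimately show ?thesis
    unfolding test_fun_def using assms(3)
    by (intro conjI exI[of _ "{-b..b} \<times> cball (0::'a) L"]) (auto intro: compact_Times)
qed

lemma strip_cutoffs:
  assumes "0 < T" "b < T"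
  obtains a b' L' and \<theta> :: "real \<Rightarrow> real" and \<zeta> :: "'a::euclidean_space \<Rightarrow> real"
  where "b < a" "b' < T" "smooth_fun \<theta>" "smooth_fun \<zeta>"
    "\<And>t. b' \<le> \<bar>t\<bar> \<Longrightarrow> \<theta> t = 0" "\<And>x. L' \<le> norm x \<Longrightarrow> \<zeta> x = 0"
    "\<And>t. \<bar>t\<bar> \<le> a \<Longrightarrow> \<theta> t = 1" "\<And>x. norm x \<le> L \<Longrightarrow> \<zeta> x = 1"
proof -
  define a where "a = (max b 0 + T) / 2"
  have a: "0 \<le> a" "a < (a + T) / 2" "(a + T) / 2 < T" "b < a"
    using assms by (auto simp: a_def max_def)
  obtain \<theta> :: "real \<Rightarrow> real" where \<theta>: "smooth_fun \<theta>" "\<And>t. norm t \<le> a \<Longrightarrow> \<theta> t = 1"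
      "\<And>t. (a + T) / 2 \<le> norm t \<Longrightarrow> \<theta> t = 0"
    by (rule smooth_cutoff[OF a(1,2), where 'a = real]) (rule that)
  obtain \<zeta> :: "'a \<Rightarrow> real" where \<zeta>: "smooth_fun \<zeta>" "\<And>x. norm x \<le> max L 0 \<Longrightarrow> \<zeta> x = 1"
      "\<And>x. max L 0 + 1 \<le> norm x \<Longrightarrow> \<zeta> x = 0"
    by (rule smooth_cutoff[OF max.cobounded2[of 0 L] less_add_one, where 'a = 'a]) (rule that)
  show ?thesis
    by (rule that[of a "(a + T) / 2" \<theta> \<zeta> "max L 0 + 1"]) (use a \<theta> \<zeta> in auto)
qed

definition strip_integrable :: "real \<Rightarrow> (real \<times> 'a::euclidean_space \<Rightarrow> real) \<Rightarrow> bool" where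
  "strip_integrable T F \<longleftrightarrow> (\<forall>b L. b < T \<longrightarrow> set_integrable lborel ({0<..b} \<times> cball 0 L) F)"

definition tail :: "real \<Rightarrow> (real \<Rightarrow> real) \<Rightarrow> real \<Rightarrow> real" where
  "tail b \<theta> t = integral {t..b} \<theta>"

lemma DERIV_tail:
  assumes "continuous_on {0..b} \<theta>" "t \<in> {0..b}"
  shows "(tail b \<theta> has_real_derivative - \<theta> t) (at t within {0..b})"
proof -
  have split: "integral {0..b} \<theta> - integral {0..u} \<theta> = tail b \<theta> u" if "u \<in> {0..b}" for u
    using Henstock_Kurzweil_Integration.integral_combine[of 0 u b \<theta>] that
      integrable_continuous_real[OF assms(1)] by (auto simp: tail_def)
  have "((\<lambda>u. integral {0..b} \<theta> - integral {0..u} \<theta>) has_real_derivative - \<theta> t)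
      (at t within {0..b})"
    using DERIV_diff[OF DERIV_const integral_has_real_derivative[OF assms]] by simp
  then show ?thesis
    by (rule has_field_derivative_transform_within[where d = 1]) (use assms(2) split in auto)
qed

lemma continuous_on_tail: "continuous_on {0..b} \<theta> \<Longrightarrow> continuous_on {0..b} (tail b \<theta>)"
  by (rule DERIV_continuous_on) (rule DERIV_tail)

lemma tail_end: "tail b \<theta> b = 0"
  by (simp add: tail_def)

lemma uniform_limit_tail:
  assumes "\<And>j. continuous_on {0..b} (\<theta> j)" "continuous_on {0..b} \<eta>"
    and limit: "uniform_limit {0..b} \<theta> \<eta> sequentially"
  shows "uniform_limit {0..b} (\<lambda>j. tail b (\<theta> j)) (tail b \<eta>) sequentially"
proof (rule uniform_limitI)
  fix e :: real assume "0 < e"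
  define d where "d = e / (\<bar>b\<bar> + 1)"
  have "0 < d" using \<open>0 < e\<close> by (simp add: d_def)
  show "\<forall>\<^sub>F j in sequentially. \<forall>t\<in>{0..b}. dist (tail b (\<theta> j) t) (tail b \<eta> t) < e"
    using uniform_limitD[OF limit \<open>0 < d\<close>]
  proof eventually_elim
    case (elim j)
    show ?case
    proof
      fix t assume t: "t \<in> {0..b}"
      have cont: "continuous_on {t..b} (\<theta> j)" "continuous_on {t..b} \<eta>"
        using t by (auto intro: continuous_on_subset[OF assms(1)] continuous_on_subset[OF assms(2)])
      have "norm (integral {t..b} (\<lambda>s. \<theta> j s - \<eta> s)) \<le> d * (b - t)"
        using t elim by (intro integral_bound continuous_on_diff cont)
          (auto simp: dist_real_def intro!: less_imp_le)
      also have "\<dots> \<le> d * \<bar>b\<bar>" using t \<open>0 < d\<close> by (intro mult_left_mono) auto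
      also have "\<dots> < d * (\<bar>b\<bar> + 1)" using \<open>0 < d\<close> by simp
      also have "\<dots> = e" by (simp add: d_def)
      finally show "dist (tail b (\<theta> j) t) (tail b \<eta> t) < e"
        using cont by (simp add: dist_real_def tail_def integral_diff integrable_continuous_real)
    qed
  qed
qed

lemma tail_derivative:
  assumes "\<And>t. (f has_real_derivative f' t) (at t)" "t \<le> b"
  shows "tail b f' t = f b - f t"
  unfolding tail_def
  by (intro integral_unique fundamental_theorem_of_calculus assms)
    (use assms(1) in \<open>auto simp: has_real_derivative_iff_has_vector_derivative[symmetric]
      intro: has_field_derivative_at_within\<close>)

lemma polynomial_antiderivative:
  fixes g :: "real \<Rightarrow> real"
  assumes "polynomial_function g"
  obtains G where "smooth_fun G" "\<And>t. (G has_real_derivative g t) (at t)" "G b = y"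
proof -
  obtain c m where g: "g = (\<lambda>t. \<Sum>i\<le>m. c i * t ^ i)"
    using assms unfolding real_polynomial_function_eq[symmetric] real_polynomial_function_iff_sum
    by (elim exE)
  define G where "G = (\<lambda>t. \<Sum>i\<le>m. c i / real (Suc i) * (t ^ Suc i - b ^ Suc i))"
  have smooth: "smooth_fun G" unfolding G_def
    by (intro smooth_fun_sum smooth_fun_mult smooth_fun_const smooth_fun_diff smooth_fun_power
        smooth_fun_linear bounded_linear_ident)
  have deriv: "(G has_real_derivative g t) (at t)" for t
    unfolding G_def g
    by (auto intro!: derivative_eq_intros sum.cong simp del: power_Suc of_nat_Suc)
  show ?thesis
  proof (rule that[of "\<lambda>t. G t + y"])
    show "smooth_fun (\<lambda>t. G t + y)" by (intro smooth_fun_add smooth smooth_fun_const)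
    show "((\<lambda>t. G t + y) has_real_derivative g t) (at t)" for t
      using DERIV_add[OF deriv DERIV_const] by simp
    show "G b + y = y" by (simp add: G_def)
  qed
qed

lemma deriv_eq_0_beyond:
  fixes \<theta> :: "real \<Rightarrow> real"
  assumes "(\<theta> has_real_derivative d) (at t)" "\<And>u. \<sigma> \<le> u \<Longrightarrow> \<theta> u = 0" "\<sigma> \<le> t"
  shows "d = 0"
proof -
  have "((\<lambda>_. 0) has_real_derivative d) (at t within {t..t+1})"
    by (rule has_field_derivative_transform_within[OF has_field_derivative_at_within[OF assms(1)]
          zero_less_one]) (use assms(2,3) in auto)
  then show ?thesis
    by (rule has_field_derivative_unique[OF _ DERIV_const]) (simp add: at_within_Icc_at_right)
qed

lemma deriv_eq_0_inside:
  fixes \<kappa> :: "real \<Rightarrow> real"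
  assumes "\<And>t. norm t \<le> \<sigma> \<Longrightarrow> \<kappa> t = 1" "norm t < \<sigma>"
  shows "deriv \<kappa> t = 0"
proof (rule DERIV_imp_deriv)
  show "(\<kappa> has_real_derivative 0) (at t)"
    by (rule has_field_derivative_transform_within_open[OF DERIV_const, where S = "{-\<sigma><..<\<sigma>}"])
      (use assms in auto)
qed

lemma C1_polynomial_approximation:
  fixes \<theta> \<theta>' :: "real \<Rightarrow> real"
  assumes \<theta>: "\<And>t. (\<theta> has_real_derivative \<theta>' t) (at t)" "continuous_on UNIV \<theta>'"
  obtains G g :: "nat \<Rightarrow> real \<Rightarrow> real" where "\<And>j. smooth_fun (G j)"
    "\<And>j t. (G j has_real_derivative g j t) (at t)"
    "uniform_limit {0..b} G \<theta> sequentially" "uniform_limit {0..b} g \<theta>' sequentially"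
proof -
  obtain g where g: "uniform_limit {0..b} g \<theta>' sequentially" "\<And>j. polynomial_function (g j)"
    using Stone_Weierstrass_uniform_limit[OF compact_Icc continuous_on_subset[OF \<theta>(2) subset_UNIV]]
    by blast
  have "\<exists>G. smooth_fun G \<and> (\<forall>t. (G has_real_derivative g j t) (at t)) \<and> G b = \<theta> b" for j
    by (rule polynomial_antiderivative[OF g(2), of j b "\<theta> b"]) blast
  then obtain G where G: "\<And>j. smooth_fun (G j)" "\<And>j t. (G j has_real_derivative g j t) (at t)"
      "\<And>j. G j b = \<theta> b"
    by metis
  have "uniform_limit {0..b} (\<lambda>j. tail b (g j)) (tail b \<theta>') sequentially"
    by (intro uniform_limit_tail g continuous_on_polymonial_function
        continuous_on_subset[OF \<theta>(2)]) auto
  then have "uniform_limit {0..b} (\<lambda>j t. \<theta> b - tail b (g j) t) (\<lambda>t. \<theta> b - tail b \<theta>' t) sequentially"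
    by (intro uniform_limit_minus uniform_limit_const)
  then have "uniform_limit {0..b} G \<theta> sequentially"
    by (rule iffD1[OF uniform_limit_cong', rotated -1])
      (auto simp: tail_derivative[OF G(2)] tail_derivative[OF \<theta>(1)] G(3))
  with G(1,2) show ?thesis using g(1) by (rule that)
qed

lemma C1_smooth_approximation:
  fixes \<theta> \<theta>' :: "real \<Rightarrow> real"
  assumes \<theta>: "\<And>t. (\<theta> has_real_derivative \<theta>' t) (at t)" "continuous_on UNIV \<theta>'"
      "\<And>t. \<sigma> \<le> t \<Longrightarrow> \<theta> t = 0"
    and \<sigma>: "0 < \<sigma>" "\<sigma> < b"
  obtains \<eta> :: "nat \<Rightarrow> real \<Rightarrow> real" where "\<And>j. smooth_fun (\<eta> j)"
    "\<And>j t. b \<le> \<bar>t\<bar> \<Longrightarrow> \<eta> j t = 0"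
    "uniform_limit {0..b} \<eta> \<theta> sequentially"
    "uniform_limit {0..b} (\<lambda>j. deriv (\<eta> j)) \<theta>' sequentially"
proof -
  obtain \<kappa> :: "real \<Rightarrow> real" where \<kappa>: "smooth_fun \<kappa>" "\<And>t. norm t \<le> \<sigma> \<Longrightarrow> \<kappa> t = 1"
      "\<And>t. b \<le> norm t \<Longrightarrow> \<kappa> t = 0"
    by (rule smooth_cutoff[OF less_imp_le[OF \<sigma>(1)] \<sigma>(2), where 'a = real]) (rule that)
  obtain G g where G: "\<And>j. smooth_fun (G j)" "\<And>j t. (G j has_real_derivative g j t) (at t)"
      "uniform_limit {0..b} G \<theta> sequentially" "uniform_limit {0..b} g \<theta>' sequentially"
    by (rule C1_polynomial_approximation[OF \<theta>(1,2), of b]) (rule that)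
  have cut_value: "\<kappa> t * \<theta> t = \<theta> t" if "t \<in> {0..b}" for t
    using that \<kappa>(2)[of t] \<theta>(3)[of t] by (cases "t < \<sigma>") auto
  have cut_deriv: "deriv \<kappa> t * \<theta> t + \<kappa> t * \<theta>' t = \<theta>' t" if "t \<in> {0..b}" for t
    using that deriv_eq_0_inside[OF \<kappa>(2)] \<kappa>(2)[of t] \<theta>(3) deriv_eq_0_beyond[OF \<theta>(1,3)]
    by (cases "t < \<sigma>") auto
  have bounded: "bounded (f ` {0..b})" if "continuous_on UNIV f" for f :: "real \<Rightarrow> real"
    by (intro compact_imp_bounded compact_continuous_image continuous_on_subset[OF that]) auto
  have cont: "continuous_on UNIV \<theta>" "continuous_on UNIV \<kappa>" "continuous_on UNIV (deriv \<kappa>)"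
    by (intro DERIV_continuous_on[OF \<theta>(1)] smooth_fun_continuous smooth_fun_deriv \<kappa>)+
  have const_limit: "uniform_limit {0..b} (\<lambda>_. f) f sequentially" for f :: "real \<Rightarrow> real"
    by (rule uniform_limit_const)
  have "uniform_limit {0..b} (\<lambda>j t. \<kappa> t * G j t) (\<lambda>t. \<kappa> t * \<theta> t) sequentially"
    by (intro uniform_lim_mult const_limit G bounded cont)
  then have "uniform_limit {0..b} (\<lambda>j t. \<kappa> t * G j t) \<theta> sequentially"
    by (rule iffD1[OF uniform_limit_cong', rotated -1]) (use cut_value in auto)
  moreover have "uniform_limit {0..b} (\<lambda>j t. deriv \<kappa> t * G j t + \<kappa> t * g j t)
      (\<lambda>t. deriv \<kappa> t * \<theta> t + \<kappa> t * \<theta>' t) sequentially"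
    by (intro uniform_limit_add uniform_lim_mult const_limit G bounded cont \<theta>(2))
  then have "uniform_limit {0..b} (\<lambda>j t. deriv \<kappa> t * G j t + \<kappa> t * g j t) \<theta>' sequentially"
    by (rule iffD1[OF uniform_limit_cong', rotated -1]) (use cut_deriv in auto)
  moreover have "(\<lambda>t. deriv \<kappa> t * G j t + \<kappa> t * g j t) = deriv (\<lambda>t. \<kappa> t * G j t)" for j
    using DERIV_mult[OF smooth_fun_has_real_derivative[OF \<kappa>(1)] G(2)]
    by (intro ext DERIV_imp_deriv[symmetric]) (simp add: mult.commute)
  ultimately show ?thesis
    by (intro that[of "\<lambda>j t. \<kappa> t * G j t"]) (auto simp: \<kappa> intro: smooth_fun_mult G)
qed

locale weak_wave =
  fixes T \<epsilon> R :: real and D V w0 w1 :: "'a::euclidean_space \<Rightarrow> real"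
    and N w wt :: "real \<Rightarrow> 'a \<Rightarrow> real" and gw :: "real \<Rightarrow> 'a \<Rightarrow> 'a"
  assumes T_pos: "0 < T" and R_pos: "0 < R"
    and H1: "C_H1 T w gw" and C1: "C1_L2 T w wt"
    and wt_meas: "(\<lambda>z. wt (fst z) (snd z)) \<in> borel_measurable borel"
    and init: "AE x in lborel. w 0 x = \<epsilon> * w0 x"
    and weak_identity: "weak_eq T \<epsilon> D V w0 w1 N w wt gw"
    and w_cone: "\<And>t. t \<in> {0..<T} \<Longrightarrow> AE x in lborel. t + R < norm x \<longrightarrow> w t x = 0"
    and N_cone: "AE z in lborel. 0 < fst z \<and> fst z < T \<and> fst z + R < norm (snd z) \<longrightarrow>
      N (fst z) (snd z) = 0"
    and D_cont: "continuous_on UNIV D" and V_cont: "continuous_on UNIV V"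
    and w0_cont: "continuous_on UNIV w0" and w1_cont: "continuous_on UNIV w1"
    and w0_support: "\<And>x. R < norm x \<Longrightarrow> w0 x = 0" and w1_support: "\<And>x. R < norm x \<Longrightarrow> w1 x = 0"
begin

lemma wt_cone: "AE z in lborel. 0 < fst z \<and> fst z < T \<and> fst z + R < norm (snd z) \<longrightarrow>
    wt (fst z) (snd z) = 0"
  by (rule time_derivative_cone_AE[OF C1 wt_meas w_cone])

lemma N_strip_integrable: "strip_integrable T (\<lambda>z. N (fst z) (snd z))"
  unfolding strip_integrable_def
proof (intro allI impI)
  fix b L :: real assume "b < T"
  obtain a b' L' and \<theta> :: "real \<Rightarrow> real" and \<zeta> :: "'a \<Rightarrow> real" where cutoffs: "b < a" "b' < T"
    "smooth_fun \<theta>" "smooth_fun \<zeta>" "\<And>t. b' \<le> \<bar>t\<bar> \<Longrightarrow> \<theta> t = 0" "\<And>x. L' \<le> norm x \<Longrightarrow> \<zeta> x = 0"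
    "\<And>t. \<bar>t\<bar> \<le> a \<Longrightarrow> \<theta> t = 1" "\<And>x. norm x \<le> L \<Longrightarrow> \<zeta> x = 1"
    by (rule strip_cutoffs[OF T_pos \<open>b < T\<close>, of L, where 'a = 'a]) (rule that)
  have "set_integrable lborel ({0<..<T} \<times> UNIV) (\<lambda>(t,x). N t x * (\<theta> t * \<zeta> x))"
    using weak_identity test_fun_product[OF cutoffs(3,4,2,5,6)] unfolding weak_eq_def by fastforce
  then have "set_integrable lborel ({0<..b} \<times> cball 0 L) (\<lambda>(t,x). N t x * (\<theta> t * \<zeta> x))"
    by (rule set_integrable_subset) (use \<open>b < T\<close> in \<open>auto intro!: borel_Times\<close>)
  then show "set_integrable lborel ({0<..b} \<times> cball 0 L) (\<lambda>z. N (fst z) (snd z))"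
    by (rule iffD1[OF set_integrable_cong, rotated -1]) (use cutoffs in auto)
qed

lemma wt_strip_integrable: "strip_integrable T (\<lambda>z. wt (fst z) (snd z))"
  unfolding strip_integrable_def
proof (intro allI impI)
  fix b L :: real assume "b < T"
  obtain a b' L' and \<theta> :: "real \<Rightarrow> real" and \<zeta> :: "'a \<Rightarrow> real" where cutoffs: "b < a" "b' < T"
    "smooth_fun \<theta>" "smooth_fun \<zeta>" "\<And>t. b' \<le> \<bar>t\<bar> \<Longrightarrow> \<theta> t = 0" "\<And>x. L' \<le> norm x \<Longrightarrow> \<zeta> x = 0"
    "\<And>t. \<bar>t\<bar> \<le> a \<Longrightarrow> \<theta> t = 1" "\<And>x. norm x \<le> L \<Longrightarrow> \<zeta> x = 1"
    by (rule strip_cutoffs[OF T_pos \<open>b < T\<close>, of L, where 'a = 'a]) (rule that)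
  define \<eta> where "\<eta> = (\<lambda>t. t * \<theta> t)"
  have \<eta>: "smooth_fun \<eta>" "\<And>t. b' \<le> \<bar>t\<bar> \<Longrightarrow> \<eta> t = 0"
    unfolding \<eta>_def
    by (intro smooth_fun_mult smooth_fun_linear bounded_linear_ident cutoffs) (simp add: cutoffs)
  have \<eta>_deriv: "deriv \<eta> t = 1" if "0 < t" "t \<le> b" for t
  proof (rule DERIV_imp_deriv)
    have "((\<lambda>t. t) has_real_derivative 1) (at t)" by (rule DERIV_ident)
    then show "(\<eta> has_real_derivative 1) (at t)"
      by (rule has_field_derivative_transform_within_open[where S = "{-a<..<a}"])
        (use that cutoffs in \<open>auto simp: \<eta>_def\<close>)
  qed
  have \<zeta>_deriv_0: "frechet_derivative \<zeta> (at x) 0 = 0" for x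
    by (intro linear_0 linear_frechet_derivative smooth_fun_differentiable cutoffs)
  have "set_integrable lborel ({0<..<T} \<times> UNIV)
      (\<lambda>(t,x). wt t x * frechet_derivative (\<lambda>z. \<eta> (fst z) * \<zeta> (snd z)) (at (t,x)) (1,0))"
    using weak_identity test_fun_product[OF \<eta>(1) cutoffs(4,2) \<eta>(2) cutoffs(6)]
    unfolding weak_eq_def by blast
  then have "set_integrable lborel ({0<..<T} \<times> UNIV) (\<lambda>(t,x). wt t x * (deriv \<eta> t * \<zeta> x))"
    unfolding frechet_derivative_product[OF \<eta>(1) cutoffs(4)] \<zeta>_deriv_0 by simp
  then have "set_integrable lborel ({0<..b} \<times> cball 0 L) (\<lambda>(t,x). wt t x * (deriv \<eta> t * \<zeta> x))"
    by (rule set_integrable_subset) (use \<open>b < T\<close> in \<open>auto intro!: borel_Times\<close>)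
  then show "set_integrable lborel ({0<..b} \<times> cball 0 L) (\<lambda>z. wt (fst z) (snd z))"
    by (rule iffD1[OF set_integrable_cong, rotated -1]) (use cutoffs \<eta>_deriv in auto)
qed

subsection \<open>Integration by parts in time\<close>

definition pairing :: "('a \<Rightarrow> real) \<Rightarrow> real \<Rightarrow> real" where
  "pairing h t = (\<integral>x. w t x * h x \<partial>lborel)"

definition pairing_t :: "('a \<Rightarrow> real) \<Rightarrow> real \<Rightarrow> real" where
  "pairing_t h t = (\<integral>x. wt t x * h x \<partial>lborel)"

lemma DERIV_pairing:
  assumes "is_L2 h" "b < T" "t \<in> {0..b}"
  shows "(pairing h has_real_derivative pairing_t h t) (at t within {0..b})"
  unfolding pairing_def[abs_def] pairing_t_def
  by (rule DERIV_subset[OF C1_L2_pairing_derivative[OF C1 assms(1)]]) (use assms in auto)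

lemma continuous_on_pairing: "is_L2 h \<Longrightarrow> b < T \<Longrightarrow> continuous_on {0..b} (pairing h)"
  by (rule DERIV_continuous_on) (rule DERIV_pairing)

lemma continuous_on_pairing_t:
  assumes "is_L2 h" "b < T"
  shows "continuous_on {0..b} (pairing_t h)"
  unfolding pairing_t_def[abs_def]
  by (rule continuous_on_subset[OF C1_L2_pairing_continuous[OF C1 assms(1)]]) (use assms in auto)

lemma pairing_initial:
  assumes "is_L2 h"
  shows "pairing h 0 = \<epsilon> * (\<integral>x. w0 x * h x \<partial>lborel)"
proof -
  have [measurable]: "w 0 \<in> borel_measurable borel" "w0 \<in> borel_measurable borel"
    "h \<in> borel_measurable borel"
    using T_pos C1_L2_is_L2(1)[OF C1, of 0] assms w0_cont
    by (auto dest: is_L2_measurable intro: borel_measurable_continuous_onI)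
  have "pairing h 0 = (\<integral>x. \<epsilon> * (w0 x * h x) \<partial>lborel)"
    unfolding pairing_def
    by (rule integral_cong_AE) (use init in \<open>auto elim: eventually_mono\<close>)
  then show ?thesis by simp
qed

lemma pairing_by_parts:
  assumes b: "0 \<le> b" "b < T" and h: "is_L2 h"
    and f: "\<And>t. t \<in> {0..b} \<Longrightarrow> (f has_real_derivative f' t) (at t within {0..b})"
        "continuous_on {0..b} f'"
    and "f b = 0"
  shows "integral {0..b} (\<lambda>t. f' t * pairing h t) =
    - f 0 * (\<epsilon> * (\<integral>x. w0 x * h x \<partial>lborel)) - integral {0..b} (\<lambda>t. f t * pairing_t h t)"
  unfolding pairing_initial[OF h, symmetric]
  by (intro integral_by_parts_vanishing b f DERIV_pairing h continuous_on_pairing_t assms)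

lemma weak_laplace:
  assumes \<zeta>: "smooth_fun \<zeta>" "\<And>x. L \<le> norm x \<Longrightarrow> \<zeta> x = 0" and t: "t \<in> {0..<T}"
  shows "(\<integral>x. frechet_derivative \<zeta> (at x) (gw t x) \<partial>lborel) = - pairing (laplace \<zeta>) t"
proof -
  have w: "is_L2 (w t)" and g: "is_L2 (gw t)" and grad: "weak_grad (w t) (gw t)"
    using H1 t by (auto simp: C_H1_def is_H1_def)
  define \<zeta>' where "\<zeta>' = (\<lambda>e x. frechet_derivative \<zeta> (at x) e)"
  have smooth: "smooth_fun (\<zeta>' e)" for e
    unfolding \<zeta>'_def by (rule smooth_fun_frechet_derivative[OF \<zeta>(1)])
  have support: "\<zeta>' e x = 0" if "L + 1 \<le> norm x" for e x
    unfolding \<zeta>'_def by (rule frechet_derivative_eq_0_outside[OF \<zeta>(2)]) (use that in auto)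
  have "is_L2 (\<zeta>' e)" for e
    by (rule is_L2_continuous_support[OF smooth_fun_continuous[OF smooth], where L = "L + 1"])
      (use support in auto)
  moreover have "is_L2 (\<lambda>x. gw t x \<bullet> e)" if "e \<in> Basis" for e
    using is_L2_measurable[OF g] Basis_le_norm[OF that] by (intro is_L2_dominated[OF g]) auto
  ultimately have int: "integrable lborel (\<lambda>x. (gw t x \<bullet> e) * \<zeta>' e x)" if "e \<in> Basis" for e
    using that by (intro L2_pairing_integrable) auto
  have "is_L2 (\<lambda>x. frechet_derivative (\<zeta>' e) (at x) e)" for e
    by (rule is_L2_continuous_support[where L = "L + 1"])
      (auto intro: smooth_fun_continuous smooth_fun_frechet_derivative smooth
        frechet_derivative_eq_0_outside[OF support])
  then have int': "integrable lborel (\<lambda>x. w t x * frechet_derivative (\<zeta>' e) (at x) e)" for e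
    by (rule L2_pairing_integrable[OF w])
  have linear: "frechet_derivative \<zeta> (at x) v = (\<Sum>e\<in>Basis. (v \<bullet> e) * \<zeta>' e x)" for x v
    using linear_sum linear_cmul
      linear_frechet_derivative[OF smooth_fun_differentiable[OF \<zeta>(1)], of x]
    by (subst euclidean_representation[of v, symmetric]) (simp add: linear_sum linear_cmul \<zeta>'_def)
  have "(\<integral>x. frechet_derivative \<zeta> (at x) (gw t x) \<partial>lborel) =
      (\<Sum>e\<in>Basis. \<integral>x. (gw t x \<bullet> e) * \<zeta>' e x \<partial>lborel)"
    unfolding linear by (rule Bochner_Integration.integral_sum[OF int])
  also have "\<dots> = (\<Sum>e\<in>Basis. - (\<integral>x. w t x * frechet_derivative (\<zeta>' e) (at x) e \<partial>lborel))"
  proof (rule sum.cong[OF refl])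
    fix e :: 'a assume "e \<in> Basis"
    moreover have "Cc_inf (\<zeta>' e)"
      unfolding Cc_inf_def using smooth support by (auto intro!: exI[of _ "cball 0 (L + 1)"])
    ultimately show "(\<integral>x. (gw t x \<bullet> e) * \<zeta>' e x \<partial>lborel) =
        - (\<integral>x. w t x * frechet_derivative (\<zeta>' e) (at x) e \<partial>lborel)"
      using grad by (simp add: weak_grad_def)
  qed
  also have "\<dots> = - (\<integral>x. (\<Sum>e\<in>Basis. w t x * frechet_derivative (\<zeta>' e) (at x) e) \<partial>lborel)"
    by (simp add: Bochner_Integration.integral_sum int' sum_negf)
  finally show ?thesis by (simp add: pairing_def laplace_def \<zeta>'_def sum_distrib_left)
qed

lemma pairing_diff:
  assumes "is_L2 h" "is_L2 k" "t \<in> {0..<T}"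
  shows "pairing (\<lambda>x. h x - k x) t = pairing h t - pairing k t"
    and "pairing_t (\<lambda>x. h x - k x) t = pairing_t h t - pairing_t k t"
  unfolding pairing_def pairing_t_def right_diff_distrib
  by (intro Bochner_Integration.integral_diff L2_pairing_integrable C1_L2_is_L2[OF C1] assms)+

subsection \<open>The product identity on space-time cylinders\<close>

definition cylinder :: "real \<Rightarrow> (real \<times> 'a) set" where
  "cylinder b = {0<..b} \<times> cball 0 (T + R)"

lemma cylinder_borel: "cylinder b \<in> sets borel"
  unfolding cylinder_def by (rule borel_Times) simp_all

lemma cylinder_bounded_mult_integrable:
  assumes F: "strip_integrable T F" "b < T"
    and G: "G \<in> borel_measurable borel" "\<And>z. \<bar>G z\<bar> \<le> K" "\<And>z. z \<notin> cylinder b \<Longrightarrow> G z = 0"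
  shows "integrable lborel (\<lambda>z. F z * G z)"
proof -
  have F_int: "integrable lborel (\<lambda>z. indicator (cylinder b) z * F z)"
    using F by (simp add: strip_integrable_def cylinder_def set_integrable_def)
  have "integrable lborel (\<lambda>z. (indicator (cylinder b) z * F z) * G z)"
  proof (rule Bochner_Integration.integrable_bound[OF integrable_mult_left[OF F_int, of K]])
    show "(\<lambda>z. (indicator (cylinder b) z * F z) * G z) \<in> borel_measurable lborel"
      using borel_measurable_times[OF borel_measurable_integrable[OF F_int]] G(1) by simp
    have "0 \<le> K" using G(2)[of undefined] by linarith
    then show "AE z in lborel. norm (indicator (cylinder b) z * F z * G z)
        \<le> norm (indicator (cylinder b) z * F z * K)"
      using G(2) by (intro AE_I2) (auto simp: abs_mult intro: mult_left_mono)
  qed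
  moreover have "indicator (cylinder b) z * F z * G z = F z * G z" for z
    using G(3)[of z] by (auto simp: indicator_def)
  ultimately show ?thesis by simp
qed

lemma cylinder_continuous_mult_integrable:
  assumes F: "strip_integrable T F" "b < T" and G: "continuous_on ({0..b} \<times> cball 0 (T + R)) G"
  shows "set_integrable lborel (cylinder b) (\<lambda>z. F z * G z)"
  using assms cylinder_borel
  by (intro set_integrable_mult_continuous[where K = "{0..b} \<times> cball 0 (T + R)"])
    (auto simp: strip_integrable_def cylinder_def intro: compact_Times)

lemma cylinder_slice_pairing_t:
  assumes t: "0 < t" "t < T" and h: "h \<in> borel_measurable borel"
  shows "(\<integral>x. indicator (cylinder b) (t, x) * (wt t x * (c * h x)) \<partial>lborel) =
    indicator {..b} t * (c * pairing_t h t)"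
proof -
  have [measurable]: "wt t \<in> borel_measurable borel"
    using C1_L2_is_L2(2)[OF C1, of t] t by (auto dest: is_L2_measurable)
  have wt_slice: "AE x in lborel. t + R < norm x \<longrightarrow> wt t x = 0"
    by (rule time_derivative_support[OF C1 t w_cone])
  have "(\<integral>x. indicator (cylinder b) (t, x) * (wt t x * (c * h x)) \<partial>lborel) =
      (\<integral>x. indicator {..b} t * c * (wt t x * h x) \<partial>lborel)"
  proof (rule integral_cong_AE)
    show "(\<lambda>x. indicator (cylinder b) (t, x) * (wt t x * (c * h x))) \<in> borel_measurable lborel"
      using h by (auto simp: cylinder_def indicator_times
          intro!: borel_measurable_times borel_measurable_indicator)
    show "AE x in lborel. indicator (cylinder b) (t, x) * (wt t x * (c * h x)) =
        indicator {..b} t * c * (wt t x * h x)"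
      using wt_slice by eventually_elim (use t in \<open>auto simp: indicator_def cylinder_def\<close>)
  qed (use h in simp)
  then show ?thesis by (simp add: pairing_t_def)
qed

lemma cylinder_integral_wt:
  assumes b: "0 \<le> b" "b < T" and f: "continuous_on {0..b} f"
    and h: "continuous_on UNIV h" "\<And>x. L < norm x \<Longrightarrow> h x = 0"
  shows "(LINT z:cylinder b|lborel. wt (fst z) (snd z) * (f (fst z) * h (snd z))) =
    integral {0..b} (\<lambda>t. f t * pairing_t h t)"
proof -
  let ?F = "\<lambda>z::real \<times> 'a. wt (fst z) (snd z) * (f (fst z) * h (snd z))"
  have L2: "is_L2 h" by (rule is_L2_continuous_support[OF h])
  have indicator_strip: "indicator ({0<..<T} \<times> UNIV) z *\<^sub>R (indicator (cylinder b) z * ?F z) =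
      indicator (cylinder b) z *\<^sub>R ?F z" for z
    using b by (auto simp: indicator_def cylinder_def)
  have "(LINT z:cylinder b|lborel. ?F z) =
      (LINT z:{0<..<T} \<times> UNIV|lborel. indicator (cylinder b) z * ?F z)"
    by (simp only: set_lebesgue_integral_def indicator_strip)
  also have "\<dots> = integral {0..b} (\<lambda>t. indicator {..b} t * (f t * pairing_t h t))"
  proof (rule strip_integral_eq_integral[OF _ _ _ _ b])
    have "set_integrable lborel (cylinder b) ?F"
      by (intro cylinder_continuous_mult_integrable wt_strip_integrable b continuous_on_tensor f
          continuous_on_subset[OF h(1)]) auto
    then show "set_integrable lborel ({0<..<T} \<times> UNIV) (\<lambda>z. indicator (cylinder b) z * ?F z)"
      by (simp only: set_integrable_def indicator_strip)
    have "continuous_on {0..b} (\<lambda>t. f t * pairing_t h t)"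
      by (intro continuous_on_mult f continuous_on_pairing_t L2 b)
    then show "continuous_on {0..b} (\<lambda>t. indicator {..b} t * (f t * pairing_t h t))"
      by (rule continuous_on_eq) simp
  qed (simp_all add: cylinder_slice_pairing_t is_L2_measurable[OF L2])
  also have "\<dots> = integral {0..b} (\<lambda>t. f t * pairing_t h t)"
    by (rule Henstock_Kurzweil_Integration.integral_cong) simp
  finally show ?thesis .
qed

definition test_identity ::
  "real \<Rightarrow> (real \<Rightarrow> real) \<Rightarrow> (real \<Rightarrow> real) \<Rightarrow> ('a \<Rightarrow> real) \<Rightarrow> ('a \<Rightarrow> real) \<Rightarrow> bool" where
  "test_identity b \<theta> \<theta>' \<zeta> \<xi> \<longleftrightarrow>
    \<epsilon> * (\<theta> 0 * (LINT x:cball 0 R|lborel. w1 x * \<zeta> x)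
        + tail b \<theta> 0 * (LINT x:cball 0 R|lborel. w0 x * (\<xi> x - V x * \<zeta> x)))
      + (LINT z:cylinder b|lborel. N (fst z) (snd z) * (\<theta> (fst z) * \<zeta> (snd z)))
    = (LINT z:cylinder b|lborel. wt (fst z) (snd z) * (\<theta> (fst z) * (D (snd z) * \<zeta> (snd z))
        - \<theta>' (fst z) * \<zeta> (snd z) - tail b \<theta> (fst z) * (\<xi> (snd z) - V (snd z) * \<zeta> (snd z))))"

lemma cball_integral_eq:
  fixes f h :: "'a \<Rightarrow> real"
  assumes "\<And>x. R < norm x \<Longrightarrow> f x = 0"
  shows "(LINT x:cball 0 R|lborel. f x * h x) = (\<integral>x. f x * h x \<partial>lborel)"
  unfolding set_lebesgue_integral_def
  using assms by (intro Bochner_Integration.integral_cong) (auto simp: indicator_def not_le)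

context
  fixes b L :: real and \<theta> :: "real \<Rightarrow> real" and \<zeta> :: "'a \<Rightarrow> real"
  assumes b: "0 \<le> b" "b < T" and \<theta>: "smooth_fun \<theta>" "\<And>t. b \<le> \<bar>t\<bar> \<Longrightarrow> \<theta> t = 0"
    and \<zeta>: "smooth_fun \<zeta>" "\<And>x. L \<le> norm x \<Longrightarrow> \<zeta> x = 0"
begin

lemma factors_continuous:
  "continuous_on X \<theta>" "continuous_on X (deriv \<theta>)" "continuous_on UNIV \<zeta>"
  "continuous_on UNIV (laplace \<zeta>)"
  by (intro continuous_on_subset[OF smooth_fun_continuous subset_UNIV] smooth_fun_continuous
      smooth_fun_deriv smooth_fun_laplace \<theta> \<zeta>)+

lemma factors_eq_0:
  "b < t \<Longrightarrow> \<theta> t = 0" "b < t \<Longrightarrow> deriv \<theta> t = 0"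
  "L < norm x \<Longrightarrow> \<zeta> x = 0" "L < norm x \<Longrightarrow> laplace \<zeta> x = 0"
  using \<theta>(2)[of t] \<zeta>(2)[of x] laplace_eq_0_outside[OF \<zeta>(2)]
    deriv_eq_0_beyond[OF smooth_fun_has_real_derivative[OF \<theta>(1)], of b t] \<theta>(2) by auto

lemma factors_L2:
  "is_L2 \<zeta>" "is_L2 (laplace \<zeta>)" "is_L2 (\<lambda>x. D x * \<zeta> x)" "is_L2 (\<lambda>x. V x * \<zeta> x)"
  "is_L2 (\<lambda>x. laplace \<zeta> x - V x * \<zeta> x)"
  by (intro is_L2_continuous_support[where L = L] continuous_on_mult continuous_on_diff
      factors_continuous D_cont V_cont; simp add: factors_eq_0)+

lemma weak_identity_pairing:
  "\<epsilon> * \<theta> 0 * (\<integral>x. w1 x * \<zeta> x \<partial>lborel) + \<epsilon> * \<theta> 0 * (\<integral>x. w0 x * (D x * \<zeta> x) \<partial>lborel)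
      + (LINT z:{0<..<T} \<times> UNIV|lborel. N (fst z) (snd z) * (\<theta> (fst z) * \<zeta> (snd z)))
    = - integral {0..b} (\<lambda>t. deriv \<theta> t * pairing_t \<zeta> t)
      + integral {0..b} (\<lambda>t. - \<theta> t * pairing (laplace \<zeta>) t)
      - integral {0..b} (\<lambda>t. deriv \<theta> t * pairing (\<lambda>x. D x * \<zeta> x) t)
      + integral {0..b} (\<lambda>t. \<theta> t * pairing (\<lambda>x. V x * \<zeta> x) t)"
proof -
  have \<zeta>_deriv_0: "frechet_derivative \<zeta> (at x) 0 = 0" for x
    by (intro linear_0 linear_frechet_derivative smooth_fun_differentiable \<zeta>)
  note weak = weak_identity[unfolded weak_eq_def, rule_format,
      OF test_fun_product[OF \<theta>(1) \<zeta>(1) b(2) \<theta>(2) \<zeta>(2)],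
      unfolded frechet_derivative_product[OF \<theta>(1) \<zeta>(1)] \<zeta>_deriv_0 split_beta fst_conv snd_conv,
      simplified]
  note strip = strip_integral_eq_integral[OF _ _ _ _ b]
  have "(LINT z:{0<..<T} \<times> UNIV|lborel. wt (fst z) (snd z) * (deriv \<theta> (fst z) * \<zeta> (snd z))) =
      integral {0..b} (\<lambda>t. deriv \<theta> t * pairing_t \<zeta> t)"
    using weak by (intro strip continuous_on_mult factors_continuous
        continuous_on_pairing_t factors_L2 b)
      (simp_all add: factors_eq_0 pairing_t_def mult.left_commute)
  moreover have "(LINT z:{0<..<T} \<times> UNIV|lborel.
      \<theta> (fst z) * frechet_derivative \<zeta> (at (snd z)) (gw (fst z) (snd z))) =
      integral {0..b} (\<lambda>t. - \<theta> t * pairing (laplace \<zeta>) t)"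
    using weak by (intro strip continuous_on_mult continuous_on_minus factors_continuous
        continuous_on_pairing factors_L2 b)
      (simp_all add: factors_eq_0 weak_laplace[OF \<zeta>])
  moreover have "(LINT z:{0<..<T} \<times> UNIV|lborel.
      w (fst z) (snd z) * D (snd z) * (deriv \<theta> (fst z) * \<zeta> (snd z))) =
      integral {0..b} (\<lambda>t. deriv \<theta> t * pairing (\<lambda>x. D x * \<zeta> x) t)"
    using weak by (intro strip continuous_on_mult factors_continuous
        continuous_on_pairing factors_L2 b)
      (simp_all add: factors_eq_0 pairing_def mult_ac flip: integral_mult_right_zero)
  moreover have "(LINT z:{0<..<T} \<times> UNIV|lborel.
      V (snd z) * w (fst z) (snd z) * (\<theta> (fst z) * \<zeta> (snd z))) =
      integral {0..b} (\<lambda>t. \<theta> t * pairing (\<lambda>x. V x * \<zeta> x) t)"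
    using weak by (intro strip continuous_on_mult factors_continuous
        continuous_on_pairing factors_L2 b)
      (simp_all add: factors_eq_0 pairing_def mult_ac flip: integral_mult_right_zero)
  ultimately show ?thesis
    using weak by (simp add: mult_ac flip: integral_mult_right_zero)
qed

lemma product_identity:
  "\<epsilon> * (\<theta> 0 * (\<integral>x. w1 x * \<zeta> x \<partial>lborel)
        + tail b \<theta> 0 * (\<integral>x. w0 x * (laplace \<zeta> x - V x * \<zeta> x) \<partial>lborel))
      + (LINT z:{0<..<T} \<times> UNIV|lborel. N (fst z) (snd z) * (\<theta> (fst z) * \<zeta> (snd z)))
    = integral {0..b} (\<lambda>t. \<theta> t * pairing_t (\<lambda>x. D x * \<zeta> x) t)
      - integral {0..b} (\<lambda>t. deriv \<theta> t * pairing_t \<zeta> t)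
      - integral {0..b} (\<lambda>t. tail b \<theta> t * pairing_t (\<lambda>x. laplace \<zeta> x - V x * \<zeta> x) t)"
proof -
  have "integral {0..b} (\<lambda>t. - \<theta> t * pairing (laplace \<zeta>) t)
      + integral {0..b} (\<lambda>t. \<theta> t * pairing (\<lambda>x. V x * \<zeta> x) t)
    = integral {0..b} (\<lambda>t. - \<theta> t * pairing (laplace \<zeta>) t + \<theta> t * pairing (\<lambda>x. V x * \<zeta> x) t)"
    by (intro integral_add[symmetric] integrable_continuous_real continuous_on_mult
        continuous_on_minus factors_continuous continuous_on_pairing factors_L2 b)
  also have "\<dots> = integral {0..b} (\<lambda>t. - \<theta> t * pairing (\<lambda>x. laplace \<zeta> x - V x * \<zeta> x) t)"
    using b by (intro Henstock_Kurzweil_Integration.integral_cong)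
      (simp add: pairing_diff[OF factors_L2(2,4)] algebra_simps)
  also have "\<dots> = - tail b \<theta> 0 * (\<epsilon> * (\<integral>x. w0 x * (laplace \<zeta> x - V x * \<zeta> x) \<partial>lborel))
      - integral {0..b} (\<lambda>t. tail b \<theta> t * pairing_t (\<lambda>x. laplace \<zeta> x - V x * \<zeta> x) t)"
    by (intro pairing_by_parts b factors_L2 DERIV_tail continuous_on_minus
        factors_continuous tail_end)
  finally have elliptic: "integral {0..b} (\<lambda>t. - \<theta> t * pairing (laplace \<zeta>) t)
      + integral {0..b} (\<lambda>t. \<theta> t * pairing (\<lambda>x. V x * \<zeta> x) t) = \<dots>" .
  have damping: "integral {0..b} (\<lambda>t. deriv \<theta> t * pairing (\<lambda>x. D x * \<zeta> x) t) =
      - \<theta> 0 * (\<epsilon> * (\<integral>x. w0 x * (D x * \<zeta> x) \<partial>lborel))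
      - integral {0..b} (\<lambda>t. \<theta> t * pairing_t (\<lambda>x. D x * \<zeta> x) t)"
    by (rule pairing_by_parts[OF b factors_L2(3) has_field_derivative_at_within
          factors_continuous(2)])
      (simp_all add: smooth_fun_has_real_derivative[OF \<theta>(1)] \<theta>(2))
  from weak_identity_pairing elliptic damping show ?thesis
    by (simp add: distrib_left mult.assoc mult.left_commute[of _ \<epsilon>])
qed

lemma cylinder_kernel_integral:
  "(LINT z:cylinder b|lborel. wt (fst z) (snd z) * (\<theta> (fst z) * (D (snd z) * \<zeta> (snd z))
      - deriv \<theta> (fst z) * \<zeta> (snd z)
      - tail b \<theta> (fst z) * (laplace \<zeta> (snd z) - V (snd z) * \<zeta> (snd z))))
    = integral {0..b} (\<lambda>t. \<theta> t * pairing_t (\<lambda>x. D x * \<zeta> x) t)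
      - integral {0..b} (\<lambda>t. deriv \<theta> t * pairing_t \<zeta> t)
      - integral {0..b} (\<lambda>t. tail b \<theta> t * pairing_t (\<lambda>x. laplace \<zeta> x - V x * \<zeta> x) t)"
proof -
  have cont: "continuous_on UNIV (\<lambda>x. D x * \<zeta> x)" "continuous_on UNIV (\<lambda>x. laplace \<zeta> x - V x * \<zeta> x)"
      "continuous_on {0..b} (tail b \<theta>)"
    by (intro continuous_on_mult continuous_on_diff continuous_on_tail D_cont V_cont
        factors_continuous)+
  have vanish: "D x * \<zeta> x = 0" "laplace \<zeta> x - V x * \<zeta> x = 0" if "L < norm x" for x
    using that by (simp_all add: factors_eq_0)
  note wt_integral = cylinder_integral_wt[OF b factors_continuous(1) cont(1) vanish(1)]
    cylinder_integral_wt[OF b factors_continuous(2,3) factors_eq_0(3)]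
    cylinder_integral_wt[OF b cont(3,2) vanish(2)]
  have integrable: "set_integrable lborel (cylinder b)
      (\<lambda>z. wt (fst z) (snd z) * (f (fst z) * h (snd z)))"
    if "continuous_on {0..b} f" "continuous_on UNIV h" for f h
    by (intro cylinder_continuous_mult_integrable wt_strip_integrable b continuous_on_tensor that
        continuous_on_subset[OF that(2)]) auto
  note wt_integrable = integrable[OF factors_continuous(1) cont(1)]
    integrable[OF factors_continuous(2,3)] integrable[OF cont(3,2)]
  show ?thesis
    by (simp only: right_diff_distrib[of "wt _ _"] set_integral_diff wt_integrable wt_integral)
qed

lemma test_identity_compact_support:
  "test_identity b \<theta> (deriv \<theta>) \<zeta> (laplace \<zeta>)"
proof -
  have "(LINT z:{0<..<T} \<times> UNIV|lborel. N (fst z) (snd z) * (\<theta> (fst z) * \<zeta> (snd z))) =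
      (LINT z:cylinder b|lborel. N (fst z) (snd z) * (\<theta> (fst z) * \<zeta> (snd z)))"
  proof (rule set_integral_restrict_AE)
    show "set_integrable lborel ({0<..<T} \<times> UNIV) (\<lambda>z. N (fst z) (snd z) * (\<theta> (fst z) * \<zeta> (snd z)))"
      using weak_identity test_fun_product[OF \<theta>(1) \<zeta>(1) b(2) \<theta>(2) \<zeta>(2)]
      unfolding weak_eq_def split_beta by fastforce
    show "AE z in lborel. z \<in> {0<..<T} \<times> UNIV - cylinder b \<longrightarrow>
        N (fst z) (snd z) * (\<theta> (fst z) * \<zeta> (snd z)) = 0"
      using N_cone by eventually_elim (use \<theta>(2) in \<open>auto simp: cylinder_def\<close>)
  qed (use b cylinder_borel in \<open>auto simp: cylinder_def\<close>)
  then show ?thesis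
    using product_identity cylinder_kernel_integral
    by (simp add: test_identity_def cball_integral_eq w0_support w1_support)
qed

end

lemma test_identity_cong:
  assumes "\<And>x. norm x \<le> T + R \<Longrightarrow> \<zeta> x = \<zeta>' x" "\<And>x. norm x \<le> T + R \<Longrightarrow> \<xi> x = \<xi>' x"
  shows "test_identity b \<theta> \<theta>' \<zeta> \<xi> = test_identity b \<theta> \<theta>' \<zeta>' \<xi>'"
proof -
  have "norm x \<le> R \<Longrightarrow> \<zeta> x = \<zeta>' x" "norm x \<le> R \<Longrightarrow> \<xi> x = \<xi>' x" for x
    using assms T_pos by auto
  then have "(LINT x:cball 0 R|lborel. w1 x * \<zeta> x) = (LINT x:cball 0 R|lborel. w1 x * \<zeta>' x)"
    "(LINT x:cball 0 R|lborel. w0 x * (\<xi> x - V x * \<zeta> x)) =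
      (LINT x:cball 0 R|lborel. w0 x * (\<xi>' x - V x * \<zeta>' x))"
    by (intro set_lebesgue_integral_cong; simp)+
  moreover have "\<zeta> (snd z) = \<zeta>' (snd z)" "\<xi> (snd z) = \<xi>' (snd z)" if "z \<in> cylinder b" for z
    using assms that by (auto simp: cylinder_def)
  then have "(LINT z:cylinder b|lborel. N (fst z) (snd z) * (\<theta> (fst z) * \<zeta> (snd z))) =
      (LINT z:cylinder b|lborel. N (fst z) (snd z) * (\<theta> (fst z) * \<zeta>' (snd z)))"
    "(LINT z:cylinder b|lborel. wt (fst z) (snd z) * (\<theta> (fst z) * (D (snd z) * \<zeta> (snd z))
        - \<theta>' (fst z) * \<zeta> (snd z) - tail b \<theta> (fst z) * (\<xi> (snd z) - V (snd z) * \<zeta> (snd z)))) =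
      (LINT z:cylinder b|lborel. wt (fst z) (snd z) * (\<theta> (fst z) * (D (snd z) * \<zeta>' (snd z))
        - \<theta>' (fst z) * \<zeta>' (snd z) - tail b \<theta> (fst z) * (\<xi>' (snd z) - V (snd z) * \<zeta>' (snd z))))"
    by (intro set_lebesgue_integral_cong; simp add: cylinder_borel)+
  ultimately show ?thesis by (simp only: test_identity_def)
qed

lemma test_identity_smooth:
  assumes b: "0 \<le> b" "b < T" and \<theta>: "smooth_fun \<theta>" "\<And>t. b \<le> \<bar>t\<bar> \<Longrightarrow> \<theta> t = 0" and \<zeta>: "smooth_fun \<zeta>"
  shows "test_identity b \<theta> (deriv \<theta>) \<zeta> (laplace \<zeta>)"
proof -
  obtain \<kappa> :: "'a \<Rightarrow> real" where \<kappa>: "smooth_fun \<kappa>" "\<And>x. norm x \<le> T + R + 1 \<Longrightarrow> \<kappa> x = 1"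
      "\<And>x. T + R + 2 \<le> norm x \<Longrightarrow> \<kappa> x = 0"
    by (rule smooth_cutoff[of "T + R + 1" "T + R + 2", where 'a = 'a])
      (use T_pos R_pos that in auto)
  have smooth: "smooth_fun (\<lambda>x. \<kappa> x * \<zeta> x)" by (rule smooth_fun_mult[OF \<kappa>(1) \<zeta>])
  have "test_identity b \<theta> (deriv \<theta>) (\<lambda>x. \<kappa> x * \<zeta> x) (laplace (\<lambda>x. \<kappa> x * \<zeta> x))"
    by (rule test_identity_compact_support[OF b \<theta> smooth, of "T + R + 2"]) (use \<kappa>(3) in auto)
  moreover have "laplace (\<lambda>x. \<kappa> x * \<zeta> x) x = laplace \<zeta> x" if "norm x \<le> T + R" for x
    by (rule laplace_cong_open[OF open_ball _ _ smooth, of _ 0 "T + R + 1"])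
      (use that \<kappa> in auto)
  ultimately show ?thesis
    by (subst (asm) test_identity_cong) (auto simp: \<kappa>)
qed

lemma cylinder_integral_limit:
  assumes "strip_integrable T F" "b < T"
    and "\<And>j. continuous_on ({0..b} \<times> cball 0 (T + R)) (G j)"
    and "uniform_limit ({0..b} \<times> cball 0 (T + R)) G H sequentially"
  shows "(\<lambda>j. LINT z:cylinder b|lborel. F z * G j z) \<longlonglongrightarrow> (LINT z:cylinder b|lborel. F z * H z)"
proof (rule set_integral_mult_uniform_limit)
  show "set_integrable lborel (cylinder b) F"
    using assms(1,2) by (simp add: strip_integrable_def cylinder_def)
  show "cylinder b \<subseteq> {0..b} \<times> cball 0 (T + R)" by (auto simp: cylinder_def)
  then show "uniform_limit (cylinder b) G H sequentially"
    by (rule uniform_limit_on_subset[OF assms(4)])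
  show "continuous_on ({0..b} \<times> cball 0 (T + R)) H"
    by (rule uniform_limit_theorem[OF eventuallyI _ sequentially_bot]) (rule assms)+
qed (use assms(3) cylinder_borel in \<open>auto intro: compact_Times\<close>)

lemma data_integral_limit:
  fixes f g :: "'a \<Rightarrow> real"
  assumes "continuous_on UNIV f" "\<And>j. continuous_on (cball 0 (T + R)) (h j)"
    and "continuous_on (cball 0 (T + R)) g" "uniform_limit (cball 0 (T + R)) h g sequentially"
  shows "(\<lambda>j. LINT x:cball 0 R|lborel. f x * h j x) \<longlonglongrightarrow> (LINT x:cball 0 R|lborel. f x * g x)"
proof (rule set_integral_mult_uniform_limit[where K = "cball 0 (T + R)"])
  show "set_integrable lborel (cball 0 R) f"
    unfolding set_integrable_def
    by (rule borel_integrable_compact) (auto intro: continuous_on_subset[OF assms(1)])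
  show "uniform_limit (cball 0 R) h g sequentially"
    by (rule uniform_limit_on_subset[OF assms(4)]) (use T_pos in auto)
qed (use assms T_pos in auto)

lemma test_identity_limit:
  assumes b: "0 \<le> b" "b < T"
    and time: "\<And>j. continuous_on {0..b} (\<theta> j)" "uniform_limit {0..b} \<theta> \<eta> sequentially"
      "\<And>j. continuous_on {0..b} (\<theta>' j)" "uniform_limit {0..b} \<theta>' \<eta>' sequentially"
    and space: "\<And>j. continuous_on (cball 0 (T + R)) (\<zeta> j)"
      "uniform_limit (cball 0 (T + R)) \<zeta> \<phi> sequentially"
      "\<And>j. continuous_on (cball 0 (T + R)) (\<xi> j)"
      "uniform_limit (cball 0 (T + R)) \<xi> \<psi> sequentially"
    and identities: "\<And>j. test_identity b (\<theta> j) (\<theta>' j) (\<zeta> j) (\<xi> j)"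
  shows "test_identity b \<eta> \<eta>' \<phi> \<psi>"
proof -
  let ?B = "cball (0::'a) (T + R)"
  note limit_cont = uniform_limit_theorem[OF eventuallyI _ sequentially_bot]
  have limits_cont: "continuous_on {0..b} \<eta>" "continuous_on {0..b} \<eta>'"
      "continuous_on ?B \<phi>" "continuous_on ?B \<psi>"
    by (rule limit_cont[OF time(1,2)] limit_cont[OF time(3,4)]
        limit_cont[OF space(1,2)] limit_cont[OF space(3,4)])+
  have coeff_cont: "continuous_on ?B D" "continuous_on ?B V"
    using D_cont V_cont by (auto intro: continuous_on_subset)
  have bounded: "bounded (f ` ?B)" if "continuous_on ?B f" for f :: "'a \<Rightarrow> real"
    by (intro compact_imp_bounded compact_continuous_image that compact_cball)
  have coeff_limits: "uniform_limit ?B (\<lambda>j x. D x * \<zeta> j x) (\<lambda>x. D x * \<phi> x) sequentially"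
    "uniform_limit ?B (\<lambda>j x. \<xi> j x - V x * \<zeta> j x) (\<lambda>x. \<psi> x - V x * \<phi> x) sequentially"
    by (intro uniform_limit_minus uniform_lim_mult uniform_limit_const space bounded limits_cont
        coeff_cont)+
  note cont = continuous_on_mult continuous_on_diff coeff_cont limits_cont space(1,3) time(1,3)
    continuous_on_tail
  have data_limit: "(\<lambda>j. \<epsilon> * (\<theta> j 0 * (LINT x:cball 0 R|lborel. w1 x * \<zeta> j x)
        + tail b (\<theta> j) 0 * (LINT x:cball 0 R|lborel. w0 x * (\<xi> j x - V x * \<zeta> j x))))
    \<longlonglongrightarrow> \<epsilon> * (\<eta> 0 * (LINT x:cball 0 R|lborel. w1 x * \<phi> x)
        + tail b \<eta> 0 * (LINT x:cball 0 R|lborel. w0 x * (\<psi> x - V x * \<phi> x)))"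
    using b time(2) uniform_limit_tail[OF time(1) limits_cont(1) time(2)]
    by (intro tendsto_intros data_integral_limit w0_cont w1_cont coeff_limits space cont)
      (auto intro: tendsto_uniform_limitI)
  note tensor = uniform_limit_tensor[OF compact_Icc _ _ compact_cball]
  have N_limit: "(\<lambda>j. LINT z:cylinder b|lborel. N (fst z) (snd z) * (\<theta> j (fst z) * \<zeta> j (snd z)))
      \<longlonglongrightarrow> (LINT z:cylinder b|lborel. N (fst z) (snd z) * (\<eta> (fst z) * \<phi> (snd z)))"
    by (intro cylinder_integral_limit N_strip_integrable b continuous_on_tensor tensor cont
        time space)
  have wt_limit: "(\<lambda>j. LINT z:cylinder b|lborel. wt (fst z) (snd z) *
        (\<theta> j (fst z) * (D (snd z) * \<zeta> j (snd z)) - \<theta>' j (fst z) * \<zeta> j (snd z)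
        - tail b (\<theta> j) (fst z) * (\<xi> j (snd z) - V (snd z) * \<zeta> j (snd z))))
      \<longlonglongrightarrow> (LINT z:cylinder b|lborel. wt (fst z) (snd z) * (\<eta> (fst z) * (D (snd z) * \<phi> (snd z))
        - \<eta>' (fst z) * \<phi> (snd z) - tail b \<eta> (fst z) * (\<psi> (snd z) - V (snd z) * \<phi> (snd z))))"
    by (intro cylinder_integral_limit wt_strip_integrable b continuous_on_tensor tensor cont time
        space coeff_limits uniform_limit_minus uniform_limit_tail)
  show ?thesis
    using LIMSEQ_unique[OF tendsto_add[OF data_limit N_limit]] wt_limit identities
    by (simp add: test_identity_def)
qed

lemma test_identity_radial:
  assumes b: "0 < \<sigma>" "\<sigma> < b" "b < T"
    and \<theta>: "\<And>t. (\<theta> has_real_derivative \<theta>' t) (at t)" "continuous_on UNIV \<theta>'"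
      "\<And>t. \<sigma> \<le> t \<Longrightarrow> \<theta> t = 0"
    and radial: "radial_equation DIM('a) s a \<phi>"
  shows "test_identity b \<theta> \<theta>' (\<lambda>x. \<phi> (norm x)) (\<lambda>x. a (norm x) * \<phi> (norm x))"
proof -
  interpret radial_equation "DIM('a)" s a \<phi> by (rule radial)
  obtain \<eta> where \<eta>: "\<And>j. smooth_fun (\<eta> j)" "\<And>j t. b \<le> \<bar>t\<bar> \<Longrightarrow> \<eta> j t = 0"
      "uniform_limit {0..b} \<eta> \<theta> sequentially"
        "uniform_limit {0..b} (\<lambda>j. deriv (\<eta> j)) \<theta>' sequentially"
    by (rule C1_smooth_approximation[OF \<theta> b(1,2)]) (assumption, rule that)
  obtain Q :: "nat \<Rightarrow> 'a \<Rightarrow> real" where Q: "\<And>j. smooth_fun (Q j)"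
      "uniform_limit (cball 0 (T + R)) Q (\<lambda>x. \<phi> (norm x)) sequentially"
      "uniform_limit (cball 0 (T + R)) (\<lambda>j. laplace (Q j)) (\<lambda>x. a (norm x) * \<phi> (norm x))
          sequentially"
    by (rule smooth_approximation[OF refl, of "T + R"]) (rule that)
  show ?thesis
  proof (rule test_identity_limit[OF _ b(3) _ \<eta>(3) _ \<eta>(4) _ Q(2) _ Q(3)])
    show "test_identity b (\<eta> j) (deriv (\<eta> j)) (Q j) (laplace (Q j))" for j
      by (rule test_identity_smooth) (use b \<eta> Q in auto)
  qed (use b \<eta>(1) Q(1) in \<open>auto intro!: continuous_on_subset[OF smooth_fun_continuous]
      smooth_fun_deriv smooth_fun_laplace\<close>)
qed

end

section \<open>The conical weight\<close>

lemma radial_weight_le_exp: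
  assumes "0 \<le> s" "0 \<le> r" "r \<le> L"
  shows "radial_weight s r \<le> exp L"
proof -
  have "(1 + r) powr (- s) \<le> 1" using powr_mono[of "- s" 0 "1 + r"] assms by simp
  then have "(1 + r) powr (- s) * exp r \<le> 1 * exp L" using assms by (intro mult_mono) auto
  then show ?thesis by (simp add: radial_weight_def)
qed

lemma continuous_on_radial_weight_norm:
  "continuous_on X (\<lambda>x::'a::real_normed_vector. radial_weight s (norm x))"
proof -
  have "1 + norm x \<noteq> 0" for x :: 'a using norm_ge_zero[of x] by linarith
  then show ?thesis unfolding radial_weight_def by (intro continuous_intros) auto
qed

lemma set_integrable_radial_weight:
  "set_integrable lborel (cball (0::'a::euclidean_space) \<rho>) (\<lambda>x. radial_weight s (norm x))"
  unfolding set_integrable_def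
  by (intro borel_integrable_compact compact_cball continuous_on_radial_weight_norm)

lemma annulus_content_le:
  assumes "1 \<le> \<rho>"
  shows "measure lborel (cball (0::'a::euclidean_space) \<rho> - cball 0 (\<rho> - 1)) \<le>
    unit_ball_vol DIM('a) * DIM('a) * \<rho> ^ (DIM('a) - 1)"
proof -
  have "measure lborel (cball (0::'a) \<rho> - cball 0 (\<rho> - 1)) =
      measure lborel (cball (0::'a) \<rho>) - measure lborel (cball (0::'a) (\<rho> - 1))"
    using emeasure_bounded_finite[of "cball (0::'a) \<rho>"]
    by (intro measure_Diff subset_cball) auto
  also have "\<dots> = unit_ball_vol DIM('a) * (\<rho> ^ DIM('a) - (\<rho> - 1) ^ DIM('a))"
    using assms by (simp add: content_cball right_diff_distrib)
  also have "\<dots> \<le> unit_ball_vol DIM('a) * (real DIM('a) * \<rho> ^ (DIM('a) - 1) * (\<rho> - (\<rho> - 1)))"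
    using assms by (intro mult_left_mono power_diff_le unit_ball_vol_nonneg) auto
  finally show ?thesis by simp
qed

lemma radial_weight_annulus_integral_le:
  assumes s: "real DIM('a::euclidean_space) = 2 * s + 1" "0 \<le> s" and \<rho>: "1 \<le> \<rho>"
  shows "(LINT x:cball (0::'a) \<rho> - cball 0 (\<rho> - 1)|lborel. radial_weight s (norm x)) \<le>
    unit_ball_vol DIM('a) * DIM('a) * (\<rho> powr s * exp \<rho>)"
proof -
  define A where "A = cball (0::'a) \<rho> - cball 0 (\<rho> - 1)"
  have A_int: "set_integrable lborel A (\<lambda>_. c :: real)" for c
    unfolding A_def using emeasure_bounded_finite[of "cball (0::'a) \<rho> - cball 0 (\<rho> - 1)"]
    by (auto simp: set_integrable_def bounded_diff)
  have "(LINT x:A|lborel. radial_weight s (norm x)) \<le> (LINT x:A|lborel. \<rho> powr (- s) * exp \<rho>)"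
  proof (rule set_integral_mono[OF _ A_int])
    show "set_integrable lborel A (\<lambda>x. radial_weight s (norm x))"
      by (rule set_integrable_subset[OF set_integrable_radial_weight[of \<rho>]]) (auto simp: A_def)
    fix x assume "x \<in> A"
    then have x: "\<rho> - 1 < norm x" "norm x \<le> \<rho>" by (auto simp: A_def)
    then show "radial_weight s (norm x) \<le> \<rho> powr (- s) * exp \<rho>"
      unfolding radial_weight_def using s \<rho> by (intro mult_mono powr_mono2') auto
  qed
  also have "\<dots> = measure lborel A * (\<rho> powr (- s) * exp \<rho>)"
    by (simp add: A_def set_lebesgue_integral_def)
  also have "\<dots> \<le> unit_ball_vol DIM('a) * DIM('a) * \<rho> ^ (DIM('a) - 1) * (\<rho> powr (- s) * exp \<rho>)"
    unfolding A_def by (intro mult_right_mono annulus_content_le \<rho>) auto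
  also have "\<rho> ^ (DIM('a) - 1) = \<rho> powr (2 * s)"
  proof -
    have "2 * s = real (DIM('a) - 1)" using s by (simp add: of_nat_diff Suc_leI)
    moreover have "\<rho> powr real (DIM('a) - 1) = \<rho> ^ (DIM('a) - 1)"
      using \<rho> by (intro powr_realpow) auto
    ultimately show ?thesis by (simp only:)
  qed
  also have "unit_ball_vol DIM('a) * DIM('a) * \<rho> powr (2 * s) * (\<rho> powr (- s) * exp \<rho>) =
      unit_ball_vol DIM('a) * DIM('a) * (\<rho> powr (2 * s + - s) * exp \<rho>)"
    by (simp only: powr_add mult_ac)
  finally show ?thesis by (simp add: A_def)
qed

lemma radial_weight_unit_ball_integral_le:
  assumes "0 \<le> s" "0 \<le> \<rho>" "\<rho> \<le> 1"
  shows "(LINT x:cball (0::'a::euclidean_space) \<rho>|lborel. radial_weight s (norm x)) \<le>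
    unit_ball_vol DIM('a) * exp \<rho>"
proof -
  have "(LINT x:cball (0::'a) \<rho>|lborel. radial_weight s (norm x)) \<le>
      (LINT x:cball (0::'a) \<rho>|lborel. exp \<rho>)"
    using emeasure_bounded_finite[of "cball (0::'a) \<rho>"] assms
    by (intro set_integral_mono set_integrable_radial_weight)
      (auto simp: set_integrable_def intro: radial_weight_le_exp)
  also have "\<dots> = unit_ball_vol DIM('a) * \<rho> ^ DIM('a) * exp \<rho>"
    using assms by (simp add: set_lebesgue_integral_def content_cball)
  also have "\<dots> \<le> unit_ball_vol DIM('a) * 1 * exp \<rho>"
    using assms by (intro mult_right_mono mult_left_mono power_le_one) auto
  finally show ?thesis by simp
qed

lemma radial_weight_ball_integral_split:
  "(LINT x:cball (0::'a::euclidean_space) \<rho>|lborel. radial_weight s (norm x)) =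
    (LINT x:cball (0::'a) (\<rho> - 1)|lborel. radial_weight s (norm x)) +
    (LINT x:cball (0::'a) \<rho> - cball 0 (\<rho> - 1)|lborel. radial_weight s (norm x))"
proof -
  have "cball (0::'a) \<rho> = cball 0 (\<rho> - 1) \<union> (cball 0 \<rho> - cball 0 (\<rho> - 1))" by auto
  then have "(LINT x:cball (0::'a) \<rho>|lborel. radial_weight s (norm x)) =
      (LINT x:cball (0::'a) (\<rho> - 1) \<union> (cball 0 \<rho> - cball 0 (\<rho> - 1))|lborel.
        radial_weight s (norm x))" by simp
  also have "\<dots> = (LINT x:cball (0::'a) (\<rho> - 1)|lborel. radial_weight s (norm x)) +
      (LINT x:cball (0::'a) \<rho> - cball 0 (\<rho> - 1)|lborel. radial_weight s (norm x))"
    by (intro set_integral_Un set_integrable_radial_weight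
        set_integrable_subset[OF set_integrable_radial_weight[of \<rho>]]) auto
  finally show ?thesis .
qed

lemma radial_weight_ball_integral_le:
  assumes s: "real DIM('a::euclidean_space) = 2 * s + 1" "0 \<le> s" and "0 \<le> \<rho>"
  shows "(LINT x:cball (0::'a) \<rho>|lborel. radial_weight s (norm x)) \<le>
    2 * (unit_ball_vol DIM('a) * DIM('a)) * ((1 + \<rho>) powr s * exp \<rho>)"
  using \<open>0 \<le> \<rho>\<close>
proof (induction "nat \<lfloor>\<rho>\<rfloor>" arbitrary: \<rho>)
  case 0
  let ?v = "unit_ball_vol DIM('a) * DIM('a)"
  have \<rho>: "0 \<le> \<rho>" "\<rho> \<le> 1" using 0 by linarith+
  have dim: "1 \<le> 2 * real DIM('a)" using s by linarith
  have "(LINT x:cball (0::'a) \<rho>|lborel. radial_weight s (norm x)) \<le> unit_ball_vol DIM('a) * exp \<rho>"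
    by (rule radial_weight_unit_ball_integral_le[OF s(2) \<rho>])
  also have "\<dots> \<le> 2 * ?v * (1 * exp \<rho>)"
    using mult_left_mono[OF dim, of "unit_ball_vol DIM('a)"] by simp
  also have "\<dots> \<le> 2 * ?v * ((1 + \<rho>) powr s * exp \<rho>)"
    using \<rho> s ge_one_powr_ge_zero[of "1 + \<rho>" s] by (intro mult_left_mono mult_right_mono) auto
  finally show ?case .
next
  case (Suc m)
  let ?v = "unit_ball_vol DIM('a) * DIM('a)"
  have \<rho>: "1 \<le> \<rho>" using Suc(2) by linarith
  have exp_step: "2 * exp (\<rho> - 1) \<le> exp \<rho>"
    using exp_ge_add_one_self[of 1] by (simp add: exp_diff pos_divide_le_eq)
  have "2 * ?v * ((1 + (\<rho> - 1)) powr s * exp (\<rho> - 1)) = ?v * (\<rho> powr s * (2 * exp (\<rho> - 1)))"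
    by simp
  also have "\<dots> \<le> ?v * (\<rho> powr s * exp \<rho>)"
    using exp_step by (intro mult_left_mono) auto
  finally have halved: "2 * ?v * ((1 + (\<rho> - 1)) powr s * exp (\<rho> - 1)) \<le> ?v * (\<rho> powr s * exp \<rho>)" .
  have "(LINT x:cball (0::'a) \<rho>|lborel. radial_weight s (norm x)) \<le>
      2 * ?v * ((1 + (\<rho> - 1)) powr s * exp (\<rho> - 1)) + ?v * (\<rho> powr s * exp \<rho>)"
    unfolding radial_weight_ball_integral_split[of \<rho>]
    using Suc(2) \<rho> by (intro add_mono Suc.hyps(1) radial_weight_annulus_integral_le s) linarith+
  also have "\<dots> \<le> 2 * ?v * (\<rho> powr s * exp \<rho>)"
    using halved by linarith
  also have "\<dots> \<le> 2 * ?v * ((1 + \<rho>) powr s * exp \<rho>)"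
    using \<rho> s by (intro mult_left_mono mult_right_mono powr_mono2) auto
  finally show ?case .
qed

definition light_cone_weight :: "real \<Rightarrow> real \<Rightarrow> real \<Rightarrow> real \<times> 'a::euclidean_space \<Rightarrow> real" where
  "light_cone_weight s R T z =
    (if 0 < fst z \<and> fst z < T \<and> norm (snd z) \<le> fst z + R
     then exp (- fst z) * radial_weight s (norm (snd z)) else 0)"

lemma light_cone_weight_nonneg: "0 \<le> light_cone_weight s R T z"
  using radial_weight_pos[of "norm (snd z)" s] by (simp add: light_cone_weight_def)

lemma light_cone_weight_le: "0 \<le> s \<Longrightarrow> light_cone_weight s R T z \<le> exp R"
  using radial_weight_le_exp[of s "norm (snd z)" "fst z + R"]
  by (auto simp: light_cone_weight_def exp_add exp_minus field_simps)

lemma light_cone_weight_measurable: "light_cone_weight s R T \<in> borel_measurable borel"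
proof -
  have "light_cone_weight s R T \<in> borel_measurable (borel \<Otimes>\<^sub>M borel :: (real \<times> 'a) measure)"
    unfolding light_cone_weight_def[abs_def] radial_weight_def by measurable
  then show ?thesis by (simp add: borel_prod)
qed

definition cone_constant :: "real \<Rightarrow> real \<Rightarrow> real" where
  "cone_constant s R =
    max 1 (2 * (unit_ball_vol (2 * s + 1) * (2 * s + 1)) * (1 + R) powr s * exp R)"

lemma light_cone_weight_slice_le:
  assumes s: "real DIM('a::euclidean_space) = 2 * s + 1" "0 \<le> s" and "0 < R" "0 \<le> t"
  shows "(\<integral>x. light_cone_weight s R T (t, x::'a) \<partial>lborel) \<le> cone_constant s R * (1 + t) powr s"
proof (cases "0 < t \<and> t < T")
  case True
  let ?v = "2 * (unit_ball_vol (2 * s + 1) * (2 * s + 1))"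
  have "(\<integral>x. light_cone_weight s R T (t, x::'a) \<partial>lborel) =
      (\<integral>x. exp (- t) * (indicator (cball 0 (t + R)) x * radial_weight s (norm (x::'a))) \<partial>lborel)"
    using True by (intro Bochner_Integration.integral_cong)
      (auto simp: light_cone_weight_def indicator_def)
  also have "\<dots> = exp (- t) * (LINT x:cball (0::'a) (t + R)|lborel. radial_weight s (norm x))"
    by (simp add: set_lebesgue_integral_def)
  also have "\<dots> \<le> exp (- t) * (?v * ((1 + (t + R)) powr s * exp (t + R)))"
    using radial_weight_ball_integral_le[OF s, of "t + R"] assms by (intro mult_left_mono) auto
  also have "\<dots> \<le> exp (- t) * (?v * (((1 + R) * (1 + t)) powr s * exp (t + R)))"
    using assms by (intro mult_left_mono mult_right_mono powr_mono2) (auto simp: algebra_simps)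
  also have "\<dots> = (?v * (1 + R) powr s * exp R) * (1 + t) powr s"
    using assms by (simp add: powr_mult exp_add exp_minus)
  also have "\<dots> \<le> cone_constant s R * (1 + t) powr s"
    unfolding cone_constant_def by (intro mult_right_mono) auto
  finally show ?thesis .
qed (auto simp: light_cone_weight_def cone_constant_def)

lemma light_cone_weight_decay_integrable:
  fixes s R T e \<sigma> :: real
  defines "F \<equiv> \<lambda>z::real \<times> 'a::euclidean_space.
    if fst z < \<sigma> then light_cone_weight s R T z * (1 + fst z) powr (- e) else 0"
  assumes "0 \<le> s" "0 \<le> e"
  shows "integrable lborel F"
proof (rule integrable_bounded_support)
  have [measurable]: "light_cone_weight s R T
      \<in> borel_measurable (borel \<Otimes>\<^sub>M borel :: (real \<times> 'a) measure)"
    using light_cone_weight_measurable by (simp add: borel_prod)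
  have "F \<in> borel_measurable (borel \<Otimes>\<^sub>M borel)" unfolding F_def by measurable
  then show "F \<in> borel_measurable borel" by (simp add: borel_prod)
  show "\<bar>F z\<bar> \<le> exp R" for z
  proof (cases "0 < fst z \<and> fst z < \<sigma>")
    case True
    then have "(1 + fst z) powr (- e) \<le> 1"
      using powr_mono[of "- e" 0 "1 + fst z"] assms by simp
    then have "light_cone_weight s R T z * (1 + fst z) powr (- e) \<le> exp R * 1"
      using assms by (intro mult_mono light_cone_weight_le) auto
    then show ?thesis using True by (simp add: F_def light_cone_weight_nonneg)
  qed (auto simp: F_def light_cone_weight_def)
  show "{0..\<sigma>} \<times> cball (0::'a) (\<sigma> + R) \<in> sets borel" by (intro borel_Times) auto
  show "bounded ({0..\<sigma>} \<times> cball (0::'a) (\<sigma> + R))" by (intro bounded_Times) auto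
  show "F z = 0" if "z \<notin> {0..\<sigma>} \<times> cball (0::'a) (\<sigma> + R)" for z
    using that by (cases z) (auto simp: F_def light_cone_weight_def)
qed

lemma light_cone_weight_decay_integral_le:
  fixes s R T e \<sigma> :: real
  defines "F \<equiv> \<lambda>z::real \<times> 'a::euclidean_space.
    if fst z < \<sigma> then light_cone_weight s R T z * (1 + fst z) powr (- e) else 0"
  assumes s: "real DIM('a) = 2 * s + 1" "0 \<le> s" and R: "0 < R" and e: "0 \<le> e" "e \<le> s" and \<sigma>: "0 \<le> \<sigma>"
  shows "(\<integral>z. F z \<partial>lborel) \<le> cone_constant s R * (1 + \<sigma>) powr (s + 1 - e)"
proof -
  have C: "0 \<le> cone_constant s R" by (simp add: cone_constant_def)
  have F_int: "integrable (lborel \<Otimes>\<^sub>M lborel) F"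
    using light_cone_weight_decay_integrable[OF s(2) e(1)] unfolding F_def lborel_prod .
  have slice: "(\<integral>x. F (t, x) \<partial>lborel) \<le>
      indicator {0..\<sigma>} t * (cone_constant s R * (1 + \<sigma>) powr (s - e))"
    for t
  proof (cases "0 < t \<and> t < \<sigma>")
    case True
    have "(\<integral>x. F (t, x) \<partial>lborel) =
        (1 + t) powr (- e) * (\<integral>x. light_cone_weight s R T (t, x::'a) \<partial>lborel)"
      using True by (simp add: F_def mult.commute)
    also have "\<dots> \<le> (1 + t) powr (- e) * (cone_constant s R * (1 + t) powr s)"
      using True by (intro mult_left_mono light_cone_weight_slice_le s R) auto
    also have "\<dots> = cone_constant s R * (1 + t) powr (s - e)"
      by (simp add: powr_diff powr_minus divide_simps)
    also have "\<dots> \<le> cone_constant s R * (1 + \<sigma>) powr (s - e)"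
      using True e C by (intro mult_left_mono powr_mono2) auto
    finally show ?thesis using True by simp
  next
    case False
    then have "F (t, x) = 0" for x by (auto simp: F_def light_cone_weight_def)
    then show ?thesis using C by simp
  qed
  have "(\<integral>z. F z \<partial>lborel) = (\<integral>t. \<integral>x. F (t, x) \<partial>lborel \<partial>lborel)"
    using lborel_pair.integral_fst'[OF F_int] by (simp add: lborel_prod)
  also have "\<dots> \<le> (\<integral>t. indicator {0..\<sigma>} t * (cone_constant s R * (1 + \<sigma>) powr (s - e)) \<partial>lborel)"
  proof (rule integral_mono[OF lborel_pair.integrable_fst'[OF F_int] _ slice])
    show "integrable lborel (\<lambda>t. indicator {0..\<sigma>} t * (cone_constant s R * (1 + \<sigma>) powr (s - e)))"
      using emeasure_bounded_finite[of "{0..\<sigma>}"]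
      by (intro integrable_mult_left integrable_real_indicator) auto
  qed
  also have "\<dots> = \<sigma> * (cone_constant s R * (1 + \<sigma>) powr (s - e))" using \<sigma> by simp
  also have "\<dots> \<le> (1 + \<sigma>) * (cone_constant s R * (1 + \<sigma>) powr (s - e))"
    using C by (intro mult_right_mono) auto
  also have "\<dots> = cone_constant s R * (1 + \<sigma>) powr (s + 1 - e)"
    using \<sigma> powr_add[of "1 + \<sigma>" "s - e" 1] by (simp add: algebra_simps)
  finally show ?thesis .
qed

proposition cone_weight_light_cone_weight:
  assumes "real DIM('a::euclidean_space) = 2 * s + 1" "0 < s" "0 < R"
  shows "cone_weight (lborel :: (real \<times> 'a) measure) fst (light_cone_weight s R T) s
    (cone_constant s R) T"
proof
  have "(fst :: real \<times> 'a \<Rightarrow> real) \<in> borel_measurable (borel \<Otimes>\<^sub>M borel)" by measurable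
  then show "fst \<in> borel_measurable (lborel :: (real \<times> 'a) measure)" by (simp add: borel_prod)
  show "light_cone_weight s R T \<in> borel_measurable (lborel :: (real \<times> 'a) measure)"
    using light_cone_weight_measurable by simp
  show "0 \<le> fst z" if "light_cone_weight s R T z \<noteq> 0" for z :: "real \<times> 'a"
    using that by (auto simp: light_cone_weight_def split: if_splits)
  show "1 \<le> cone_constant s R" by (simp add: cone_constant_def)
qed (use assms in \<open>auto intro: light_cone_weight_nonneg light_cone_weight_decay_integrable
    light_cone_weight_decay_integral_le\<close>)

section \<open>The cone inequality\<close>

lemma DERIV_max_0_power:
  fixes y :: real
  assumes "1 \<le> k"
  shows "((\<lambda>y. max 0 y ^ Suc k) has_real_derivative real (Suc k) * max 0 y ^ k) (at y)"
proof -
  consider "0 < y" | "y < 0" | "y = 0" by linarith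
  then show ?thesis
  proof cases
    assume "0 < y"
    have "((\<lambda>y. y ^ Suc k) has_real_derivative real (Suc k) * max 0 y ^ k) (at y)"
      using \<open>0 < y\<close> DERIV_pow[of "Suc k" y] by simp
    then show ?thesis
      by (rule has_field_derivative_transform_within_open[where S = "{0<..}"]) (use \<open>0 < y\<close> in auto)
  next
    assume "y < 0"
    have "((\<lambda>y. 0) has_real_derivative real (Suc k) * max 0 y ^ k) (at y)"
      using \<open>y < 0\<close> assms by (simp add: power_0_left)
    then show ?thesis
      by (rule has_field_derivative_transform_within_open[where S = "{..<0}"]) (use \<open>y < 0\<close> in auto)
  next
    assume "y = 0"
    have "((\<lambda>h. \<bar>h\<bar> ^ k) \<longlongrightarrow> \<bar>0::real\<bar> ^ k) (at 0)" by (intro tendsto_intros)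
    then have limit: "((\<lambda>h. \<bar>h\<bar> ^ k) \<longlongrightarrow> (0::real)) (at 0)"
      using assms by (simp add: power_0_left)
    have "((\<lambda>h. (max 0 (0 + h) ^ Suc k - max 0 0 ^ Suc k) / h) \<longlongrightarrow> (0::real)) (at 0)"
      by (rule Lim_null_comparison[OF _ limit]) (auto simp: max_def abs_mult)
    then show ?thesis
      unfolding \<open>y = 0\<close> DERIV_def using assms by (simp add: power_0_left)
  qed
qed

definition ramp_exp :: "nat \<Rightarrow> real \<Rightarrow> real \<Rightarrow> real" where
  "ramp_exp k \<sigma> t = ramp \<sigma> t ^ k * exp (- t)"

lemma ramp_exp_nonneg: "0 \<le> ramp_exp k \<sigma> t"
  by (simp add: ramp_exp_def ramp_nonneg)

lemma ramp_exp_eq_0: "1 \<le> \<sigma> \<Longrightarrow> \<sigma> \<le> t \<Longrightarrow> ramp_exp (Suc k) \<sigma> t = 0"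
  by (simp add: ramp_exp_def ramp_eq_0)

lemma continuous_on_ramp_exp: "continuous_on X (ramp_exp k \<sigma>)"
  unfolding ramp_exp_def[abs_def] by (intro continuous_intros continuous_on_ramp)

lemma DERIV_ramp_exp:
  assumes "1 \<le> k" "1 \<le> \<sigma>"
  shows "(ramp_exp (Suc k) \<sigma> has_real_derivative
    - (real (Suc k) / (1 + \<sigma>) * ramp_exp k \<sigma> t + ramp_exp (Suc k) \<sigma> t)) (at t)"
proof -
  have "((\<lambda>t. (\<sigma> - t) / (1 + \<sigma>)) has_real_derivative (- 1) / (1 + \<sigma>)) (at t)"
    by (rule DERIV_cdivide) (auto intro!: derivative_eq_intros)
  from DERIV_chain2[OF DERIV_max_0_power[OF assms(1)] this]
  have "((\<lambda>t. ramp \<sigma> t ^ Suc k) has_real_derivative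
      real (Suc k) * ramp \<sigma> t ^ k * ((- 1) / (1 + \<sigma>))) (at t)"
    by (simp add: ramp_def)
  moreover have "((\<lambda>t. exp (- t)) has_real_derivative exp (- t) * - 1) (at t)"
    by (intro DERIV_fun_exp derivative_eq_intros) auto
  ultimately have "((\<lambda>t. ramp \<sigma> t ^ Suc k * exp (- t)) has_real_derivative
      real (Suc k) * ramp \<sigma> t ^ k * ((- 1) / (1 + \<sigma>)) * exp (- t)
        + exp (- t) * - 1 * ramp \<sigma> t ^ Suc k) (at t)"
    by (rule DERIV_mult)
  then show ?thesis
    unfolding ramp_exp_def[abs_def]
    by (rule DERIV_cong) (simp add: algebra_simps del: power_Suc of_nat_Suc)
qed

lemma tail_ramp_exp_bounds:
  assumes "1 \<le> \<sigma>" "t \<le> b"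
  shows "0 \<le> tail b (ramp_exp k \<sigma>) t" "tail b (ramp_exp k \<sigma>) t \<le> ramp_exp k \<sigma> t"
proof -
  have int: "ramp_exp k \<sigma> integrable_on {t..b}"
    by (intro integrable_continuous_real continuous_on_ramp_exp)
  show "0 \<le> tail b (ramp_exp k \<sigma>) t"
    unfolding tail_def by (intro integral_nonneg int ramp_exp_nonneg)
  have "((\<lambda>u. exp (- u)) has_integral (- exp (- b)) - (- exp (- t))) {t..b}"
    using assms by (intro fundamental_theorem_of_calculus)
      (auto simp flip: has_real_derivative_iff_has_vector_derivative intro!: derivative_eq_intros)
  then have exp_integral: "integral {t..b} (\<lambda>u. exp (- u)) = exp (- t) - exp (- b)"
    by (simp add: integral_unique)
  have "tail b (ramp_exp k \<sigma>) t \<le> integral {t..b} (\<lambda>u. ramp \<sigma> t ^ k * exp (- u))"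
    unfolding tail_def
  proof (rule integral_le[OF int])
    show "(\<lambda>u. ramp \<sigma> t ^ k * exp (- u)) integrable_on {t..b}"
      by (intro integrable_continuous_real continuous_intros)
    fix u assume "u \<in> {t..b}"
    then have "ramp \<sigma> u \<le> ramp \<sigma> t"
      unfolding ramp_def using assms by (intro max.mono order_refl divide_right_mono) auto
    then show "ramp_exp k \<sigma> u \<le> ramp \<sigma> t ^ k * exp (- u)"
      unfolding ramp_exp_def by (intro mult_right_mono power_mono ramp_nonneg) auto
  qed
  also have "\<dots> = ramp \<sigma> t ^ k * (exp (- t) - exp (- b))"
    by (simp add: exp_integral)
  also have "\<dots> \<le> ramp_exp k \<sigma> t"
    unfolding ramp_exp_def by (intro mult_left_mono zero_le_power ramp_nonneg) simp
  finally show "tail b (ramp_exp k \<sigma>) t \<le> ramp_exp k \<sigma> t" .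
qed

lemma ramp_exp_minus_tail:
  assumes "1 \<le> k" "1 \<le> \<sigma>" "\<sigma> \<le> b" "t \<le> b"
  shows "ramp_exp (Suc k) \<sigma> t - tail b (ramp_exp (Suc k) \<sigma>) t =
    real (Suc k) / (1 + \<sigma>) * tail b (ramp_exp k \<sigma>) t"
proof -
  have "- ramp_exp (Suc k) \<sigma> t =
      tail b (\<lambda>u. - (real (Suc k) / (1 + \<sigma>) * ramp_exp k \<sigma> u + ramp_exp (Suc k) \<sigma> u)) t"
    using tail_derivative[OF DERIV_ramp_exp[OF assms(1,2)] assms(4)] ramp_exp_eq_0[OF assms(2,3)]
    by simp
  also have "\<dots> = - (real (Suc k) / (1 + \<sigma>) * tail b (ramp_exp k \<sigma>) t
      + tail b (ramp_exp (Suc k) \<sigma>) t)"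
    unfolding tail_def
    by (intro integral_unique has_integral_neg has_integral_add has_integral_mult_right
        integrable_integral integrable_continuous_real continuous_on_ramp_exp)
  finally show ?thesis by linarith
qed

definition ramp_floor :: "nat \<Rightarrow> real" where
  "ramp_floor k = (1 / 4) ^ k * exp (- 1) / 2"

lemma ramp_floor_pos: "0 < ramp_floor k"
  by (simp add: ramp_floor_def)

lemma ramp_floor_le:
  assumes "1 \<le> \<sigma>" "\<sigma> \<le> b"
  shows "ramp_floor k \<le> ramp_exp k \<sigma> 0" "ramp_floor k \<le> tail b (ramp_exp k \<sigma>) 0"
proof -
  have lower: "(1 / 4) ^ k * exp (- 1) \<le> ramp_exp k \<sigma> t" if "0 \<le> t" "t \<le> 1/2" for t
  proof -
    have "1 / 4 \<le> ramp \<sigma> t" using that assms by (auto simp: ramp_def field_simps max_def)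
    then show ?thesis unfolding ramp_exp_def using that by (intro mult_mono power_mono) auto
  qed
  have "ramp_floor k \<le> (1 / 4) ^ k * exp (- 1)" by (simp add: ramp_floor_def)
  then show "ramp_floor k \<le> ramp_exp k \<sigma> 0" using lower[of 0] by linarith
  have int: "ramp_exp k \<sigma> integrable_on {u..v}" for u v
    by (intro integrable_continuous_real continuous_on_ramp_exp)
  have "ramp_floor k = integral {0..1/2::real} (\<lambda>_. (1 / 4) ^ k * exp (- 1))"
    by (simp add: ramp_floor_def)
  also have "\<dots> \<le> integral {0..1/2} (ramp_exp k \<sigma>)"
    by (intro integral_le int integrable_const_ivl) (use lower in auto)
  also have "\<dots> \<le> tail b (ramp_exp k \<sigma>) 0"
    unfolding tail_def using assms by (intro integral_subset_le int) (auto simp: ramp_exp_nonneg)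
  finally show "ramp_floor k \<le> tail b (ramp_exp k \<sigma>) 0" .
qed

definition light_cone_mass ::
  "real \<Rightarrow> real \<Rightarrow> real \<Rightarrow> nat \<Rightarrow> real \<Rightarrow> (real \<Rightarrow> 'a::euclidean_space \<Rightarrow> real) \<Rightarrow> real" where
  "light_cone_mass s R T k \<sigma> f =
    (\<integral>z. f (fst z) (snd z) * (light_cone_weight s R T z * ramp \<sigma> (fst z) ^ k) \<partial>lborel)"

lemma light_cone_mass_nonneg: "(\<And>t x. 0 \<le> f t x) \<Longrightarrow> 0 \<le> light_cone_mass s R T k \<sigma> f"
  unfolding light_cone_mass_def
  by (intro Bochner_Integration.integral_nonneg mult_nonneg_nonneg light_cone_weight_nonneg
      zero_le_power ramp_nonneg)

definition ramp_kernel :: "real \<Rightarrow> nat \<Rightarrow> real \<Rightarrow> real \<Rightarrow> real \<Rightarrow> real" where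
  "ramp_kernel b k \<sigma> t d = real (Suc k) / (1 + \<sigma>) * ramp_exp k \<sigma> t
    + (1 + d) * (ramp_exp (Suc k) \<sigma> t - tail b (ramp_exp (Suc k) \<sigma>) t)"

lemma abs_ramp_kernel_le:
  assumes d: "0 \<le> d" "d \<le> \<alpha>" and "1 \<le> k" "1 \<le> \<sigma>" "\<sigma> \<le> b" "t \<le> b"
  shows "\<bar>ramp_kernel b k \<sigma> t d\<bar> \<le> (2 + \<alpha>) * real (Suc k) / (1 + \<sigma>) * ramp_exp k \<sigma> t"
proof -
  define slope where "slope = real (Suc k) / (1 + \<sigma>) * ramp_exp k \<sigma> t"
  define gap where "gap = real (Suc k) / (1 + \<sigma>) * tail b (ramp_exp k \<sigma>) t"
  have "0 \<le> real (Suc k) / (1 + \<sigma>)" using assms by simp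
  then have gap: "0 \<le> gap" "gap \<le> slope" "0 \<le> slope"
    unfolding gap_def slope_def
    by (intro mult_nonneg_nonneg mult_left_mono tail_ramp_exp_bounds assms ramp_exp_nonneg; simp)+
  have "(1 + d) * gap \<le> (1 + \<alpha>) * slope" "0 \<le> (1 + d) * gap"
    using gap d by (auto intro: mult_mono)
  moreover have "ramp_kernel b k \<sigma> t d = slope + (1 + d) * gap"
    unfolding ramp_kernel_def ramp_exp_minus_tail[OF assms(3-6)] slope_def gap_def ..
  moreover have "(2 + \<alpha>) * real (Suc k) / (1 + \<sigma>) * ramp_exp k \<sigma> t = slope + (1 + \<alpha>) * slope"
    by (simp add: slope_def add_divide_distrib algebra_simps)
  ultimately show ?thesis using gap(3) by linarith
qed

lemma continuous_on_ramp_kernel: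
  assumes "continuous_on X D"
  shows "continuous_on ({0..b} \<times> X) (\<lambda>z. ramp_kernel b k \<sigma> (fst z) (D (snd z)))"
proof -
  have "continuous_on ({0..b} \<times> X) (\<lambda>z. D (snd z))"
    "continuous_on ({0..b} \<times> X) (\<lambda>z. tail b (ramp_exp (Suc k) \<sigma>) (fst z))"
    "continuous_on ({0..b} \<times> X) (\<lambda>z. ramp_exp j \<sigma> (fst z))" for j
    by (intro continuous_on_compose2[OF assms] continuous_on_compose2[OF continuous_on_tail]
        continuous_on_compose2[OF continuous_on_ramp_exp[of UNIV]] continuous_on_ramp_exp
        continuous_on_fst continuous_on_snd continuous_on_id; auto)+
  then show ?thesis unfolding ramp_kernel_def by (intro continuous_intros)
qed

lemma mult_kernel_le_cone_weight:
  assumes z: "0 < fst z" "fst z < T" "norm (snd z) \<le> fst z + R" and B: "0 \<le> B" and "0 \<le> C"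
    and \<kappa>: "\<bar>\<kappa>\<bar> \<le> B * ramp_exp k \<sigma> (fst z) * \<psi>" and \<psi>: "\<psi> \<le> C * radial_weight s (norm (snd z))"
  shows "y * \<kappa> \<le> B * C * (\<bar>y\<bar> * (light_cone_weight s R T z * ramp \<sigma> (fst z) ^ k))"
proof -
  have "y * \<kappa> \<le> \<bar>y\<bar> * \<bar>\<kappa>\<bar>" by (metis abs_ge_self abs_mult)
  also have "\<dots> \<le> \<bar>y\<bar> * (B * ramp_exp k \<sigma> (fst z) * (C * radial_weight s (norm (snd z))))"
    using B by (intro mult_left_mono order_trans[OF \<kappa>] \<psi> mult_nonneg_nonneg ramp_exp_nonneg) auto
  also have "\<dots> = B * C * (\<bar>y\<bar> * (light_cone_weight s R T z * ramp \<sigma> (fst z) ^ k))"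
    using z by (simp add: light_cone_weight_def ramp_exp_def)
  finally show ?thesis .
qed

context weak_wave
begin

lemma light_cone_mass_integrable:
  fixes f :: "real \<Rightarrow> 'a \<Rightarrow> real"
  assumes f: "strip_integrable T (\<lambda>z. f (fst z) (snd z))" and "0 \<le> s" "1 \<le> k" "1 \<le> \<sigma>" "\<sigma> < T"
  shows "integrable lborel
      (\<lambda>z. f (fst z) (snd z) * (light_cone_weight s R T z * ramp \<sigma> (fst z) ^ k))"
proof (rule cylinder_bounded_mult_integrable[OF f \<open>\<sigma> < T\<close>])
  have [measurable]: "light_cone_weight s R T
      \<in> borel_measurable (borel \<Otimes>\<^sub>M borel :: (real \<times> 'a) measure)"
    using light_cone_weight_measurable by (simp add: borel_prod)
  have "(\<lambda>z::real \<times> 'a. light_cone_weight s R T z * ramp \<sigma> (fst z) ^ k)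
      \<in> borel_measurable (borel \<Otimes>\<^sub>M borel)"
    by measurable
  then show "(\<lambda>z::real \<times> 'a. light_cone_weight s R T z * ramp \<sigma> (fst z) ^ k)
      \<in> borel_measurable borel"
    by (simp add: borel_prod)
  fix z :: "real \<times> 'a"
  show "\<bar>light_cone_weight s R T z * ramp \<sigma> (fst z) ^ k\<bar> \<le> exp R"
  proof (cases "0 < fst z")
    case True
    then have "light_cone_weight s R T z * ramp \<sigma> (fst z) ^ k \<le> exp R * 1"
      using assms by (intro mult_mono power_le_one light_cone_weight_le ramp_le_1 zero_le_power
          ramp_nonneg) auto
    then show ?thesis by (simp add: abs_mult light_cone_weight_nonneg ramp_nonneg)
  qed (simp add: light_cone_weight_def)
  show "light_cone_weight s R T z * ramp \<sigma> (fst z) ^ k = 0" if "z \<notin> cylinder \<sigma>"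
    using that assms ramp_power_eq_0[of \<sigma> "fst z" k]
    by (cases z) (auto simp: cylinder_def light_cone_weight_def)
qed

lemma nonlinearity_integral_ge:
  fixes \<phi> :: "real \<Rightarrow> real"
  assumes N: "\<And>t x. 0 \<le> N t x" and \<phi>: "continuous_on UNIV \<phi>" "\<And>r. 0 \<le> \<phi> r"
      "\<And>r. 0 \<le> r \<Longrightarrow> c * radial_weight s r \<le> \<phi> r"
    and "0 \<le> s" "1 \<le> \<sigma>" "\<sigma> \<le> b" "b < T"
  shows "c * light_cone_mass s R T (Suc k) \<sigma> N \<le>
    (LINT z:cylinder b|lborel. N (fst z) (snd z) * (ramp_exp (Suc k) \<sigma> (fst z) * \<phi> (norm (snd z))))"
  unfolding light_cone_mass_def set_lebesgue_integral_def integral_mult_right_zero[symmetric]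
proof (rule integral_mono)
  show "integrable lborel (\<lambda>z. c * (N (fst z) (snd z) *
      (light_cone_weight s R T z * ramp \<sigma> (fst z) ^ Suc k)))"
    using assms by (intro integrable_mult_right light_cone_mass_integrable N_strip_integrable) auto
  have "set_integrable lborel (cylinder b)
      (\<lambda>z. N (fst z) (snd z) * (ramp_exp (Suc k) \<sigma> (fst z) * \<phi> (norm (snd z))))"
    by (intro cylinder_continuous_mult_integrable N_strip_integrable assms continuous_on_tensor
        continuous_on_ramp_exp continuous_on_compose2[OF \<phi>(1)] continuous_on_norm_id) auto
  then show "integrable lborel (\<lambda>z. indicator (cylinder b) z *\<^sub>R
      (N (fst z) (snd z) * (ramp_exp (Suc k) \<sigma> (fst z) * \<phi> (norm (snd z)))))"
    by (simp add: set_integrable_def)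
  fix z :: "real \<times> 'a"
  show "c * (N (fst z) (snd z) * (light_cone_weight s R T z * ramp \<sigma> (fst z) ^ Suc k)) \<le>
      indicator (cylinder b) z *\<^sub>R
        (N (fst z) (snd z) * (ramp_exp (Suc k) \<sigma> (fst z) * \<phi> (norm (snd z))))"
  proof (cases "0 < fst z \<and> fst z < \<sigma> \<and> norm (snd z) \<le> fst z + R")
    case True
    have "(N (fst z) (snd z) * ramp_exp (Suc k) \<sigma> (fst z)) * (c * radial_weight s (norm (snd z)))
        \<le> (N (fst z) (snd z) * ramp_exp (Suc k) \<sigma> (fst z)) * \<phi> (norm (snd z))"
      by (intro mult_left_mono mult_nonneg_nonneg N ramp_exp_nonneg \<phi>(3)) auto
    moreover have "z \<in> cylinder b" using True assms by (cases z) (auto simp: cylinder_def)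
    ultimately show ?thesis
      using True assms by (simp add: light_cone_weight_def ramp_exp_def mult_ac)
  next
    case False
    then have "light_cone_weight s R T z * ramp \<sigma> (fst z) ^ Suc k = 0"
      using assms by (auto simp: light_cone_weight_def ramp_eq_0)
    then show ?thesis
      by (simp only: mult_zero_right) (simp add: N \<phi>(2) ramp_exp_nonneg)
  qed
qed

lemma cylinder_kernel_integral_le:
  fixes \<phi> :: "real \<Rightarrow> real" and K :: "real \<times> 'a \<Rightarrow> real"
  assumes \<phi>: "\<And>r. 0 \<le> \<phi> r" "\<And>r. 0 \<le> r \<Longrightarrow> \<phi> r \<le> C * radial_weight s r"
    and K: "continuous_on ({0..b} \<times> cball 0 (T + R)) K" "0 \<le> B"
      "\<And>z. z \<in> cylinder b \<Longrightarrow> \<bar>K z\<bar> \<le> B * ramp_exp k \<sigma> (fst z) * \<phi> (norm (snd z))"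
    and "0 \<le> C" "0 \<le> s" "1 \<le> k" "1 \<le> \<sigma>" "\<sigma> < T" "b < T"
  shows "(LINT z:cylinder b|lborel. wt (fst z) (snd z) * K z) \<le>
    B * C * light_cone_mass s R T k \<sigma> (\<lambda>t x. \<bar>wt t x\<bar>)"
  unfolding light_cone_mass_def set_lebesgue_integral_def integral_mult_right_zero[symmetric]
proof (rule integral_mono_AE)
  show "integrable lborel (\<lambda>z. indicator (cylinder b) z *\<^sub>R (wt (fst z) (snd z) * K z))"
    unfolding set_integrable_def[symmetric]
    by (intro cylinder_continuous_mult_integrable wt_strip_integrable K assms)
  have "strip_integrable T (\<lambda>z. \<bar>wt (fst z) (snd z)\<bar>)"
    using wt_strip_integrable by (auto simp: strip_integrable_def intro: set_integrable_abs)
  then show "integrable lborel (\<lambda>z. B * C * (\<bar>wt (fst z) (snd z)\<bar> *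
      (light_cone_weight s R T z * ramp \<sigma> (fst z) ^ k)))"
    using assms by (intro integrable_mult_right light_cone_mass_integrable) auto
  show "AE z in lborel. indicator (cylinder b) z *\<^sub>R (wt (fst z) (snd z) * K z) \<le>
      B * C * (\<bar>wt (fst z) (snd z)\<bar> * (light_cone_weight s R T z * ramp \<sigma> (fst z) ^ k))"
    using wt_cone
  proof eventually_elim
    case (elim z)
    show ?case
    proof (cases "z \<in> cylinder b \<and> norm (snd z) \<le> fst z + R")
      case True
      then have z: "0 < fst z" "fst z < T" "norm (snd z) \<le> fst z + R"
        using \<open>b < T\<close> by (auto simp: cylinder_def)
      have "wt (fst z) (snd z) * K z \<le> B * C * (\<bar>wt (fst z) (snd z)\<bar> *
          (light_cone_weight s R T z * ramp \<sigma> (fst z) ^ k))"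
        by (rule mult_kernel_le_cone_weight[OF z K(2) \<open>0 \<le> C\<close> K(3) \<phi>(2)]) (use True in auto)
      then show ?thesis using True by simp
    next
      case False
      then have "indicator (cylinder b) z *\<^sub>R (wt (fst z) (snd z) * K z) = 0"
        using elim \<open>b < T\<close> by (auto simp: cylinder_def indicator_def)
      moreover have "0 \<le> B * C * (\<bar>wt (fst z) (snd z)\<bar> *
          (light_cone_weight s R T z * ramp \<sigma> (fst z) ^ k))"
        using assms by (intro mult_nonneg_nonneg light_cone_weight_nonneg zero_le_power
            ramp_nonneg) auto
      ultimately show ?thesis by (simp only:)
    qed
  qed
qed

lemma data_integral_ge:
  assumes data: "\<And>x. 0 \<le> w0 x" "\<And>x. 0 \<le> w1 x" and D: "\<And>x. 0 \<le> D x"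
    and \<phi>: "continuous_on UNIV \<phi>" "\<And>r. 0 \<le> \<phi> r" and m: "0 \<le> m" "m \<le> A" "m \<le> B"
  shows "m * (LINT x:cball 0 R|lborel. (w0 x + w1 x) * \<phi> (norm x)) \<le>
    A * (LINT x:cball 0 R|lborel. w1 x * \<phi> (norm x)) +
    B * (LINT x:cball 0 R|lborel. w0 x * ((1 + D x) * \<phi> (norm x)))"
proof -
  have \<phi>_cont: "continuous_on X (\<lambda>x::'a. \<phi> (norm x))" for X
    by (intro continuous_on_compose2[OF \<phi>(1)] continuous_on_norm_id) auto
  have int: "set_integrable lborel (cball 0 R) h" if "continuous_on UNIV h" for h :: "'a \<Rightarrow> real"
    unfolding set_integrable_def
    by (intro borel_integrable_compact continuous_on_subset[OF that]) auto
  note cont = continuous_on_mult continuous_on_add continuous_on_const \<phi>_cont w0_cont w1_cont D_cont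
  have "m * (LINT x:cball 0 R|lborel. (w0 x + w1 x) * \<phi> (norm x)) =
      m * (LINT x:cball 0 R|lborel. w1 x * \<phi> (norm x)) +
      m * (LINT x:cball 0 R|lborel. w0 x * \<phi> (norm x))"
    unfolding distrib_right by (subst set_integral_add) (auto intro!: int cont simp: distrib_left)
  also have "\<dots> \<le> A * (LINT x:cball 0 R|lborel. w1 x * \<phi> (norm x)) +
      B * (LINT x:cball 0 R|lborel. w0 x * ((1 + D x) * \<phi> (norm x)))"
  proof (intro add_mono mult_mono m)
    show "(LINT x:cball 0 R|lborel. w0 x * \<phi> (norm x)) \<le>
        (LINT x:cball 0 R|lborel. w0 x * ((1 + D x) * \<phi> (norm x)))"
      using data D \<phi>(2) by (intro set_integral_mono int cont mult_left_mono)
        (auto simp: distrib_right)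
  qed (use m data \<phi>(2) in \<open>auto simp: set_lebesgue_integral_def
      intro!: Bochner_Integration.integral_nonneg\<close>)
  finally show ?thesis .
qed

lemma ramp_identity:
  assumes radial: "radial_equation DIM('a) s a \<phi>" and a: "\<And>x. a (norm x) = 1 + D x + V x"
    and k: "1 \<le> k" and \<sigma>: "1 \<le> \<sigma>" "\<sigma> < b" "b < T"
  shows "\<epsilon> * (ramp_exp (Suc k) \<sigma> 0 * (LINT x:cball 0 R|lborel. w1 x * \<phi> (norm x)) +
        tail b (ramp_exp (Suc k) \<sigma>) 0 * (LINT x:cball 0 R|lborel. w0 x * ((1 + D x) * \<phi> (norm x))))
      + (LINT z:cylinder b|lborel.
          N (fst z) (snd z) * (ramp_exp (Suc k) \<sigma> (fst z) * \<phi> (norm (snd z))))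
    = (LINT z:cylinder b|lborel. wt (fst z) (snd z) *
        (ramp_kernel b k \<sigma> (fst z) (D (snd z)) * \<phi> (norm (snd z))))"
proof -
  define \<theta>' where "\<theta>' = (\<lambda>t. - (real (Suc k) / (1 + \<sigma>) * ramp_exp k \<sigma> t + ramp_exp (Suc k) \<sigma> t))"
  have "continuous_on UNIV \<theta>'"
    unfolding \<theta>'_def by (intro continuous_intros continuous_on_ramp_exp)
  moreover have "(ramp_exp (Suc k) \<sigma> has_real_derivative \<theta>' t) (at t)" for t
    unfolding \<theta>'_def by (rule DERIV_ramp_exp[OF k \<sigma>(1)])
  ultimately have identity: "test_identity b (ramp_exp (Suc k) \<sigma>) \<theta>'
      (\<lambda>x. \<phi> (norm x)) (\<lambda>x. a (norm x) * \<phi> (norm x))"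
    using \<sigma> by (intro test_identity_radial[OF _ _ _ _ _ ramp_exp_eq_0 radial]) auto
  have elliptic: "a (norm x) * \<phi> (norm x) - V x * \<phi> (norm x) = (1 + D x) * \<phi> (norm x)" for x :: 'a
    by (simp add: a algebra_simps)
  have kernel: "ramp_exp (Suc k) \<sigma> t * (D x * \<phi> (norm x)) - \<theta>' t * \<phi> (norm x)
      - tail b (ramp_exp (Suc k) \<sigma>) t * ((1 + D x) * \<phi> (norm x)) =
    ramp_kernel b k \<sigma> t (D x) * \<phi> (norm x)" for t x
    by (simp add: ramp_kernel_def \<theta>'_def algebra_simps del: of_nat_Suc)
  from identity show ?thesis
    unfolding test_identity_def elliptic kernel .
qed

proposition cone_inequality:
  assumes radial: "radial_equation DIM('a) s a \<phi>" "0 \<le> s" and a: "\<And>x. a (norm x) = 1 + D x + V x"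
    and comparable: "0 < c" "0 < C" "\<And>r. 0 \<le> r \<Longrightarrow> c * radial_weight s r \<le> \<phi> r"
      "\<And>r. 0 \<le> r \<Longrightarrow> \<phi> r \<le> C * radial_weight s r"
    and D: "\<And>x. 0 \<le> D x" "\<And>x. D x \<le> \<alpha>" and data: "\<And>x. 0 \<le> w0 x" "\<And>x. 0 \<le> w1 x"
    and N: "\<And>t x. 0 \<le> N t x" and \<epsilon>: "0 < \<epsilon>" and k: "1 \<le> k" and \<sigma>: "1 \<le> \<sigma>" "\<sigma> < T"
  shows "\<epsilon> * (ramp_floor (Suc k) * (LINT x:cball 0 R|lborel. (w0 x + w1 x) * \<phi> (norm x)))
      + c * light_cone_mass s R T (Suc k) \<sigma> N
    \<le> (2 + \<alpha>) * real (Suc k) / (1 + \<sigma>) * C * light_cone_mass s R T k \<sigma> (\<lambda>t x. \<bar>wt t x\<bar>)"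
proof -
  interpret radial_equation "DIM('a)" s a \<phi> by (rule radial)
  obtain b where b: "\<sigma> < b" "b < T" using dense[OF \<sigma>(2)] by blast
  have "\<epsilon> * (ramp_floor (Suc k) * (LINT x:cball 0 R|lborel. (w0 x + w1 x) * \<phi> (norm x))) \<le>
      \<epsilon> * (ramp_exp (Suc k) \<sigma> 0 * (LINT x:cball 0 R|lborel. w1 x * \<phi> (norm x)) +
        tail b (ramp_exp (Suc k) \<sigma>) 0 * (LINT x:cball 0 R|lborel. w0 x * ((1 + D x) * \<phi> (norm x))))"
    using \<epsilon> b \<sigma> less_imp_le[OF ramp_floor_pos]
    by (intro mult_left_mono data_integral_ge data D phi_cont phi_nonneg ramp_floor_le) auto
  moreover have "c * light_cone_mass s R T (Suc k) \<sigma> N \<le>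
      (LINT z:cylinder b|lborel.
        N (fst z) (snd z) * (ramp_exp (Suc k) \<sigma> (fst z) * \<phi> (norm (snd z))))"
    using b \<sigma> radial(2)
    by (intro nonlinearity_integral_ge N phi_cont phi_nonneg comparable) auto
  moreover have "(LINT z:cylinder b|lborel. wt (fst z) (snd z) *
        (ramp_kernel b k \<sigma> (fst z) (D (snd z)) * \<phi> (norm (snd z)))) \<le>
      (2 + \<alpha>) * real (Suc k) / (1 + \<sigma>) * C * light_cone_mass s R T k \<sigma> (\<lambda>t x. \<bar>wt t x\<bar>)"
  proof (rule cylinder_kernel_integral_le[OF phi_nonneg comparable(4)])
    have "continuous_on X (\<lambda>z::real \<times> 'a. \<phi> (norm (snd z)))" for X
      by (rule continuous_on_compose2[OF phi_cont[of UNIV]]) (auto intro!: continuous_intros)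
    then show "continuous_on ({0..b} \<times> cball 0 (T + R))
        (\<lambda>z. ramp_kernel b k \<sigma> (fst z) (D (snd z)) * \<phi> (norm (snd z)))"
      by (intro continuous_on_mult continuous_on_ramp_kernel continuous_on_subset[OF D_cont]) auto
    show "\<bar>ramp_kernel b k \<sigma> (fst z) (D (snd z)) * \<phi> (norm (snd z))\<bar>
        \<le> (2 + \<alpha>) * real (Suc k) / (1 + \<sigma>) * ramp_exp k \<sigma> (fst z) * \<phi> (norm (snd z))"
      if "z \<in> cylinder b" for z
      using that b \<sigma> k D unfolding abs_mult abs_of_nonneg[OF phi_nonneg]
      by (intro mult_right_mono abs_ramp_kernel_le phi_nonneg) (auto simp: cylinder_def)
  qed (use b \<sigma> k comparable D[of 0] radial(2) in auto)
  ultimately show ?thesis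
    using ramp_identity[OF radial(1) a k \<sigma>(1) b] by linarith
qed

end

section \<open>Lifespan of the coupled system\<close>

lemma continuous_integral_pos:
  fixes h :: "'a::euclidean_space \<Rightarrow> real"
  assumes h: "continuous_on UNIV h" "\<And>x. 0 \<le> h x" "h x0 \<noteq> 0" "\<And>x. R < norm x \<Longrightarrow> h x = 0"
  shows "0 < (LINT x:cball 0 R|lborel. h x)"
proof -
  have restrict: "indicator (cball 0 R) x *\<^sub>R h x = h x" for x
    using h(4)[of x] by (auto simp: indicator_def)
  have "set_integrable lborel (cball 0 R) h"
    unfolding set_integrable_def
    by (intro borel_integrable_compact continuous_on_subset[OF h(1)]) auto
  then have int: "integrable lborel h"
    by (simp only: set_integrable_def restrict)
  have "open {x. h x \<noteq> 0}"
    using open_Collect_neq[OF h(1) continuous_on_const] by simp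
  moreover from this have "{x. h x \<noteq> 0} \<notin> null_sets lborel"
    using open_not_negligible[of "{x. h x \<noteq> 0}"] null_sets_completionI h(3)
    by (auto simp: negligible_iff_null_sets)
  ultimately have "\<not> (AE x in lborel. h x = 0)"
    using AE_iff_null_sets[of "{x. h x \<noteq> 0}" lborel] by auto
  then have "(\<integral>x. h x \<partial>lborel) \<noteq> 0"
    using integral_nonneg_eq_0_iff_AE[OF int] h(2) by auto
  moreover have "0 \<le> (\<integral>x. h x \<partial>lborel)"
    by (rule Bochner_Integration.integral_nonneg) (rule h(2))
  ultimately show ?thesis
    by (simp only: set_lebesgue_integral_def restrict)
qed

lemma radial_profile_exists:
  fixes f :: "'a::euclidean_space \<Rightarrow> real"
  assumes "continuous_on UNIV f" "radial f"
  obtains g where "continuous_on UNIV g" "\<And>x. f x = g (norm x)" "range g \<subseteq> range f"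
proof -
  obtain e :: 'a where "e \<in> Basis" using nonempty_Basis by blast
  then have "norm (norm x *\<^sub>R e) = norm x" for x :: 'a by simp
  then have "f x = f (norm x *\<^sub>R e)" for x
    using assms(2) unfolding radial_def by metis
  moreover have "continuous_on UNIV (\<lambda>r. f (r *\<^sub>R e))"
    by (rule continuous_on_compose2[OF assms(1)]) (auto intro!: continuous_intros)
  ultimately show ?thesis by (intro that[of "\<lambda>r. f (r *\<^sub>R e)"]) auto
qed

lemma one_plus_powr_le:
  fixes r :: real
  assumes "1 \<le> r" "0 \<le> \<gamma>" "\<gamma> \<le> \<delta>"
  shows "(1 + r) powr (- \<delta>) \<le> r powr (- \<gamma>)"
proof -
  have "(1 + r) powr (- \<delta>) \<le> r powr (- \<delta>)" using assms by (intro powr_mono2') auto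
  also have "\<dots> \<le> r powr (- \<gamma>)" using assms by (intro powr_mono) auto
  finally show ?thesis .
qed

locale wave_data =
  fixes D V w0 w1 :: "'a::euclidean_space \<Rightarrow> real" and s R \<alpha>1 \<alpha>2 \<beta> \<omega> :: real
  assumes dim: "3 \<le> DIM('a)" and dim_eq: "real DIM('a) = 2 * s + 1" and R_pos: "0 < R"
    and decay: "0 \<le> \<alpha>1" "0 \<le> \<alpha>2" "1 < \<beta>" "2 < \<omega>"
    and D_cont: "continuous_on UNIV D" and V_cont: "continuous_on UNIV V"
    and D_radial: "radial D" and V_radial: "radial V"
    and D_nonneg: "\<And>x. 0 \<le> D x" and V_nonneg: "\<And>x. 0 \<le> V x"
    and D_le: "\<And>x. D x \<le> \<alpha>1 * (1 + norm x) powr (- \<beta>)"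
    and V_le: "\<And>x. V x \<le> \<alpha>2 * (1 + norm x) powr (- \<omega>)"
    and w0_smooth: "smooth_fun w0" and w1_smooth: "smooth_fun w1"
    and w0_nonneg: "\<And>x. 0 \<le> w0 x" and w1_nonneg: "\<And>x. 0 \<le> w1 x"
    and w0_support: "\<And>x. R < norm x \<Longrightarrow> w0 x = 0" and w1_support: "\<And>x. R < norm x \<Longrightarrow> w1 x = 0"
    and nontrivial: "(\<exists>x. w0 x \<noteq> 0) \<or> (\<exists>x. w1 x \<noteq> 0)"
begin

lemma D_le_const: "D x \<le> \<alpha>1"
proof -
  have "1 + norm x \<noteq> 0" using norm_ge_zero[of x] by linarith
  then have "(1 + norm x) powr (- \<beta>) \<le> 1" using powr_mono[of "- \<beta>" 0 "1 + norm x"] decay by simp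
  then have "\<alpha>1 * (1 + norm x) powr (- \<beta>) \<le> \<alpha>1 * 1" using decay by (intro mult_left_mono) auto
  then show ?thesis using D_le[of x] by simp
qed

lemma radial_equation_profile:
  obtains a \<phi> and c C :: real where "radial_equation DIM('a) s a \<phi>"
    "\<And>x. a (norm x) = 1 + D x + V x" "0 < c" "0 < C"
    "\<And>r. 0 \<le> r \<Longrightarrow> c * radial_weight s r \<le> \<phi> r"
    "\<And>r. 0 \<le> r \<Longrightarrow> \<phi> r \<le> C * radial_weight s r"
proof -
  obtain a where a_cont: "continuous_on UNIV a" and a_norm: "\<And>x. 1 + D x + V x = a (norm x)"
      and a_range: "range a \<subseteq> range (\<lambda>x. 1 + D x + V x)"
  proof (rule radial_profile_exists)
    show "continuous_on UNIV (\<lambda>x. 1 + D x + V x)" by (intro continuous_intros D_cont V_cont)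
    show "radial (\<lambda>x. 1 + D x + V x)"
      using D_radial V_radial unfolding radial_def by metis
  qed (rule that)
  have a_ge_1: "1 \<le> a r" for r
  proof -
    obtain x where "a r = 1 + D x + V x" using a_range by blast
    then show ?thesis using D_nonneg[of x] V_nonneg[of x] by simp
  qed
  then have a_nonneg: "0 \<le> a r" for r by (rule order_trans[OF zero_le_one])
  let ?\<phi> = "neumann_series DIM('a) a"
  interpret radial_equation "DIM('a)" s a ?\<phi>
    by unfold_locales
      (use a_cont a_nonneg dim_eq in \<open>auto intro: radial_solution_neumann_series\<close>)
  define \<gamma> where "\<gamma> = min \<beta> 2"
  have \<gamma>: "1 < \<gamma>" "\<gamma> \<le> 2" "\<gamma> \<le> \<beta>" "\<gamma> \<le> \<omega>" using decay by (auto simp: \<gamma>_def)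
  have a_decay: "a r \<le> 1 + (\<alpha>1 + \<alpha>2) * r powr (- \<gamma>)" if r: "1 \<le> r" for r
  proof -
    obtain x :: 'a where x: "norm x = r" using vector_choose_size[of r] r by auto
    have "D x \<le> \<alpha>1 * r powr (- \<gamma>)" "V x \<le> \<alpha>2 * r powr (- \<gamma>)"
      using \<gamma> decay r x
      by (auto intro!: order_trans[OF D_le] order_trans[OF V_le] mult_left_mono one_plus_powr_le)
    then show ?thesis unfolding x[symmetric] a_norm[symmetric] by (simp add: distrib_right)
  qed
  obtain c C where "0 < c" "0 < C" "\<And>r. 0 \<le> r \<Longrightarrow> c * radial_weight s r \<le> ?\<phi> r"
      "\<And>r. 0 \<le> r \<Longrightarrow> ?\<phi> r \<le> C * radial_weight s r"
    by (rule phi_comparable_to_weight[OF dim a_ge_1 a_decay _ \<gamma>(1,2)])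
      (use decay in \<open>auto intro: that\<close>)
  then show ?thesis
    by (rule that[OF radial_equation_axioms a_norm[symmetric]])
qed

definition component_bound :: "nat \<Rightarrow> real \<Rightarrow> real \<Rightarrow> bool" where
  "component_bound k c C \<longleftrightarrow> (\<forall>T \<epsilon> N w wt gw \<sigma>.
    weak_wave T \<epsilon> R D V w0 w1 N w wt gw \<longrightarrow> (\<forall>t x. 0 \<le> N t x) \<longrightarrow> 0 < \<epsilon> \<longrightarrow> 1 \<le> \<sigma> \<longrightarrow> \<sigma> < T \<longrightarrow>
      c * \<epsilon> + light_cone_mass s R T (Suc k) \<sigma> N \<le>
        C / (1 + \<sigma>) * light_cone_mass s R T k \<sigma> (\<lambda>t x. \<bar>wt t x\<bar>))"

lemma component_boundD:
  assumes "component_bound k c C" "weak_wave T \<epsilon> R D V w0 w1 N w wt gw" "\<And>t x. 0 \<le> N t x"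
    and "0 < \<epsilon>" "1 \<le> \<sigma>" "\<sigma> < T"
  shows "c * \<epsilon> + light_cone_mass s R T (Suc k) \<sigma> N \<le>
    C / (1 + \<sigma>) * light_cone_mass s R T k \<sigma> (\<lambda>t x. \<bar>wt t x\<bar>)"
  using assms unfolding component_bound_def by blast

lemma component_bound_weaken:
  assumes "component_bound k c C" "c' \<le> c" "C \<le> C'"
  shows "component_bound k c' C'"
  unfolding component_bound_def
proof (intro allI impI)
  fix T \<epsilon> \<sigma> and N w wt :: "real \<Rightarrow> 'a \<Rightarrow> real" and gw
  let ?mass = "light_cone_mass s R T k \<sigma> (\<lambda>t x. \<bar>wt t x\<bar>)"
  assume wave: "weak_wave T \<epsilon> R D V w0 w1 N w wt gw" "\<forall>t x. 0 \<le> N t x" "0 < \<epsilon>" "1 \<le> \<sigma>" "\<sigma> < T"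
  then have "c * \<epsilon> + light_cone_mass s R T (Suc k) \<sigma> N \<le> C / (1 + \<sigma>) * ?mass"
    by (intro component_boundD[OF assms(1)]) auto
  moreover have "c' * \<epsilon> \<le> c * \<epsilon>" using assms(2) wave(3) by (intro mult_right_mono) auto
  moreover have "C / (1 + \<sigma>) * ?mass \<le> C' / (1 + \<sigma>) * ?mass"
    using assms(3) wave(4) by (intro mult_right_mono divide_right_mono light_cone_mass_nonneg) auto
  ultimately show "c' * \<epsilon> + light_cone_mass s R T (Suc k) \<sigma> N \<le> C' / (1 + \<sigma>) * ?mass"
    by linarith
qed

proposition component_bound_exists:
  assumes k: "1 \<le> k"
  obtains c C where "0 < c" "0 < C" "component_bound k c C"
proof -
  obtain a \<phi> and c C :: real where radial: "radial_equation DIM('a) s a \<phi>"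
      and a: "\<And>x. a (norm x) = 1 + D x + V x"
      and comparable: "0 < c" "0 < C" "\<And>r. 0 \<le> r \<Longrightarrow> c * radial_weight s r \<le> \<phi> r"
      "\<And>r. 0 \<le> r \<Longrightarrow> \<phi> r \<le> C * radial_weight s r"
    by (rule radial_equation_profile) (rule that)
  interpret radial_equation "DIM('a)" s a \<phi> by (rule radial)
  define data where "data = (LINT x:cball 0 R|lborel. (w0 x + w1 x) * \<phi> (norm x))"
  obtain x0 where "w0 x0 \<noteq> 0 \<or> w1 x0 \<noteq> 0" using nontrivial by blast
  then have "(w0 x0 + w1 x0) * \<phi> (norm x0) \<noteq> 0"
    using w0_nonneg[of x0] w1_nonneg[of x0] phi_pos[of "norm x0"] by auto
  moreover have "continuous_on UNIV (\<lambda>x::'a. \<phi> (norm x))"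
    by (rule continuous_on_compose2[OF phi_cont[of UNIV] continuous_on_norm_id]) simp
  ultimately have "0 < data"
    unfolding data_def using w0_nonneg w1_nonneg phi_nonneg w0_support w1_support
    by (intro continuous_integral_pos continuous_on_mult continuous_on_add
        smooth_fun_continuous[OF w0_smooth] smooth_fun_continuous[OF w1_smooth]) auto
  define c' where "c' = ramp_floor (Suc k) * data / c"
  define C' where "C' = (2 + \<alpha>1) * real (Suc k) * C / c"
  have "component_bound k c' C'"
    unfolding component_bound_def
  proof (intro allI impI)
    fix T \<epsilon> N w wt gw \<sigma>
    assume "weak_wave T \<epsilon> R D V w0 w1 N w wt gw" and N: "\<forall>t x. 0 \<le> N t x"
      and \<epsilon>: "0 < \<epsilon>" and \<sigma>: "1 \<le> \<sigma>" "\<sigma> < T"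
    then interpret weak_wave T \<epsilon> R D V w0 w1 N w wt gw by simp
    have "\<epsilon> * (ramp_floor (Suc k) * data) + c * light_cone_mass s R T (Suc k) \<sigma> N
        \<le> (2 + \<alpha>1) * real (Suc k) / (1 + \<sigma>) * C * light_cone_mass s R T k \<sigma> (\<lambda>t x. \<bar>wt t x\<bar>)"
      unfolding data_def
      by (rule cone_inequality[OF radial _ a comparable D_nonneg D_le_const w0_nonneg w1_nonneg
            N[rule_format] \<epsilon> k \<sigma>]) (use dim dim_eq in simp)
    from divide_right_mono[OF this, of c]
    show "c' * \<epsilon> + light_cone_mass s R T (Suc k) \<sigma> N \<le>
        C' / (1 + \<sigma>) * light_cone_mass s R T k \<sigma> (\<lambda>t x. \<bar>wt t x\<bar>)"
      using comparable(1) by (simp add: c'_def C'_def add_divide_distrib mult_ac)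
  qed
  then show ?thesis
    using \<open>0 < data\<close> comparable decay ramp_floor_pos[of "Suc k"]
    by (intro that[of c' C']) (auto simp: c'_def C'_def)
qed

end

lemma exponent_step_exists:
  fixes p q :: real
  assumes "1 < p" "1 < q"
  obtains k :: nat where "1 \<le> k" "real (Suc k) \<le> p * real k" "real (Suc k) \<le> q * real k"
proof -
  obtain k :: nat where "max (1 / (p - 1)) (1 / (q - 1)) < real k"
    using reals_Archimedean2 by blast
  then have "1 < (p - 1) * real k" "1 < (q - 1) * real k"
    using assms by (simp_all add: pos_divide_less_eq mult.commute)
  moreover from this have "k \<noteq> 0" by (intro notI) simp
  ultimately show ?thesis by (intro that[of k]) (auto simp: algebra_simps)
qed

lemma admissible_of_weak_wave:
  fixes f :: "real \<Rightarrow> 'a::euclidean_space \<Rightarrow> real"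
  assumes wave: "weak_wave T \<epsilon> R D V w0 w1 (\<lambda>t x. \<bar>f t x\<bar> powr p) w wt gw"
    and f: "(\<lambda>z. f (fst z) (snd z)) \<in> borel_measurable borel"
    and cone: "cone_weight (lborel :: (real \<times> 'a) measure) fst (light_cone_weight s R T) s C0 T"
  shows "cone_weight.admissible lborel fst (light_cone_weight s R T) T p (\<lambda>z. \<bar>f (fst z) (snd z)\<bar>)"
proof -
  interpret weak_wave T \<epsilon> R D V w0 w1 "\<lambda>t x. \<bar>f t x\<bar> powr p" w wt gw by (rule wave)
  interpret cone_weight "lborel :: (real \<times> 'a) measure" fst "light_cone_weight s R T" s C0 T
    by (rule cone)
  have "integrable lborel (\<lambda>z. if fst z < \<sigma>
      then \<bar>f (fst z) (snd z)\<bar> powr p * light_cone_weight s R T z else 0)" if "1 \<le> \<sigma>" "\<sigma> < T" for \<sigma>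
  proof -
    let ?W = "\<lambda>z::real \<times> 'a. if fst z < \<sigma> then light_cone_weight s R T z else 0"
    have "integrable lborel (\<lambda>z. \<bar>f (fst z) (snd z)\<bar> powr p * ?W z)"
    proof (rule cylinder_bounded_mult_integrable[OF N_strip_integrable \<open>\<sigma> < T\<close>])
      show "?W \<in> borel_measurable borel"
        using time_meas W_meas by measurable
      show "\<bar>?W z\<bar> \<le> exp R" for z
        using light_cone_weight_le[of s R T z] s_pos by (simp add: light_cone_weight_nonneg)
      show "?W z = 0" if "z \<notin> cylinder \<sigma>" for z
        using that \<open>\<sigma> < T\<close> by (cases z) (auto simp: cylinder_def light_cone_weight_def)
    qed
    then show ?thesis by (simp add: if_distrib[of "\<lambda>y. _ * y"] cong: if_cong)
  qed
  then show ?thesis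
    using f by (auto simp: admissible_def)
qed

locale coupled_wave_data =
  u: wave_data D1 V1 u0 u1 s R \<alpha>1 \<alpha>2 \<beta> \<omega> + v: wave_data D2 V2 v0 v1 s R \<alpha>1 \<alpha>2 \<beta> \<omega>
  for D1 D2 V1 V2 u0 u1 v0 v1 :: "'a::euclidean_space \<Rightarrow> real" and s R \<alpha>1 \<alpha>2 \<beta> \<omega> :: real +
  fixes p q :: real
  assumes p: "1 < p" and q: "1 < q"
begin

lemma weak_solution_weak_wave:
  assumes sol: "weak_solution p q D1 D2 V1 V2 u0 u1 v0 v1 \<epsilon> T u ut gu v vt gv"
    and supp: "supp_in_cone R T u v"
  shows "weak_wave T \<epsilon> R D1 V1 u0 u1 (\<lambda>t x. \<bar>vt t x\<bar> powr p) u ut gu"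
    and "weak_wave T \<epsilon> R D2 V2 v0 v1 (\<lambda>t x. \<bar>ut t x\<bar> powr q) v vt gv"
proof -
  have regular: "C1_L2 T u ut" "C1_L2 T v vt" "(\<lambda>z. ut (fst z) (snd z)) \<in> borel_measurable borel"
      "(\<lambda>z. vt (fst z) (snd z)) \<in> borel_measurable borel"
    using sol by (auto simp: weak_solution_def Lp_loc_def)
  have cone: "AE x in lborel. t + R < norm x \<longrightarrow> u t x = 0"
      "AE x in lborel. t + R < norm x \<longrightarrow> v t x = 0"
    if "t \<in> {0..<T}" for t
  proof -
    have "AE x in lborel. t + R < norm x \<longrightarrow> u t x = 0 \<and> v t x = 0"
      using supp that by (simp add: supp_in_cone_def)
    then show "AE x in lborel. t + R < norm x \<longrightarrow> u t x = 0"
        "AE x in lborel. t + R < norm x \<longrightarrow> v t x = 0"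
      by (auto elim: eventually_mono)
  qed
  have powr_cone: "AE z in lborel. 0 < fst z \<and> fst z < T \<and> fst z + R < norm (snd z) \<longrightarrow>
      \<bar>ut (fst z) (snd z)\<bar> powr q = 0"
    "AE z in lborel. 0 < fst z \<and> fst z < T \<and> fst z + R < norm (snd z) \<longrightarrow>
      \<bar>vt (fst z) (snd z)\<bar> powr p = 0"
    using time_derivative_cone_AE[OF regular(1,3) cone(1)]
      time_derivative_cone_AE[OF regular(2,4) cone(2)]
    by (auto elim: eventually_mono)
  note data_cont = smooth_fun_continuous[OF u.w0_smooth] smooth_fun_continuous[OF u.w1_smooth]
    smooth_fun_continuous[OF v.w0_smooth] smooth_fun_continuous[OF v.w1_smooth]
  note facts = sol[unfolded weak_solution_def] cone powr_cone regular data_cont u.R_pos u.D_cont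
    u.V_cont
    v.D_cont v.V_cont u.w0_support u.w1_support v.w0_support v.w1_support
  show "weak_wave T \<epsilon> R D1 V1 u0 u1 (\<lambda>t x. \<bar>vt t x\<bar> powr p) u ut gu"
    "weak_wave T \<epsilon> R D2 V2 v0 v1 (\<lambda>t x. \<bar>ut t x\<bar> powr q) v vt gv"
    by (unfold_locales; use facts in blast)+
qed

abbreviation velocity_pair ::
  "real \<Rightarrow> nat \<Rightarrow> real \<Rightarrow> real \<Rightarrow> (real \<Rightarrow> 'a \<Rightarrow> real) \<Rightarrow> (real \<Rightarrow> 'a \<Rightarrow> real) \<Rightarrow> bool" where
  "velocity_pair T k \<delta> C ut vt \<equiv> coupled_pair lborel fst (light_cone_weight s R T) s
    (cone_constant s R) T k p q \<delta> C (\<lambda>z. \<bar>vt (fst z) (snd z)\<bar>) (\<lambda>z. \<bar>ut (fst z) (snd z)\<bar>)"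

lemma velocity_pair_of_component_bounds:
  assumes k: "1 \<le> k" "real (Suc k) \<le> p * real k" "real (Suc k) \<le> q * real k"
    and bounds: "u.component_bound k c C" "v.component_bound k c C" "0 < c" "0 < C"
    and \<epsilon>: "0 < \<epsilon>" and sol: "weak_solution p q D1 D2 V1 V2 u0 u1 v0 v1 \<epsilon> T u ut gu v vt gv"
    and supp: "supp_in_cone R T u v"
  shows "velocity_pair T k (c * \<epsilon>) C ut vt"
proof -
  note waves = weak_solution_weak_wave[OF sol supp]
  have meas: "(\<lambda>z. ut (fst z) (snd z)) \<in> borel_measurable borel"
      "(\<lambda>z. vt (fst z) (snd z)) \<in> borel_measurable borel"
    using sol by (auto simp: weak_solution_def Lp_loc_def)
  have "0 < s" using u.dim u.dim_eq by simp
  note cone = cone_weight_light_cone_weight[OF u.dim_eq this u.R_pos, of T]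
  interpret cone_weight "lborel :: (real \<times> 'a) measure" fst "light_cone_weight s R T" s
    "cone_constant s R" T by (rule cone)
  have mass_eq: "ramp_mass 0 j \<sigma> (\<lambda>z. f (fst z) (snd z)) = light_cone_mass s R T j \<sigma> f" for j \<sigma> f
    by (simp add: ramp_mass_def light_cone_mass_def mult.assoc)
  show ?thesis
  proof unfold_locales
    show "admissible p (\<lambda>z. \<bar>vt (fst z) (snd z)\<bar>)" "admissible q (\<lambda>z. \<bar>ut (fst z) (snd z)\<bar>)"
      by (rule admissible_of_weak_wave[OF waves(1) meas(2) cone]
          admissible_of_weak_wave[OF waves(2) meas(1) cone])+
    fix \<sigma> assume \<sigma>: "1 \<le> \<sigma>" "\<sigma> < T"
    show "c * \<epsilon> + power_mass k p (\<lambda>z. \<bar>vt (fst z) (snd z)\<bar>) \<sigma> \<le>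
        C / (1 + \<sigma>) * ramp_mass 0 k \<sigma> (\<lambda>z. \<bar>ut (fst z) (snd z)\<bar>)"
      unfolding power_mass_def mass_eq[of _ _ "\<lambda>t x. \<bar>vt t x\<bar> powr p"]
        mass_eq[of _ _ "\<lambda>t x. \<bar>ut t x\<bar>"]
      by (rule u.component_boundD[OF bounds(1) waves(1) _ \<epsilon> \<sigma>]) simp
    show "c * \<epsilon> + power_mass k q (\<lambda>z. \<bar>ut (fst z) (snd z)\<bar>) \<sigma> \<le>
        C / (1 + \<sigma>) * ramp_mass 0 k \<sigma> (\<lambda>z. \<bar>vt (fst z) (snd z)\<bar>)"
      unfolding power_mass_def mass_eq[of _ _ "\<lambda>t x. \<bar>ut t x\<bar> powr q"]
        mass_eq[of _ _ "\<lambda>t x. \<bar>vt t x\<bar>"]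
      by (rule v.component_boundD[OF bounds(2) waves(2) _ \<epsilon> \<sigma>]) simp
  qed (use p q k bounds \<epsilon> in auto)
qed

proposition lifespan_le_bound:
  assumes "0 \<le> GammaGG DIM('a) p q"
  obtains K where "0 < K" "\<And>\<epsilon>. 0 < \<epsilon> \<Longrightarrow> lifespan p q D1 D2 V1 V2 u0 u1 v0 v1 R \<epsilon> \<le>
    ereal (lifespan_bound (GammaGG DIM('a) p q) p q K \<epsilon>)"
proof -
  obtain k where k: "1 \<le> k" "real (Suc k) \<le> p * real k" "real (Suc k) \<le> q * real k"
    by (rule exponent_step_exists[OF p q])
  obtain cu Cu where cu: "0 < cu" "0 < Cu" "u.component_bound k cu Cu"
    by (rule u.component_bound_exists[OF k(1)])
  obtain cv Cv where cv: "0 < cv" "0 < Cv" "v.component_bound k cv Cv"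
    by (rule v.component_bound_exists[OF k(1)])
  define c where "c = min cu cv"
  define C where "C = max Cu Cv"
  have constants: "0 < c" "0 < C" "0 < cone_constant s R"
    using cu cv by (auto simp: c_def C_def cone_constant_def less_max_iff_disj)
  have bounds: "u.component_bound k c C" "v.component_bound k c C"
    using cu(3) cv(3) by (auto simp: c_def C_def
        intro: u.component_bound_weaken v.component_bound_weaken)
  have s_eq: "(real DIM('a) - 1) / 2 = s" using u.dim_eq by simp
  obtain K where K: "0 < K" and T_le: "\<And>(M :: (real \<times> 'a) measure) time W T k f g \<epsilon>.
      coupled_pair M time W s (cone_constant s R) T k p q (c * \<epsilon>) C f g \<Longrightarrow> 0 < \<epsilon> \<Longrightarrow>
      T \<le> lifespan_bound (GammaGG DIM('a) p q) p q K \<epsilon>"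
    by (rule coupled_pair_lifespan[OF p q assms constants, where 'b = "real \<times> 'a", unfolded s_eq])
      (rule that)
  have "lifespan p q D1 D2 V1 V2 u0 u1 v0 v1 R \<epsilon> \<le>
      ereal (lifespan_bound (GammaGG DIM('a) p q) p q K \<epsilon>)" if "0 < \<epsilon>" for \<epsilon>
    unfolding lifespan_def
    using T_le[OF velocity_pair_of_component_bounds[OF k bounds constants(1,2) that] that]
    by (intro SUP_least) auto
  with K show ?thesis by (rule that)
qed

end

theorem theorem1p2:
  fixes D1 D2 V1 V2 u0 u1 v0 v1 :: "'a::euclidean_space \<Rightarrow> real"
    and p q R \<alpha>1 \<alpha>2 \<beta> \<omega> :: real
  assumes n3: "DIM('a) \<ge> 3"
    and pq: "p > 1" "q > 1"
    and const_asm: "\<alpha>1 \<ge> 0" "\<alpha>2 \<ge> 0" "\<beta> > 1" "\<omega> > 2"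
    and coeff_reg: "\<forall>f\<in>{D1, D2, V1, V2}. continuous_on UNIV f \<and> (\<exists>\<delta>>0. hoelder_ball \<delta> f) \<and> radial f"
    and D_bd: "\<forall>x. 0 \<le> D1 x \<and> D1 x \<le> \<alpha>1 * (1 + norm x) powr (- \<beta>)"
              "\<forall>x. 0 \<le> D2 x \<and> D2 x \<le> \<alpha>1 * (1 + norm x) powr (- \<beta>)"
    and V_bd: "\<forall>x. 0 \<le> V1 x \<and> V1 x \<le> \<alpha>2 * (1 + norm x) powr (- \<omega>)"
              "\<forall>x. 0 \<le> V2 x \<and> V2 x \<le> \<alpha>2 * (1 + norm x) powr (- \<omega>)"
    and R: "R > 0"
    and data: "\<forall>f\<in>{u0, u1, v0, v1}. smooth_fun f \<and> (\<forall>x. 0 \<le> f x) \<and> (\<forall>x. norm x > R \<longrightarrow> f x = 0)"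
    and nontriv: "(\<exists>x. u0 x \<noteq> 0) \<or> (\<exists>x. u1 x \<noteq> 0)" "(\<exists>x. v0 x \<noteq> 0) \<or> (\<exists>x. v1 x \<noteq> 0)"
    and Gamma: "GammaGG DIM('a) p q \<ge> 0"
  shows "(\<forall>\<epsilon>>0. lifespan p q D1 D2 V1 V2 u0 u1 v0 v1 R \<epsilon> < \<infinity>) \<and>
    (\<exists>\<epsilon>0>0. \<exists>C>0. \<forall>\<epsilon>. 0 < \<epsilon> \<and> \<epsilon> < \<epsilon>0 \<longrightarrow>
       lifespan p q D1 D2 V1 V2 u0 u1 v0 v1 R \<epsilon> \<le> ereal
        (if GammaGG DIM('a) p q > 0 then C * \<epsilon> powr (- (1 / GammaGG DIM('a) p q))
         else if p \<noteq> q then exp (C * \<epsilon> powr (- (p * q - 1)))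
         else exp (C * \<epsilon> powr (- (p - 1)))))"
proof -
  let ?\<Gamma> = "GammaGG DIM('a) p q"
  let ?T = "lifespan p q D1 D2 V1 V2 u0 u1 v0 v1 R"
  obtain s where "real DIM('a) = 2 * s + 1"
    using that[of "(real DIM('a) - 1) / 2"] by (simp add: field_simps)
  then interpret coupled_wave_data D1 D2 V1 V2 u0 u1 v0 v1 s R \<alpha>1 \<alpha>2 \<beta> \<omega> p q
    by unfold_locales (use assms in auto)
  obtain K where K: "0 < K" and T_le: "\<And>\<epsilon>. 0 < \<epsilon> \<Longrightarrow> ?T \<epsilon> \<le> ereal (lifespan_bound ?\<Gamma> p q K \<epsilon>)"
    by (rule lifespan_le_bound[OF Gamma]) (rule that)
  have "?T \<epsilon> < \<infinity>" if "0 < \<epsilon>" for \<epsilon>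
    by (rule le_less_trans[OF T_le[OF that]]) simp
  moreover have "\<forall>\<epsilon>. 0 < \<epsilon> \<and> \<epsilon> < 1 \<longrightarrow> ?T \<epsilon> \<le> ereal
      (if ?\<Gamma> > 0 then 2 * K * \<epsilon> powr (- (1 / ?\<Gamma>))
       else if p \<noteq> q then exp (2 * K * \<epsilon> powr (- (p * q - 1)))
       else exp (2 * K * \<epsilon> powr (- (p - 1))))"
    using order_trans[OF T_le] lifespan_bound_le[OF Gamma pq K] by simp
  moreover have "0 < 2 * K" using K by simp
  ultimately show ?thesis by (blast intro: zero_less_one)
qed

end
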